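(* Let $p>q\ge 0$ and $d\ge1$ be integers, and let $Y=(Y_t)_{t\in\mathbb{R}}$ be the $d$-dimensional MCARMA process with autoregressive polynomial $P(z)=I_dz^p+A_1z^{p-1}+\dots+A_p$ and moving average polynomial $Q(z)=B_0z^q+\dots+B_q$, where all zeros of $\det P$ have negative real part. For $\Delta>0$ let $f_\Delta$ be the spectral density matrix of the sampled process $(Y_{n\Delta})_{n\in\mathbb{Z}}$. Let $\lambda_1,\dots,\lambda_m$ be the different zeros of $\det P(z)$, with multiplicities $\nu_1,\dots,\nu_m$. Then for all $\Delta>0$ and $\omega\in(-\pi,\pi)$ $$\begin{aligned}f_\Delta(\omega)={}&\frac1{4\pi}\sum_{\ell=1}^{m}\frac{e^{-\mathfrak{i}\omega}\bigl(\alpha(\ell,1)-\alpha(\ell,1)^\top\bigr)-e^{\Delta\lambda_\ell}\alpha(\ell,1)+e^{-\Delta\lambda_\ell}\alpha(\ell,1)^\top}{\cosh\Delta\lambda_\ell-\cos\omega}\\&+\sum_{\ell=1}^m\sum_{j=2}^{\nu_\ell}\frac{s_j^\Delta(\omega,\lambda_\ell)\,\alpha(\ell,j)^\top+s_j^\Delta(-\omega,\lambda_\ell)\,\alpha(\ell,j)}{(\cosh\Delta\lambda_\ell-\cos\omega)^j},\end{aligned}$$ where the $s_j^\Delta(\omega,\lambda_\ell)$ are (suitable) trigonometric polynomials in $\omega$ of degree $j-1$ (scalar-valued, with complex coefficients), whose coefficients depend on $\Delta$ and $\lambda_\ell$ (and $j$), and the coefficient matrices $\alpha(\ell,j)\in\mathbb{C}^{d\times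 d}$ come from the partial fraction decomposition $$R(z)=\sum_{\ell=1}^{m}\sum_{j=1}^{\nu_\ell}\left(\frac{\alpha(\ell,j)}{(z-\lambda_\ell)^j}+\frac{\beta(\ell,j)}{(-z-\lambda_\ell)^j}\right).$$
   Context: $A_i,B_j$ are real $d\times d$ matrices; $I_d$ is the identity matrix; $\mathfrak{i}$ is the imaginary unit; $^\top$ is the (non-conjugate) transpose. A trigonometric polynomial of degree $n$ is a function $\sum_{k=-n}^n a_ke^{\mathfrak{i}k\omega}$ with $a_n$ or $a_{-n}$ nonzero. Driving process: $L=(L_t)_{t\in\mathbb{R}}$ is a two-sided $d$-dimensional Lévy process, $L_t=L_1(t)$ for $t\ge0$, $L_t=-L_2(-t-)$ for $t<0$, with $L_1,L_2$ i.i.d. one-sided Lévy processes, $\mathbf{E}L_1(1)=0$, $\mathbf{E}\|L_1(1)\|^2<\infty$, and $\Sigma_L$ is the covariance matrix of $L_1(1)$. MCARMA process: $Y_t=\int_{-\infty}^t g(t-s)\,\mathrm{d}L_s$ (in the $L^2$ sense), with $g(t)=\frac1{2\pi}\int_{-\infty}^{\infty}e^{\mathfrak{i}tx}P(\mathfrak{i}x)^{-1}Q(\mathfrak{i}x)\,\mathrm{d}x$ (inverse Fourier transform in the $L^2$ sense; $g$ vanishes on the negative half-line). Its spectral density is $f_Y(\lambda)=\frac1{2\pi}P(\mathfrak{i}\lambda)^{-1}Q(\mathfrak{i}\lambda)\Sigma_LQ(\mathfrak{i}\lambda)^*(P(\mathfrak{i}\lambda)^{-1})^*$, where $*$ is the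 conjugate transpose, so that $\Gamma(t):=\mathbf{E}[Y_tY_0^\top]=\int_{\mathbb{R}}e^{\mathfrak{i}t\lambda}f_Y(\lambda)\,\mathrm{d}\lambda$. Spectral density of the sampled process: $f_\Delta(\omega)=\frac1{2\pi}\sum_{k\in\mathbb{Z}}e^{-\mathfrak{i}k\omega}\Gamma(k\Delta)$. $R(z)=P(z)^{-1}Q(z)\,\Sigma_L\,Q(-z)^\top(P(-z)^{-1})^\top=\dfrac{S(z)}{\det P(z)\det P(-z)}$, with the matrix polynomial $S(z)=\mathrm{adj}P(z)\,Q(z)\,\Sigma_L\,(\mathrm{adj}P(-z)\,Q(-z))^\top$, where $\mathrm{adj}$ is the adjugate. *)

theory Defs
  imports "HOL-Probability.Probability" "HOL-Computational_Algebra.Polynomial"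
begin

definition matrix_smult :: "'a::times \<Rightarrow> 'a^'n^'m \<Rightarrow> 'a^'n^'m"  (infixr \<open>*k\<close> 75)
  where "c *k A = (\<chi> i j. c * A $ i $ j)"

abbreviation cmatrix :: "real^'n^'m \<Rightarrow> complex^'n^'m"
  where "cmatrix \<equiv> map_matrix complex_of_real"

text \<open>Matrix polynomials are matrices with polynomial entries, so that \<open>det\<close> of such a
  matrix is itself a polynomial, whose root multiplicities are given by \<open>order\<close>.\<close>

definition eval_mat :: "complex poly^'n^'m \<Rightarrow> complex \<Rightarrow> complex^'n^'m"
  where "eval_mat P z = map_matrix (\<lambda>p. poly p z) P"

definition const_mat :: "real^'n^'m \<Rightarrow> complex poly^'n^'m"
  where "const_mat A = map_matrix (\<lambda>a. [:complex_of_real a:]) A"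

definition ar_poly :: "nat \<Rightarrow> (nat \<Rightarrow> real^'d^'d) \<Rightarrow> complex poly^'d^'d"
  where "ar_poly p A = monom 1 p *k mat 1 + (\<Sum>k=1..p. monom 1 (p - k) *k const_mat (A k))"

definition ma_poly :: "nat \<Rightarrow> (nat \<Rightarrow> real^'d^'d) \<Rightarrow> complex poly^'d^'d"
  where "ma_poly q B = (\<Sum>k=0..q. monom 1 (q - k) *k const_mat (B k))"

definition levy_process :: "'w measure \<Rightarrow> (real \<Rightarrow> 'w \<Rightarrow> real^'d) \<Rightarrow> bool"
  where "levy_process M X \<longleftrightarrow>
    prob_space M \<and>
    (\<forall>t\<ge>0. X t \<in> borel_measurable M) \<and>
    (AE w in M. X 0 w = 0) \<and>
    (\<forall>n (t::nat \<Rightarrow> real). 0 \<le> t 0 \<and> (\<forall>i<n. t i \<le> t (Suc i)) \<longrightarrow>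
       prob_space.indep_vars M (\<lambda>_. borel) (\<lambda>i w. X (t (Suc i)) w - X (t i) w) {..<n}) \<and>
    (\<forall>s\<ge>0. \<forall>h\<ge>0. distr M borel (\<lambda>w. X (s + h) w - X s w) = distr M borel (X h)) \<and>
    (AE w in M. (\<forall>t\<ge>0. ((\<lambda>s. X s w) \<longlongrightarrow> X t w) (at_right t)) \<and>
                (\<forall>t>0. \<exists>l. ((\<lambda>s. X s w) \<longlongrightarrow> l) (at_left t)))"

text \<open>The process \<open>(X\<^sub>t)\<close>, \<open>t \<ge> 0\<close>, as one random element of the product space.\<close>

definition half_path :: "(real \<Rightarrow> 'w \<Rightarrow> real^'d) \<Rightarrow> 'w \<Rightarrow> real \<Rightarrow> real^'d"
  where "half_path X w = restrict (\<lambda>t. X t w) {0..}"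

text \<open>\<open>L\<^sub>t = L\<^sub>1(t)\<close> for \<open>t \<ge> 0\<close> and \<open>L\<^sub>t = - L\<^sub>2(-t-)\<close> for \<open>t < 0\<close>, with \<open>L\<^sub>1\<close>, \<open>L\<^sub>2\<close> independent
  and of the same law.  Since paths are cadlag only almost surely, measurability of the
  left limits is required separately.\<close>

definition two_sided_levy_process :: "'w measure \<Rightarrow> (real \<Rightarrow> 'w \<Rightarrow> real^'d) \<Rightarrow> bool"
  where "two_sided_levy_process M L \<longleftrightarrow>
    (\<exists>L1 L2. levy_process M L1 \<and> levy_process M L2 \<and>
       prob_space.indep_var M (PiM {0..} (\<lambda>_. borel)) (half_path L1) (PiM {0..} (\<lambda>_. borel)) (half_path L2) \<and>
       distr M (PiM {0..} (\<lambda>_. borel)) (half_path L1) = distr M (PiM {0..} (\<lambda>_. borel)) (half_path L2) \<and>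
       (\<forall>t\<ge>0. L t = L1 t) \<and>
       (\<forall>t<0. L t \<in> borel_measurable M) \<and>
       (AE w in M. \<forall>t<0. ((\<lambda>s. - L2 s w) \<longlongrightarrow> L t w) (at_left (- t))))"

definition covariance_matrix :: "'w measure \<Rightarrow> ('w \<Rightarrow> real^'d) \<Rightarrow> real^'d^'d"
  where "covariance_matrix M X =
    (\<chi> i j. LINT w|M. (X w $ i - (LINT v|M. X v $ i)) * (X w $ j - (LINT v|M. X v $ j)))"

text \<open>A list of triples \<open>(a, b, G)\<close> represents the step function with value \<open>G\<close> on \<open>(a, b]\<close>,
  summed over all triples.\<close>

definition step_fun :: "(real \<times> real \<times> (real^'d^'d)) list \<Rightarrow> real \<Rightarrow> real^'d^'d"
  where "step_fun xs s = (\<Sum>(a, b, G)\<leftarrow>xs. indicator {a<..b} s *\<^sub>R G)"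

definition step_integral ::
    "(real \<Rightarrow> 'w \<Rightarrow> real^'d) \<Rightarrow> (real \<times> real \<times> (real^'d^'d)) list \<Rightarrow> 'w \<Rightarrow> real^'d"
  where "step_integral L xs w = (\<Sum>(a, b, G)\<leftarrow>xs. G *v (L b w - L a w))"

text \<open>\<open>X = \<integral> f(s) dL\<^sub>s\<close>: \<open>X\<close> is the \<open>L\<^sup>2\<close> limit of the integrals of step functions converging
  to \<open>f\<close> in \<open>L\<^sup>2\<close>.\<close>

definition has_L2_integral ::
    "'w measure \<Rightarrow> (real \<Rightarrow> 'w \<Rightarrow> real^'d) \<Rightarrow> (real \<Rightarrow> real^'d^'d) \<Rightarrow> ('w \<Rightarrow> real^'d) \<Rightarrow> bool"
  where "has_L2_integral M L f X \<longleftrightarrow>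
    f \<in> borel_measurable lborel \<and> X \<in> borel_measurable M \<and>
    (\<exists>xs. (\<forall>n. \<forall>(a, b, G)\<in>set (xs n). a \<le> b) \<and>
       (\<lambda>n. \<integral>\<^sup>+ s. ennreal ((norm (f s - step_fun (xs n) s))\<^sup>2) \<partial>lborel) \<longlonglongrightarrow> 0 \<and>
       (\<lambda>n. \<integral>\<^sup>+ w. ennreal ((norm (X w - step_integral L (xs n) w))\<^sup>2) \<partial>M) \<longlonglongrightarrow> 0)"

text \<open>\<open>g(t) = 1/(2\<pi>) \<integral> e\<^sup>i\<^sup>t\<^sup>x F(x) dx\<close> as an \<open>L\<^sup>2\<close> limit of truncated integrals.\<close>

definition is_L2_inverse_fourier ::
    "(real \<Rightarrow> complex^'n^'m) \<Rightarrow> (real \<Rightarrow> complex^'n^'m) \<Rightarrow> bool"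
  where "is_L2_inverse_fourier F g \<longleftrightarrow>
    F \<in> borel_measurable lborel \<and> integrable lborel (\<lambda>x. (norm (F x))\<^sup>2) \<and>
    g \<in> borel_measurable lborel \<and>
    ((\<lambda>N::real. \<integral>\<^sup>+ t. ennreal ((norm (g t -
          complex_of_real (1 / (2 * pi)) *k
            (LINT x:{-N..N}|lborel. exp (\<i> * complex_of_real t * complex_of_real x) *k F x)))\<^sup>2)
        \<partial>lborel) \<longlongrightarrow> 0) at_top"

definition mcarma_kernel ::
    "complex poly^'d^'d \<Rightarrow> complex poly^'d^'d \<Rightarrow> (real \<Rightarrow> real^'d^'d) \<Rightarrow> bool"
  where "mcarma_kernel P Q g \<longleftrightarrow>
    is_L2_inverse_fourier
      (\<lambda>x. matrix_inv (eval_mat P (\<i> * complex_of_real x)) ** eval_mat Q (\<i> * complex_of_real x))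
      (\<lambda>t. cmatrix (g t))"

definition mcarma_process ::
    "'w measure \<Rightarrow> (real \<Rightarrow> 'w \<Rightarrow> real^'d) \<Rightarrow> complex poly^'d^'d \<Rightarrow> complex poly^'d^'d \<Rightarrow>
     (real \<Rightarrow> 'w \<Rightarrow> real^'d) \<Rightarrow> bool"
  where "mcarma_process M L P Q Y \<longleftrightarrow>
    (\<exists>g. mcarma_kernel P Q g \<and>
       (\<forall>t. has_L2_integral M L (\<lambda>s. if s \<le> t then g (t - s) else 0) (Y t)))"

definition autocov :: "'w measure \<Rightarrow> (real \<Rightarrow> 'w \<Rightarrow> real^'d) \<Rightarrow> real \<Rightarrow> real^'d^'d"
  where "autocov M Y t = (\<chi> i j. LINT w|M. Y t w $ i * Y 0 w $ j)"

definition sampled_spectral_density ::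
    "'w measure \<Rightarrow> (real \<Rightarrow> 'w \<Rightarrow> real^'d) \<Rightarrow> real \<Rightarrow> real \<Rightarrow> complex^'d^'d"
  where "sampled_spectral_density M Y \<Delta> \<omega> =
    complex_of_real (1 / (2 * pi)) *k
      (\<Sum>\<^sub>\<infinity>k\<in>(UNIV::int set). exp (- \<i> * of_int k * complex_of_real \<omega>) *k
                              cmatrix (autocov M Y (of_int k * \<Delta>)))"

definition R_fun ::
    "complex poly^'d^'d \<Rightarrow> complex poly^'d^'d \<Rightarrow> real^'d^'d \<Rightarrow> complex \<Rightarrow> complex^'d^'d"
  where "R_fun P Q \<Sigma> z =
    matrix_inv (eval_mat P z) ** eval_mat Q z ** cmatrix \<Sigma> **
      transpose (eval_mat Q (- z)) ** transpose (matrix_inv (eval_mat P (- z)))"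

definition trig_poly_of_degree :: "nat \<Rightarrow> (real \<Rightarrow> complex) \<Rightarrow> bool"
  where "trig_poly_of_degree n f \<longleftrightarrow>
    (\<exists>a::int \<Rightarrow> complex. (a (int n) \<noteq> 0 \<or> a (- int n) \<noteq> 0) \<and>
       (\<forall>\<omega>. f \<omega> = (\<Sum>k=- int n..int n. a k * exp (\<i> * of_int k * complex_of_real \<omega>))))"

end

theory Submission
  imports Defs
    "HOL-Complex_Analysis.Residue_Theorem"
    "HOL-Computational_Algebra.Fundamental_Theorem_Algebra"
    "HOL-Real_Asymp.Real_Asymp"
begin

text \<open>
  The entries of \<open>P(i x)\<^sup>-\<^sup>1 Q(i x)\<close> are strictly proper rational functions with poles in the left half
  plane, hence Fourier transforms of linear combinations of the kernels
  \<open>t\<^sup>n e\<^sup>z\<^sup>t / n!\<close> on \<open>t \<ge> 0\<close>; by the residue theorem their truncated inverse Fourier integrals converge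
  pointwise to these combinations, which therefore agree almost everywhere with the entries of the kernel \<open>g\<close>,
  and \<open>g\<close> is causal. The isometry of the stochastic integral gives
  \<open>\<Gamma>(t) = \<integral> g(t + s) \<Sigma> g(s)\<^sup>T ds\<close>. Inserting the truncated inverse integral for the first factor and applying
  Fubini shows that \<open>\<Gamma>(t)\<close> is the limit of \<open>1/(2\<pi>) \<integral> e\<^sup>i\<^sup>t\<^sup>x R(i x) dx\<close> over \<open>[-N, N]\<close>. Inverting the partial
  fractions of \<open>R\<close> term by term yields \<open>\<Gamma>(t) = \<Sum> \<alpha>(\<ell>,j) t\<^sup>j\<^sup>-\<^sup>1 e\<^sup>\<lambda>\<^sup>t / (j-1)!\<close> for \<open>t > 0\<close>, and for
  \<open>t = 0\<close> by continuity. What remains is to sum \<open>\<Sum> k\<^sup>n x\<^sup>k = E\<^sub>n(x) / (1 - x)\<^sup>n\<^sup>+\<^sup>1\<close> with the Eulerian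
  polynomial \<open>E\<^sub>n\<close>, at \<open>x = e\<^sup>\<Delta>\<^sup>\<lambda>\<^sup>-\<^sup>i\<^sup>\<omega>\<close> and \<open>y = e\<^sup>\<Delta>\<^sup>\<lambda>\<^sup>+\<^sup>i\<^sup>\<omega>\<close>, where
  \<open>(1 - x) (1 - y) = 2 e\<^sup>\<Delta>\<^sup>\<lambda> (cosh \<Delta>\<lambda> - cos \<omega>)\<close>. The term \<open>k = 0\<close> is split off with \<open>\<Gamma>(0)\<^sup>T\<close>,
  which is what makes the formula for simple poles asymmetric in \<open>\<omega>\<close>.
\<close>

no_notation fps_nth (infixl "$" 75)

section \<open>Fourier inversion of the exponential kernels\<close>

text \<open>Simple poles are the main obstacle. The function \<open>1 / (i x - z)\<close> is not
  integrable, so its inverse transform exists only as a limit of truncated integrals, and the kernel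
  jumps at \<open>t = 0\<close>. Hence \<open>t = 0\<close> is excluded from every pointwise
  inversion and the truncation is kept all the way to \<open>\<Gamma>(t)\<close>. Only there does
  integrability of \<open>R(i x)\<close>, whose entries are sums of products of square-integrable
  functions, yield continuity in \<open>t\<close>. The \<open>\<beta>\<close> terms are reflected
  causal transforms and invert to zero for \<open>t > 0\<close>; the symmetry
  \<open>R(- i x) = R(i x)^T\<close> turns negative times into transposes. On the probabilistic side
  moments are given at time 1 alone, and they reach other times through additive functions that are
  bounded on the unit interval. The degree \<open>j - 1\<close> of the trigonometric polynomials
  reflects that the Eulerian polynomial has no constant term once \<open>n > 0\<close>.\<close>

definition exp_kernel :: "complex \<Rightarrow> nat \<Rightarrow> real \<Rightarrow> complex"
  where "exp_kernel z n t = (if t < 0 then 0 else of_real t ^ n / fact n * exp (z * of_real t))"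

lemma exp_kernel_measurable [measurable]: "exp_kernel z n \<in> borel_measurable borel"
  unfolding exp_kernel_def by measurable

text \<open>The Erlang density has total mass 1, which makes the kernel integrable without an
  estimate.\<close>

lemma norm_exp_kernel:
  assumes "Re z < 0"
  shows "norm (exp_kernel z n t) = erlang_density n (- Re z) t / (- Re z) ^ Suc n"
  using assms by (simp add: exp_kernel_def erlang_density_def norm_mult norm_divide norm_power
      divide_simps mult_ac)

lemma integrable_exp_kernel:
  assumes "Re z < 0"
  shows "integrable lborel (exp_kernel z n)"
proof -
  interpret prob_space "density lborel (erlang_density n (- Re z))"
    using assms by (intro prob_space_erlang_density) auto
  have "integrable (density lborel (erlang_density n (- Re z))) (\<lambda>_. 1 :: real)"
    by simp
  then have "integrable lborel (\<lambda>t. erlang_density n (- Re z) t)"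
    using assms by (subst (asm) integrable_density) auto
  then have "integrable lborel (\<lambda>t. norm (exp_kernel z n t))"
    by (simp add: norm_exp_kernel[OF assms])
  then show ?thesis
    by (simp add: integrable_norm_iff)
qed

lemma exp_kernel_deriv:
  assumes "t > 0"
  shows "((\<lambda>t. of_real t ^ n / fact n * exp (z * of_real t)) has_vector_derivative
    (if n = 0 then 0 else exp_kernel z (n - 1) t) + z * exp_kernel z n t) (at t)"
proof -
  have "((\<lambda>t. t ^ n / fact n * exp (z * t)) has_field_derivative
    (of_nat n * of_real t ^ (n - 1) / fact n * exp (z * of_real t) + of_real t ^ n / fact n * (exp (z * of_real t) * z))) (at (of_real t))"
    by (auto intro!: derivative_eq_intros simp: add_divide_distrib mult_ac)
  from has_vector_derivative_real_field[OF this]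
  have "((\<lambda>t. of_real t ^ n / fact n * exp (z * of_real t)) has_vector_derivative
    of_nat n * of_real t ^ (n - 1) / fact n * exp (z * of_real t) + of_real t ^ n / fact n * (exp (z * of_real t) * z)) (at t)"
    by simp
  also have "of_nat n * of_real t ^ (n - 1) / fact n * exp (z * of_real t) + of_real t ^ n / fact n * (exp (z * of_real t) * z)
    = (if n = 0 then 0 else exp_kernel z (n - 1) t) + z * exp_kernel z n t"
    using assms by (cases n) (auto simp: exp_kernel_def simp del: of_nat_Suc)
  finally show ?thesis .
qed

lemma exp_kernel_tendsto_0:
  assumes "Re z < 0"
  shows "((\<lambda>t. of_real t ^ n / fact n * exp (z * of_real t)) \<longlongrightarrow> 0) at_top"
proof (rule tendsto_norm_zero_cancel)
  define l where "l = - Re z"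
  have "l > 0" using assms by (simp add: l_def)
  have "((\<lambda>t. t ^ n / fact n * exp (- l * t)) \<longlongrightarrow> 0) at_top"
  proof -
    have "((\<lambda>t::real. t ^ n / exp t) \<longlongrightarrow> 0) at_top" for n
      using tendsto_power_div_exp_0[of n] by simp
    moreover have "filterlim (\<lambda>t. l * t) at_top at_top"
      using \<open>l > 0\<close> by (intro filterlim_tendsto_pos_mult_at_top[OF tendsto_const] filterlim_ident)
    ultimately have "((\<lambda>t. (l * t) ^ n / exp (l * t)) \<longlongrightarrow> 0) at_top" by (rule filterlim_compose)
    then have "((\<lambda>t. (l * t) ^ n / exp (l * t) / (l ^ n * fact n)) \<longlongrightarrow> 0 / (l ^ n * fact n)) at_top"
      using \<open>l > 0\<close> by (intro tendsto_intros) auto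
    moreover have "(l * t) ^ n / exp (l * t) / (l ^ n * fact n) = t ^ n / fact n * exp (- l * t)" for t
      using \<open>l > 0\<close> by (simp add: power_mult_distrib exp_minus field_simps)
    ultimately show ?thesis by simp
  qed
  moreover have "\<forall>\<^sub>F t in at_top. t ^ n / fact n * exp (- l * t) =
     norm (of_real t ^ n / fact n * exp (z * of_real t) :: complex)"
    using eventually_ge_at_top[of 0] 
    by eventually_elim (simp add: norm_mult norm_divide norm_power l_def)
  ultimately show "((\<lambda>t. norm (of_real t ^ n / fact n * exp (z * of_real t) :: complex)) \<longlongrightarrow> 0) at_top"
    by (rule Lim_transform_eventually)
qed

text \<open>The integrand is the derivative of the kernel on the positive half-line, so only the
  boundary value at 0 survives: 1 for \<open>n = 0\<close>, where the kernel jumps, and 0 otherwise.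
  For the integrals this is a recursion in \<open>n\<close>.\<close>

lemma exp_kernel_FTC:
  assumes "Re z < 0"
  shows "(LINT t|lborel. (if n = 0 then 0 else exp_kernel z (n - 1) t) + z * exp_kernel z n t)
      = - (if n = 0 then 1 else 0)"
proof -
  let ?F = "\<lambda>t. of_real t ^ n / fact n * exp (z * of_real t)"
  let ?f = "\<lambda>t. (if n = 0 then 0 else exp_kernel z (n - 1) t) + z * exp_kernel z n t"
  have int: "integrable lborel ?f"
    using integrable_exp_kernel[OF assms] by (cases n) auto
  have "(LBINT x=0..\<infinity>. ?f x) = 0 - (if n = 0 then 1 else 0)"
  proof (rule interval_integral_FTC_integrable)
    show "(?F has_vector_derivative ?f x) (at x)" if "0 < ereal x" for x
      using exp_kernel_deriv[of x n z] that by simp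
    have cont: "isCont (exp_kernel z k) x" if "0 < x" for x k
    proof -
      have "\<forall>\<^sub>F t in nhds x. exp_kernel z k t = of_real t ^ k / fact k * exp (z * of_real t)"
        using eventually_nhds_in_open[of "{0<..}" x] that
        by (auto elim!: eventually_mono simp: exp_kernel_def)
      then show ?thesis
        by (subst isCont_cong) auto
    qed
    then show "isCont ?f x" if "0 < ereal x" for x
      using that by (cases n) (auto intro!: continuous_intros)
    show "set_integrable lborel (einterval 0 \<infinity>) ?f"
      unfolding set_integrable_def using int by (intro integrable_mult_indicator) auto
    show "((?F \<circ> real_of_ereal) \<longlongrightarrow> (if n = 0 then 1 else 0)) (at_right 0)"
    proof -
      have "(?F \<longlongrightarrow> ?F 0) (at_right 0)"
        by (intro tendsto_intros) auto
      then show ?thesis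
        unfolding zero_ereal_def ereal_tendsto_simps by (cases n) auto
    qed
    show "((?F \<circ> real_of_ereal) \<longlongrightarrow> 0) (at_left \<infinity>)"
      unfolding ereal_tendsto_simps by (rule exp_kernel_tendsto_0[OF assms])
  qed auto
  also have "(LBINT x=0..\<infinity>. ?f x) = (LINT t|lborel. ?f t)"
    unfolding interval_lebesgue_integral_def set_lebesgue_integral_def
  proof (simp, intro integral_cong_AE)
    show "AE x in lborel. indicator (einterval 0 \<infinity>) x *\<^sub>R ?f x = ?f x"
      using AE_lborel_singleton[of 0]
      by eventually_elim (auto simp: exp_kernel_def einterval_def indicator_def zero_ereal_def)
  qed auto
  finally show ?thesis by simp
qed

lemma integral_exp_kernel:
  assumes "Re z < 0"
  shows "(LINT t|lborel. exp_kernel z n t) = 1 / (- z) ^ Suc n"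
proof (induction n)
  case 0
  have "z \<noteq> 0" using assms by auto
  moreover have "z * (LINT t|lborel. exp_kernel z 0 t) = - 1"
    using exp_kernel_FTC[OF assms, of 0] by simp
  ultimately show ?case by (simp add: field_simps)
next
  case (Suc n)
  have "(LINT t|lborel. exp_kernel z n t) + z * (LINT t|lborel. exp_kernel z (Suc n) t) = 0"
    using exp_kernel_FTC[OF assms, of "Suc n"] integrable_exp_kernel[OF assms] by simp
  then have "- z * (LINT t|lborel. exp_kernel z (Suc n) t) = 1 / (- z) ^ Suc n"
    using Suc by (simp add: algebra_simps add_eq_0_iff)
  moreover have "z \<noteq> 0" using assms by auto
  ultimately show ?case
    by (simp add: field_simps)
qed

text \<open>Modulation by \<open>exp (- i t x)\<close> replaces \<open>z\<close> by
  \<open>z - i x\<close>, which has the same negative real part, so the transform is a shifted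
  instance of the plain integral.\<close>

lemma fourier_exp_kernel:
  assumes "Re z < 0"
  shows "(LINT t|lborel. exp (- (\<i> * of_real t * of_real x)) * exp_kernel z n t)
     = 1 / (\<i> * of_real x - z) ^ Suc n"
proof -
  have "exp (- (\<i> * of_real t * of_real x)) * exp_kernel z n t = exp_kernel (z - \<i> * of_real x) n t" for t
  proof -
    have "exp (- (\<i> * of_real t * of_real x)) * exp (z * of_real t) = exp ((z - \<i> * of_real x) * of_real t)"
      by (simp add: exp_add[symmetric] algebra_simps)
    then show ?thesis by (simp add: exp_kernel_def mult_ac)
  qed
  then show ?thesis
    using integral_exp_kernel[of "z - \<i> * of_real x" n] assms by simp
qed

section \<open>Inversion by the residue theorem\<close>

lemma higher_deriv_exp_mult: "(deriv ^^ n) (\<lambda>w. exp (c * w)) = (\<lambda>w. c ^ n * exp (c * w :: complex))"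
proof (induction n)
  case (Suc n)
  have "deriv (\<lambda>w. c ^ n * exp (c * w)) w = c ^ Suc n * exp (c * w)" for w
    by (rule DERIV_imp_deriv) (auto intro!: derivative_eq_intros)
  then show ?case using Suc by auto
qed auto

lemma contour_integral_linepath_same_Im:
  assumes "a < b"
  shows "contour_integral (linepath (Complex a c) (Complex b c)) f = integral {a..b} (\<lambda>x. f (Complex x c))"
proof -
  have "linepath (Complex a c) (Complex b c) x = linepath (of_real a) (of_real b) x + \<i> * of_real c" for x
    by (simp add: linepath_def complex_eq_iff algebra_simps)
  moreover have "Complex b c - Complex a c = of_real b - of_real a"
    by (simp add: complex_eq_iff)
  ultimately have "contour_integral (linepath (Complex a c) (Complex b c)) f
      = contour_integral (linepath (of_real a) (of_real b)) (\<lambda>w. f (w + \<i> * of_real c))"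
    by (simp add: contour_integral_integral)
  also have "\<dots> = integral {a..b} (\<lambda>x. f (of_real x + \<i> * of_real c))"
    using assms by (subst contour_integral_linepath_Reals_eq) auto
  also have "(\<lambda>x. of_real x + \<i> * of_real c) = (\<lambda>x. Complex x c)"
    by (simp add: fun_eq_iff complex_eq_iff)
  then have "integral {a..b} (\<lambda>x. f (of_real x + \<i> * of_real c)) = integral {a..b} (\<lambda>x. f (Complex x c))"
    by metis
  finally show ?thesis .
qed

text \<open>Length times maximum would be of order \<open>N / K\<close>, which does not vanish for
  \<open>n = 0\<close>. Integrating the exponential along the side instead gives
  \<open>1 / |t|\<close> whatever the length; the sign conditions keep \<open>exp (t x)\<close> at
  most 1 at both ends.\<close>

lemma contour_integral_horizontal_bound:
  assumes ab: "a < b" and t: "t \<noteq> 0" "t * a \<le> 0" "t * b \<le> 0"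
    and K: "K > 0" "K \<le> \<bar>c\<bar> - norm z"
  shows "norm (contour_integral (linepath (Complex a c) (Complex b c))
            (\<lambda>w. exp (of_real t * w) / (w - z) ^ Suc n)) \<le> 1 / (\<bar>t\<bar> * K ^ Suc n)"
proof -
  let ?f = "\<lambda>w. exp (of_real t * w) / (w - z) ^ Suc n"
  have far: "K \<le> norm (Complex x c - z)" for x
  proof -
    have "\<bar>c\<bar> \<le> norm (Complex x c)" using abs_Im_le_cmod[of "Complex x c"] by simp
    moreover have "norm (Complex x c) - norm z \<le> norm (Complex x c - z)" by (rule norm_triangle_ineq2)
    ultimately show ?thesis using K by linarith
  qed
  then have ne: "Complex x c - z \<noteq> 0" for x
    using K(1) by (metis norm_zero not_le)
  have "contour_integral (linepath (Complex a c) (Complex b c)) ?f = integral {a..b} (\<lambda>x. ?f (Complex x c))"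
    using ab by (rule contour_integral_linepath_same_Im)
  also have "norm \<dots> \<le> integral {a..b} (\<lambda>x. exp (t * x) / K ^ Suc n)"
  proof (rule integral_norm_bound_integral)
    show "(\<lambda>x. ?f (Complex x c)) integrable_on {a..b}"
      using ne by (intro integrable_continuous_interval continuous_intros) auto
    show "(\<lambda>x. exp (t * x) / K ^ Suc n) integrable_on {a..b}"
      using K by (intro integrable_continuous_interval continuous_intros) auto
    show "norm (?f (Complex x c)) \<le> exp (t * x) / K ^ Suc n" for x
    proof -
      have "norm (?f (Complex x c)) = exp (t * x) / norm (Complex x c - z) ^ Suc n"
        by (simp add: norm_divide norm_mult norm_power)
      also have "\<dots> \<le> exp (t * x) / K ^ Suc n"
        using K far[of x] by (intro divide_left_mono power_mono mult_pos_pos zero_less_power) (auto intro: less_le_trans)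
      finally show ?thesis .
    qed
  qed
  also have "integral {a..b} (\<lambda>x. exp (t * x) / K ^ Suc n) = exp (t * b) / (t * K ^ Suc n) - exp (t * a) / (t * K ^ Suc n)"
    using ab t K by (intro integral_unique fundamental_theorem_of_calculus)
      (auto intro!: derivative_eq_intros simp flip: has_real_derivative_iff_has_vector_derivative)
  also have "\<dots> = (exp (t * b) - exp (t * a)) / (t * K ^ Suc n)"
    by (simp add: diff_divide_distrib)
  also have "\<dots> \<le> \<bar>\<dots>\<bar>" by (rule abs_ge_self)
  also have "\<dots> = \<bar>exp (t * b) - exp (t * a)\<bar> / (\<bar>t\<bar> * K ^ Suc n)"
    using K by (simp add: abs_mult)
  also have "\<dots> \<le> 1 / (\<bar>t\<bar> * K ^ Suc n)"
  proof (intro divide_right_mono)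
    have "exp (t * b) \<le> 1" "exp (t * a) \<le> 1" using t by auto
    moreover have "exp (t * b) > 0" "exp (t * a) > 0" by auto
    ultimately show "\<bar>exp (t * b) - exp (t * a)\<bar> \<le> 1" by linarith
  qed (use K in auto)
  finally show ?thesis .
qed

text \<open>Since \<open>|c| = N\<close> and \<open>t c \<le> 0\<close>, the exponential has modulus
  \<open>exp (- |t| N)\<close> on the whole side, and here length times maximum suffices.\<close>

lemma contour_integral_vertical_bound:
  assumes N: "N > 0" and c: "\<bar>c\<bar> = N" "t * c \<le> 0"
    and K: "K > 0" "K \<le> N - norm z" and ab: "\<bar>a\<bar> = N" "\<bar>b\<bar> = N"
  shows "norm (contour_integral (linepath (Complex c a) (Complex c b))
            (\<lambda>w. exp (of_real t * w) / (w - z) ^ Suc n)) \<le> 2 * N * exp (- \<bar>t\<bar> * N) / K ^ Suc n"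
proof -
  let ?f = "\<lambda>w. exp (of_real t * w) / (w - z) ^ Suc n"
  have far: "K \<le> norm (w - z)" if "Re w = c" for w
  proof -
    have "\<bar>c\<bar> \<le> norm w" using abs_Re_le_cmod[of w] that by simp
    moreover have "norm w - norm z \<le> norm (w - z)" by (rule norm_triangle_ineq2)
    ultimately show ?thesis using K c by linarith
  qed
  have Re: "Re w = c" if "w \<in> closed_segment (Complex c a) (Complex c b)" for w
    using that by (auto simp: closed_segment_def) (simp add: algebra_simps)
  have tc: "t * c = - \<bar>t\<bar> * N"
    using c by (metis abs_mult abs_of_nonpos minus_equation_iff mult_minus_left)
  have "norm (contour_integral (linepath (Complex c a) (Complex c b)) ?f)
       \<le> exp (- \<bar>t\<bar> * N) / K ^ Suc n * norm (Complex c b - Complex c a)"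
  proof (rule contour_integral_bound_linepath)
    show "?f contour_integrable_on linepath (Complex c a) (Complex c b)"
    proof (intro contour_integrable_continuous_linepath continuous_intros ballI)
      fix w assume "w \<in> closed_segment (Complex c a) (Complex c b)"
      then have "K \<le> norm (w - z)" using far Re by blast
      then show "(w - z) ^ Suc n \<noteq> 0" using K by auto
    qed
    show "norm (?f w) \<le> exp (- \<bar>t\<bar> * N) / K ^ Suc n"
      if "w \<in> closed_segment (Complex c a) (Complex c b)" for w
    proof -
      have "norm (?f w) = exp (- \<bar>t\<bar> * N) / norm (w - z) ^ Suc n"
        using Re[OF that] tc by (simp add: norm_divide norm_mult norm_power)
      also have "\<dots> \<le> exp (- \<bar>t\<bar> * N) / K ^ Suc n"
        using K far[OF Re[OF that]] by (intro divide_left_mono power_mono mult_pos_pos zero_less_power) (auto intro: less_le_trans)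
      finally show ?thesis .
    qed
  qed (use K in auto)
  also have "Complex c b - Complex c a = Complex 0 (b - a)" by (simp add: complex_eq_iff)
  also have "norm (Complex 0 (b - a)) = \<bar>b - a\<bar>" by (simp add: cmod_def)
  also have "exp (- \<bar>t\<bar> * N) / K ^ Suc n * \<bar>b - a\<bar> \<le> exp (- \<bar>t\<bar> * N) / K ^ Suc n * (2 * N)"
    using ab K by (intro mult_left_mono) auto
  finally show ?thesis by (simp add: mult_ac)
qed

lemma contour_vertical_axis:
  assumes "N > 0"
  shows "contour_integral (linepath (Complex 0 (- N)) (Complex 0 N)) f =
           \<i> * integral {- N..N} (\<lambda>x. f (\<i> * of_real x))"
proof -
  have "Complex 0 x = \<i> * of_real x" for x by (simp add: complex_eq_iff)
  then show ?thesis
    using assms by (subst contour_integral_linepath_same_Re[where a = "-N" and b = N and c = 0]) auto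
qed

text \<open>The segment of the imaginary axis from \<open>- i N\<close> to \<open>i N\<close> is
  closed to a rectangle on the side where \<open>exp (t w)\<close> decays: to the left for
  \<open>t > 0\<close>, enclosing the pole \<open>z\<close>, and to the right for
  \<open>t < 0\<close>, leaving it outside. Both branches of the kernel are thus read off from the
  residue theorem.\<close>

lemma exp_kernel_inversion_bound:
  assumes z: "Re z < 0" and t: "t \<noteq> 0" and K: "K > 0" "K \<le> N - norm z" 
  shows "norm (integral {- N..N} (\<lambda>x. exp (of_real t * (\<i> * of_real x)) / (\<i> * of_real x - z) ^ Suc n)
            - 2 * pi * exp_kernel z n t) \<le> 2 / (\<bar>t\<bar> * K ^ Suc n) + 2 * N * exp (- \<bar>t\<bar> * N) / K ^ Suc n"
proof -
  let ?f = "\<lambda>w. exp (of_real t * w) / (w - z) ^ Suc n"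
  have N: "N > norm z" using K by linarith
  then have N0: "N > 0" using norm_ge_zero[of z] by linarith
  define b where "b = (if t < 0 then N else 0)"
  define a where "a = (if t < 0 then 0 else - N)"
  have ab: "a < b" using N0 by (auto simp: a_def b_def)
  define a1 a2 a3 a4 where "a1 = Complex a (- N)" and "a2 = Complex b (- N)"
    and "a3 = Complex b N" and "a4 = Complex a N"
  have hol: "?f holomorphic_on UNIV - {z}"
    by (auto intro!: holomorphic_intros)
  have zRe: "\<bar>Re z\<bar> < N" "\<bar>Im z\<bar> < N"
    using N abs_Re_le_cmod[of z] abs_Im_le_cmod[of z] by linarith+
  have pi: "path_image (rectpath a1 a3) \<subseteq> UNIV - {z}"
    using ab zRe z N0 by (subst path_image_rectpath) (auto simp: a1_def a3_def a_def b_def)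
  have "contour_integral (rectpath a1 a3) ?f =
      2 * pi * \<i> * (winding_number (rectpath a1 a3) z * residue ?f z)"
    using hol pi by (subst Residue_theorem[where S = UNIV and pts = "{z}"]) auto
  also have "residue ?f z = (deriv ^^ n) (\<lambda>w. exp (of_real t * w)) z / fact n"
    by (rule residue_holomorphic_over_power[of UNIV]) (auto intro!: holomorphic_intros)
  also have "\<dots> = of_real t ^ n * exp (of_real t * z) / fact n"
    by (simp add: higher_deriv_exp_mult)
  also have "winding_number (rectpath a1 a3) z = (if t < 0 then 0 else 1)"
  proof (cases "t < 0")
    case True
    then show ?thesis using z N0
      by (auto intro!: winding_number_rectpath_outside simp: a1_def a3_def a_def b_def in_cbox_complex_iff)
  next
    case False
    then show ?thesis using z N0 zRe
      by (auto intro!: winding_number_rectpath simp: a1_def a3_def a_def b_def in_box_complex_iff)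
  qed
  finally have rect: "contour_integral (rectpath a1 a3) ?f = 2 * pi * \<i> * exp_kernel z n t"
    by (simp add: exp_kernel_def mult_ac)
  have rp: "rectpath a1 a3 = linepath a1 a2 +++ linepath a2 a3 +++ linepath a3 a4 +++ linepath a4 a1"
    by (simp add: rectpath_def a1_def a2_def a3_def a4_def Let_def)
  have "path_image (rectpath a1 a3) = closed_segment a1 a2 \<union> closed_segment a2 a3 \<union> closed_segment a3 a4 \<union> closed_segment a4 a1"
    unfolding rp by (auto simp: path_image_join)
  then have seg: "z \<notin> closed_segment a1 a2" "z \<notin> closed_segment a2 a3" "z \<notin> closed_segment a3 a4"
      "z \<notin> closed_segment a4 a1"
    using pi by auto
  have ci: "?f contour_integrable_on linepath u v" if "z \<notin> closed_segment u v" for u v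
    using that by (intro contour_integrable_continuous_linepath continuous_intros) auto
  have sum: "contour_integral (rectpath a1 a3) ?f = contour_integral (linepath a1 a2) ?f
     + contour_integral (linepath a2 a3) ?f + contour_integral (linepath a3 a4) ?f + contour_integral (linepath a4 a1) ?f"
    unfolding rp using ci[OF seg(1)] ci[OF seg(2)] ci[OF seg(3)] ci[OF seg(4)]
    by (simp add: contour_integrable_joinI valid_path_join algebra_simps)
  have rev34: "contour_integral (linepath a3 a4) ?f = - contour_integral (linepath a4 a3) ?f"
    using ci[of a4 a3] seg(3) contour_integral_reversepath[of "linepath a4 a3" ?f] by simp
  have tab: "t * a \<le> 0" "t * b \<le> 0"
    using t N0 by (auto simp: a_def b_def mult_le_0_iff)
  have h1: "norm (contour_integral (linepath a1 a2) ?f) \<le> 1 / (\<bar>t\<bar> * K ^ Suc n)"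
    unfolding a1_def a2_def using ab tab t K N0
    by (intro contour_integral_horizontal_bound) auto
  have h2: "norm (contour_integral (linepath a3 a4) ?f) \<le> 1 / (\<bar>t\<bar> * K ^ Suc n)"
    unfolding rev34 norm_minus_cancel unfolding a3_def a4_def using ab tab t K N0
    by (intro contour_integral_horizontal_bound) auto
  let ?I = "\<i> * integral {- N..N} (\<lambda>x. ?f (\<i> * of_real x))"
  \<comment> \<open>\<open>V\<close> is the integral over the vertical side away from the axis. The
    sign \<open>s\<close> is the orientation of the axis: the counterclockwise rectangle runs up its
    right side and down its left side.\<close>
  obtain V s where V: "contour_integral (rectpath a1 a3) ?f = contour_integral (linepath a1 a2) ?f
        + contour_integral (linepath a3 a4) ?f + V + s * ?I" 
      "norm V \<le> 2 * N * exp (- \<bar>t\<bar> * N) / K ^ Suc n" "s = (if t < 0 then -1 else 1)"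
  proof (cases "t < 0")
    case True
    then have ax: "a1 = Complex 0 (-N)" "a4 = Complex 0 N" "a2 = Complex N (-N)" "a3 = Complex N N"
      by (auto simp: a1_def a2_def a3_def a4_def a_def b_def)
    have "contour_integral (linepath a4 a1) ?f = - contour_integral (linepath a1 a4) ?f"
      using ci[of a1 a4] seg(4) contour_integral_reversepath[of "linepath a1 a4" ?f]
      by (simp add: closed_segment_commute)
    also have "contour_integral (linepath a1 a4) ?f = ?I"
      unfolding ax by (rule contour_vertical_axis[OF N0])
    finally have "contour_integral (rectpath a1 a3) ?f = contour_integral (linepath a1 a2) ?f
        + contour_integral (linepath a3 a4) ?f + contour_integral (linepath a2 a3) ?f + (- 1) * ?I"
      using sum by simp
    moreover have "norm (contour_integral (linepath a2 a3) ?f) \<le> 2 * N * exp (- \<bar>t\<bar> * N) / K ^ Suc n"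
      unfolding ax using True N0 K by (intro contour_integral_vertical_bound) (auto simp: mult_le_0_iff)
    ultimately show ?thesis using that[of "contour_integral (linepath a2 a3) ?f" "-1"] True by simp
  next
    case False
    then have ax: "a1 = Complex (- N) (-N)" "a4 = Complex (- N) N" "a2 = Complex 0 (-N)" "a3 = Complex 0 N"
      by (auto simp: a1_def a2_def a3_def a4_def a_def b_def)
    have "contour_integral (linepath a2 a3) ?f = ?I"
      unfolding ax by (rule contour_vertical_axis[OF N0])
    then have "contour_integral (rectpath a1 a3) ?f = contour_integral (linepath a1 a2) ?f
        + contour_integral (linepath a3 a4) ?f + contour_integral (linepath a4 a1) ?f + 1 * ?I"
      using sum by simp
    moreover have "norm (contour_integral (linepath a4 a1) ?f) \<le> 2 * N * exp (- \<bar>t\<bar> * N) / K ^ Suc n"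
      unfolding ax using False N0 K by (intro contour_integral_vertical_bound) (auto simp: mult_le_0_iff)
    ultimately show ?thesis using that[of "contour_integral (linepath a4 a1) ?f" "1"] False by simp
  qed
  have eq1: "s * ?I - 2 * pi * \<i> * exp_kernel z n t = - contour_integral (linepath a1 a2) ?f
        - contour_integral (linepath a3 a4) ?f - V"
    using V(1) rect by (simp add: algebra_simps)
  \<comment> \<open>The sign may be pulled out of the kernel term as well, because the kernel is 0
    in the case \<open>s = -1\<close>.\<close>
  have eq2: "s * ?I - 2 * pi * \<i> * exp_kernel z n t = 
      s * \<i> * (integral {- N..N} (\<lambda>x. ?f (\<i> * of_real x)) - 2 * pi * exp_kernel z n t)"
    by (auto simp: V(3) exp_kernel_def algebra_simps)
  have "norm (integral {- N..N} (\<lambda>x. ?f (\<i> * of_real x)) - 2 * pi * exp_kernel z n t)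
      = norm (- contour_integral (linepath a1 a2) ?f - contour_integral (linepath a3 a4) ?f - V)"
  proof -
    have "norm (s * \<i>) = 1" by (simp add: V(3) norm_mult)
    then have "norm x = norm (s * \<i> * x)" for x by (simp only: norm_mult mult_1)
    then show ?thesis
      unfolding trans[OF eq2[symmetric] eq1, symmetric] .
  qed
  also have "\<dots> \<le> norm (contour_integral (linepath a1 a2) ?f) + norm (contour_integral (linepath a3 a4) ?f) + norm V"
    using norm_triangle_ineq4[of "- contour_integral (linepath a1 a2) ?f - contour_integral (linepath a3 a4) ?f" V]
      norm_triangle_ineq4[of "- contour_integral (linepath a1 a2) ?f" "contour_integral (linepath a3 a4) ?f"]
    unfolding norm_minus_cancel by linarith
  also have "\<dots> \<le> 2 / (\<bar>t\<bar> * K ^ Suc n) + 2 * N * exp (- \<bar>t\<bar> * N) / K ^ Suc n"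
  proof -
    have "2 / (\<bar>t\<bar> * K ^ Suc n) = 1 / (\<bar>t\<bar> * K ^ Suc n) + 1 / (\<bar>t\<bar> * K ^ Suc n)"
      by (simp add: add_divide_distrib[symmetric])
    show ?thesis
      unfolding \<open>2 / (\<bar>t\<bar> * K ^ Suc n) = 1 / (\<bar>t\<bar> * K ^ Suc n) + 1 / (\<bar>t\<bar> * K ^ Suc n)\<close>
      by (intro add_mono h1 h2 V(2))
  qed
  finally show ?thesis .
qed

lemma LINT_Icc_continuous:
  fixes f :: "real \<Rightarrow> 'a::euclidean_space"
  assumes "continuous_on {a..b} f"
  shows "(LINT x:{a..b}|lborel. f x) = integral {a..b} f"
  using assms by (intro set_borel_integral_eq_integral borel_integrable_atLeastAtMost')

text \<open>The bound is used with \<open>K = N - norm z\<close>. Even for \<open>n = 0\<close> its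
  first term is of order \<open>1 / N\<close>, and the second is exponentially small.\<close>

lemma exp_kernel_inversion:
  assumes z: "Re z < 0" and t: "t \<noteq> 0"
  shows "((\<lambda>N. LINT x:{- N..N}|lborel. exp (\<i> * of_real t * of_real x) * (1 / (\<i> * of_real x - z) ^ Suc n))
       \<longlongrightarrow> 2 * pi * exp_kernel z n t) at_top"
proof -
  have ne: "\<i> * of_real x \<noteq> z" for x
    using z by auto
  let ?J = "\<lambda>N. integral {- N..N} (\<lambda>x. exp (of_real t * (\<i> * of_real x)) / (\<i> * of_real x - z) ^ Suc n)"
  have eq: "(LINT x:{- N..N}|lborel. exp (\<i> * of_real t * of_real x) * (1 / (\<i> * of_real x - z) ^ Suc n)) = ?J N" for N
    using ne by (subst LINT_Icc_continuous) (auto intro!: continuous_intros simp: mult_ac)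
  define s r where "s = \<bar>t\<bar>" and "r = norm z"
  have "s > 0" using t by (simp add: s_def)
  have "((\<lambda>N. ?J N - 2 * pi * exp_kernel z n t) \<longlongrightarrow> 0) at_top"
  proof (rule Lim_null_comparison)
    have "\<forall>\<^sub>F N in at_top. N \<ge> norm z + 1" by (rule eventually_ge_at_top)
    then show "\<forall>\<^sub>F N in at_top. norm (?J N - 2 * pi * exp_kernel z n t)
       \<le> 2 / (s * (N - r) ^ Suc n) + 2 * N * exp (- s * N) / (N - r) ^ Suc n"
      by eventually_elim (use exp_kernel_inversion_bound[OF z t] in \<open>auto simp: s_def r_def\<close>)
    show "((\<lambda>N. 2 / (s * (N - r) ^ Suc n) + 2 * N * exp (- s * N) / (N - r) ^ Suc n) \<longlongrightarrow> 0) at_top"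
    proof -
      have 1: "((\<lambda>N. inverse (N - r)) \<longlongrightarrow> 0) at_top" by real_asymp
      have 2: "((\<lambda>N. 2 * N * exp (- s * N)) \<longlongrightarrow> 0) at_top" using \<open>s > 0\<close> by real_asymp
      have "((\<lambda>N. 2 / s * inverse (N - r) ^ Suc n + 2 * N * exp (- s * N) * inverse (N - r) ^ Suc n) \<longlongrightarrow> 2 / s * 0 ^ Suc n + 0 * 0 ^ Suc n) at_top"
        by (intro tendsto_intros 1 2)
      moreover have "2 / s * inverse (N - r) ^ Suc n + 2 * N * exp (- s * N) * inverse (N - r) ^ Suc n
          = 2 / (s * (N - r) ^ Suc n) + 2 * N * exp (- s * N) / (N - r) ^ Suc n" for N
        by (simp only: divide_inverse power_inverse inverse_mult_distrib mult.assoc)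
      ultimately show ?thesis by simp
    qed
  qed
  then show ?thesis
    unfolding eq by (rule Lim_null[THEN iffD2])
qed

section \<open>Rational matrix functions\<close>

text \<open>Two directions are bundled: \<open>F\<close> is the transform of an integrable
  \<open>h\<close> living on \<open>t \<ge> 0\<close>, and truncated inversion of \<open>F\<close>
  recovers \<open>h\<close> pointwise. At \<open>t = 0\<close> the truncated integrals of a simple
  pole approach half the jump instead of the value of the kernel, so that point is left out. All
  clauses are stable under linear combinations.\<close>

definition causal_transform :: "(real \<Rightarrow> complex) \<Rightarrow> (real \<Rightarrow> complex) \<Rightarrow> bool"
  where "causal_transform h F \<longleftrightarrow> (\<forall>t<0. h t = 0) \<and> integrable lborel h \<and> continuous_on UNIV F \<and>
    (\<forall>x. (LINT t|lborel. exp (- (\<i> * of_real t * of_real x)) * h t) = F x) \<and>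
    (\<forall>t. t \<noteq> 0 \<longrightarrow>
      ((\<lambda>N. LINT x:{- N..N}|lborel. exp (\<i> * of_real t * of_real x) * F x) \<longlongrightarrow> complex_of_real (2 * pi) * h t) at_top)"

lemma causal_transform_exp_kernel:
  assumes "Re z < 0"
  shows "causal_transform (exp_kernel z n) (\<lambda>x. 1 / (\<i> * of_real x - z) ^ Suc n)"
proof -
  have "\<i> * of_real x \<noteq> z" for x
    using assms by auto
  then have "continuous_on UNIV (\<lambda>x. 1 / (\<i> * of_real x - z) ^ Suc n)"
    by (intro continuous_intros) auto
  then show ?thesis
    unfolding causal_transform_def
    using integrable_exp_kernel[OF assms] fourier_exp_kernel[OF assms] exp_kernel_inversion[OF assms]
    by (auto simp: exp_kernel_def simp del: power_Suc)
qed

lemma fourier_factor_integrable: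
  assumes "integrable lborel h"
  shows "integrable lborel (\<lambda>t. exp (- (\<i> * of_real t * of_real x)) * h t :: complex)"
  by (rule Bochner_Integration.integrable_bound[OF assms]) (use assms in \<open>auto simp: norm_mult\<close>)

lemma set_integrable_exp_continuous:
  assumes "continuous_on UNIV F"
  shows "set_integrable lborel {- N..N} (\<lambda>x. exp (\<i> * of_real t * of_real x) * F x :: complex)"
  by (intro borel_integrable_atLeastAtMost' continuous_intros continuous_on_subset[OF assms]) auto

lemma causal_transform_add:
  assumes "causal_transform h F" "causal_transform k G"
  shows "causal_transform (\<lambda>t. h t + k t) (\<lambda>x. F x + G x)"
proof -
  have "((\<lambda>N. LINT x:{- N..N}|lborel. exp (\<i> * of_real t * of_real x) * (F x + G x)) \<longlongrightarrow> complex_of_real (2 * pi) * (h t + k t)) at_top"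
    if "t \<noteq> 0" for t
  proof -
    have "(LINT x:{- N..N}|lborel. exp (\<i> * of_real t * of_real x) * (F x + G x))
        = (LINT x:{- N..N}|lborel. exp (\<i> * of_real t * of_real x) * F x) + (LINT x:{- N..N}|lborel. exp (\<i> * of_real t * of_real x) * G x)" for N
      unfolding distrib_left using assms
      by (intro set_integral_add set_integrable_exp_continuous) (auto simp: causal_transform_def)
    then show ?thesis
      using that assms unfolding distrib_left causal_transform_def by (simp add: tendsto_add)
  qed
  moreover have "(LINT t|lborel. exp (- (\<i> * of_real t * of_real x)) * (h t + k t)) = F x + G x" for x
    using assms unfolding distrib_left
    by (subst Bochner_Integration.integral_add) (auto intro!: fourier_factor_integrable simp: causal_transform_def)
  ultimately show ?thesis
    using assms by (auto simp: causal_transform_def intro!: continuous_intros)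
qed

lemma causal_transform_scale:
  assumes "causal_transform h F"
  shows "causal_transform (\<lambda>t. c * h t) (\<lambda>x. c * F x)"
proof -
  have "((\<lambda>N. LINT x:{- N..N}|lborel. exp (\<i> * of_real t * of_real x) * (c * F x)) \<longlongrightarrow> complex_of_real (2 * pi) * (c * h t)) at_top"
    if "t \<noteq> 0" for t
  proof -
    have "(LINT x:{- N..N}|lborel. exp (\<i> * of_real t * of_real x) * (c * F x))
        = c * (LINT x:{- N..N}|lborel. exp (\<i> * of_real t * of_real x) * F x)" for N
      by (subst set_integral_mult_right[symmetric]) (simp add: mult_ac)
    moreover have "((\<lambda>N. c * (LINT x:{- N..N}|lborel. exp (\<i> * of_real t * of_real x) * F x)) \<longlongrightarrow> c * (complex_of_real (2 * pi) * h t)) at_top"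
      using that assms by (intro tendsto_intros) (auto simp: causal_transform_def)
    ultimately show ?thesis by (simp add: mult_ac)
  qed
  moreover have "(LINT t|lborel. exp (- (\<i> * of_real t * of_real x)) * (c * h t)) = c * F x" for x
  proof -
    have "(LINT t|lborel. exp (- (\<i> * of_real t * of_real x)) * (c * h t))
       = c * (LINT t|lborel. exp (- (\<i> * of_real t * of_real x)) * h t)"
      by (subst integral_mult_right_zero[symmetric]) (simp add: mult_ac)
    then show ?thesis using assms by (simp add: causal_transform_def)
  qed
  ultimately show ?thesis
    using assms by (auto simp: causal_transform_def intro!: continuous_intros)
qed

lemma causal_transform_zero: "causal_transform (\<lambda>_. 0) (\<lambda>_. 0)"
  by (simp add: causal_transform_def)

text \<open>One pole of maximal order is split off at a time.\<close>

lemma causal_transform_rational: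
  fixes num den :: "complex poly"
  assumes "\<And>z. poly den z = 0 \<Longrightarrow> Re z < 0" "degree num < degree den"
  shows "\<exists>h. causal_transform h (\<lambda>x. poly num (\<i> * of_real x) / poly den (\<i> * of_real x))"
  using assms
proof (induction "degree den" arbitrary: num den rule: less_induct)
  case less
  have "den \<noteq> 0" using less.prems(2) by auto
  have "\<not> constant (poly den)"
    using less.prems(2) by (simp add: constant_degree)
  then obtain r where r: "poly den r = 0"
    using fundamental_theorem_of_algebra by blast
  define k where "k = order r den"
  have "k \<noteq> 0" using r \<open>den \<noteq> 0\<close> by (simp add: k_def order_root)
  then obtain n where n: "k = Suc n" by (cases k) auto
  from order_decomp[OF \<open>den \<noteq> 0\<close>, of r] obtain u where u: "den = [:- r, 1:] ^ k * u" "\<not> [:- r, 1:] dvd u"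
    unfolding k_def by blast
  have "u \<noteq> 0" using u(2) by auto
  have ur: "poly u r \<noteq> 0" using u(2) by (simp add: poly_eq_0_iff_dvd)
  have degden: "degree den = k + degree u"
    using \<open>u \<noteq> 0\<close> by (simp add: u(1) degree_mult_eq degree_power_eq)
  \<comment> \<open>This \<open>c\<close> makes \<open>num - smult c u\<close> vanish at
    \<open>r\<close>, so one linear factor cancels and the remaining fraction has the denominator
    \<open>den'\<close> of degree one less.\<close>
  define c where "c = poly num r / poly u r"
  have "poly (num - smult c u) r = 0" using ur by (simp add: c_def)
  then have "[:- r, 1:] dvd num - smult c u"
    by (simp only: poly_eq_0_iff_dvd)
  then obtain num' where num': "num - smult c u = [:- r, 1:] * num'"
    by (elim dvdE)
  define den' where "den' = [:- r, 1:] ^ n * u"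
  have den': "den = [:- r, 1:] * den'" by (simp only: u(1) den'_def n power_Suc mult.assoc)
  have "den' \<noteq> 0" using \<open>den \<noteq> 0\<close> den' by auto
  have dd: "degree den = Suc (degree den')"
    using \<open>den' \<noteq> 0\<close> unfolding den' by (subst degree_mult_eq) auto
  have Rer: "Re r < 0" using less.prems(1) r by blast
  have ne: "\<i> * of_real x \<noteq> r" for x using Rer by auto
  have dne: "poly den (\<i> * of_real x) \<noteq> 0" for x
    using less.prems(1)[of "\<i> * of_real x"] by auto
  have "\<exists>h. causal_transform h (\<lambda>x. poly num' (\<i> * of_real x) / poly den' (\<i> * of_real x))"
  proof (cases "num' = 0")
    case True
    then show ?thesis using causal_transform_zero by auto
  next
    case False
    have "degree (num - smult c u) < degree den"
      using less.prems(2) degden n by (intro degree_diff_less) (auto intro: le_less_trans[OF degree_smult_le])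
    then have "degree num' < degree den'"
      using False dd unfolding num' by (subst (asm) degree_mult_eq) auto
    moreover have "Re z < 0" if "poly den' z = 0" for z
      using less.prems(1)[of z] that by (simp add: den')
    ultimately show ?thesis
      using less.hyps[of den' num'] dd by auto
  qed
  then obtain h where h: "causal_transform h (\<lambda>x. poly num' (\<i> * of_real x) / poly den' (\<i> * of_real x))"
    by blast
  have "poly num (\<i> * of_real x) / poly den (\<i> * of_real x)
      = c * (1 / (\<i> * of_real x - r) ^ Suc n) + poly num' (\<i> * of_real x) / poly den' (\<i> * of_real x)" for x
  proof -
    let ?w = "\<i> * complex_of_real x"
    have num: "poly num ?w = c * poly u ?w + (?w - r) * poly num' ?w"
      using arg_cong[OF num', of "\<lambda>p. poly p ?w"] by (simp add: algebra_simps)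
    have d: "poly den ?w = (?w - r) ^ k * poly u ?w" "poly den ?w = (?w - r) * poly den' ?w"
      by (simp_all add: u(1)) (simp add: den'_def n)
    have nz: "poly u ?w \<noteq> 0" "poly den' ?w \<noteq> 0" "?w - r \<noteq> 0"
      using dne[of x] ne[of x] d by auto
    have "poly num ?w / poly den ?w = c * poly u ?w / poly den ?w + (?w - r) * poly num' ?w / poly den ?w"
      by (simp add: num add_divide_distrib)
    also have "c * poly u ?w / poly den ?w = c * (1 / (?w - r) ^ Suc n)"
      using nz by (simp add: d(1) n)
    also have "(?w - r) * poly num' ?w / poly den ?w = poly num' ?w / poly den' ?w"
      using nz by (simp add: d(2))
    finally show ?thesis .
  qed
  then show ?case
    using causal_transform_add[OF causal_transform_scale[OF causal_transform_exp_kernel[OF Rer]] h] by auto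
qed

section \<open>Degrees of determinants and Cramer's rule\<close>

lemma coeff_prod_bounded:
  fixes f :: "'i \<Rightarrow> 'a::comm_semiring_1 poly"
  assumes "finite I" "\<And>i. i \<in> I \<Longrightarrow> degree (f i) \<le> n"
  shows "degree (prod f I) \<le> n * card I" "coeff (prod f I) (n * card I) = (\<Prod>i\<in>I. coeff (f i) n)"
proof -
  have "degree (prod f I) \<le> n * card I \<and> coeff (prod f I) (n * card I) = (\<Prod>i\<in>I. coeff (f i) n)"
    using assms
  proof (induction rule: finite_induct)
    case (insert i I)
    have le: "degree (f i) \<le> n" "degree (prod f I) \<le> n * card I" using insert by auto
    have "coeff (f i * prod f I) (n + n * card I) = coeff (f i) n * coeff (prod f I) (n * card I)"
    proof -
      have "coeff (f i * prod f I) (n + n * card I) = 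
          (\<Sum>k\<le>n + n * card I. coeff (f i) k * coeff (prod f I) (n + n * card I - k))"
        by (rule coeff_mult)
      also have "\<dots> = (\<Sum>k\<in>{n}. coeff (f i) k * coeff (prod f I) (n + n * card I - k))"
      proof (rule sum.mono_neutral_right)
        show "\<forall>k\<in>{..n + n * card I} - {n}. coeff (f i) k * coeff (prod f I) (n + n * card I - k) = 0"
        proof
          fix k assume "k \<in> {..n + n * card I} - {n}"
          then have "degree (f i) < k \<or> degree (prod f I) < n + n * card I - k"
            using le by auto
          then show "coeff (f i) k * coeff (prod f I) (n + n * card I - k) = 0"
            by (auto simp: coeff_eq_0)
        qed
      qed auto
      finally show ?thesis by simp
    qed
    moreover have "degree (f i * prod f I) \<le> n + n * card I"
      using le degree_mult_le[of "f i" "prod f I"] by linarith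
    ultimately show ?case
      using insert by simp
  qed auto
  then show "degree (prod f I) \<le> n * card I" "coeff (prod f I) (n * card I) = (\<Prod>i\<in>I. coeff (f i) n)"
    by auto
qed

text \<open>Every product in the Leibniz formula has the same formal degree
  \<open>p * CARD('n)\<close>, and coefficients at the formal degree multiply even when some factor
  has smaller degree.\<close>

lemma det_poly_coeff:
  fixes P :: "'a::comm_ring_1 poly ^ 'n ^ 'n"
  assumes "\<And>i j. degree (P $ i $ j) \<le> p"
  shows "degree (det P) \<le> p * CARD('n)"
    and "coeff (det P) (p * CARD('n)) = det (\<chi> i j. coeff (P $ i $ j) p)"
proof -
  have oi: "(of_int (sign s) :: 'a poly) = [:of_int (sign s):]" for s :: "'n \<Rightarrow> 'n"
    by (simp add: of_int_poly)
  show "degree (det P) \<le> p * CARD('n)"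
    unfolding det_def oi
    using coeff_prod_bounded(1)[of "UNIV :: 'n set" "\<lambda>i. P $ i $ s i" p for s] assms
    by (intro degree_sum_le) (auto intro: order_trans[OF degree_smult_le])
  show "coeff (det P) (p * CARD('n)) = det (\<chi> i j. coeff (P $ i $ j) p)"
    unfolding det_def oi
    using coeff_prod_bounded(2)[of "UNIV :: 'n set" "\<lambda>i. P $ i $ s i" p for s] assms
    by (simp add: coeff_sum)
qed

text \<open>The coefficient at the formal degree is the determinant of a matrix with a zero column.
  With \<open>p > 0\<close> the formal degree is positive, so a vanishing coefficient there does
  lower the degree.\<close>

lemma det_poly_degree_less:
  fixes P :: "'a::{idom,ring_char_0} poly ^ 'n ^ 'n"
  assumes "\<And>i j. degree (P $ i $ j) \<le> p" "p > 0" "\<And>a. coeff (P $ a $ k) p = 0"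
  shows "degree (det P) < p * CARD('n)"
proof -
  have "det (\<chi> i j. coeff (P $ i $ j) p) = 0"
    by (rule det_zero_column(1)[of k]) (use assms(3) in \<open>auto simp: column_def vec_eq_iff\<close>)
  then have c: "coeff (det P) (p * CARD('n)) = 0"
    using det_poly_coeff(2)[OF assms(1)] by simp
  have "0 < p * CARD('n)" using assms(2) by simp
  moreover have "degree (det P) \<le> p * CARD('n)" by (rule det_poly_coeff(1)[OF assms(1)])
  ultimately show ?thesis
    using c leading_coeff_0_iff[of "det P"] by (cases "degree (det P) = p * CARD('n)") auto
qed

lemma poly_det: "poly (det P) z = det (eval_mat P z)"
proof -
  have oi: "(of_int (sign s) :: complex poly) = [:of_int (sign s):]" for s :: "'n \<Rightarrow> 'n"
    by (simp add: of_int_poly)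
  show ?thesis
    unfolding det_def by (simp add: poly_sum poly_prod eval_mat_def map_matrix_def oi)
qed

lemma ar_poly_entry:
  "ar_poly p A $ i $ j = monom (if i = j then 1 else 0) p + (\<Sum>k=1..p. monom (of_real (A k $ i $ j)) (p - k))"
  by (simp add: ar_poly_def matrix_smult_def const_mat_def map_matrix_def mat_def sum_component mult_monom
      flip: monom_0)

lemma ma_poly_entry: "ma_poly q B $ i $ j = (\<Sum>k=0..q. monom (of_real (B k $ i $ j)) (q - k))"
  by (simp add: ma_poly_def matrix_smult_def const_mat_def map_matrix_def sum_component mult_monom
      flip: monom_0)

lemma degree_ar_poly: "degree (ar_poly p A $ i $ j) \<le> p"
  unfolding ar_poly_entry
  by (intro degree_add_le degree_sum_le) (auto intro: order_trans[OF degree_monom_le])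

lemma degree_ma_poly: "degree (ma_poly q B $ i $ j) \<le> q"
  unfolding ma_poly_entry by (intro degree_sum_le) (auto intro: order_trans[OF degree_monom_le])

lemma coeff_ar_poly:
  assumes "p > 0"
  shows "coeff (ar_poly p A $ i $ j) p = (if i = j then 1 else 0)"
proof -
  have "(\<Sum>k=1..p. coeff (monom (of_real (A k $ i $ j)) (p - k)) p) = (0 :: complex)"
    using assms by (intro sum.neutral) auto
  then show ?thesis by (simp add: ar_poly_entry coeff_sum)
qed

lemma degree_det_ar_poly:
  fixes A :: "nat \<Rightarrow> real ^ 'd ^ 'd"
  assumes "p > 0"
  shows "degree (det (ar_poly p A)) = p * CARD('d)" 
proof (rule antisym)
  show "degree (det (ar_poly p A)) \<le> p * CARD('d)"
    by (rule det_poly_coeff(1)) (rule degree_ar_poly)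
  have "(\<chi> i j. coeff (ar_poly p A $ i $ j) p) = mat 1"
    by (simp add: coeff_ar_poly[OF assms] mat_def)
  then have "coeff (det (ar_poly p A)) (p * CARD('d)) = 1"
    by (subst det_poly_coeff(2)) (auto simp: degree_ar_poly)
  then show "p * CARD('d) \<le> degree (det (ar_poly p A))"
    by (intro le_degree) auto
qed

lemma matrix_inv_right_left:
  fixes A :: "'a::field ^ 'n ^ 'n"
  assumes "det A \<noteq> 0"
  shows "A ** matrix_inv A = mat 1" "matrix_inv A ** A = mat 1"
proof -
  have "invertible A" using assms by (simp add: invertible_det_nz)
  then have "\<exists>A'. A ** A' = mat 1 \<and> A' ** A = mat 1" by (simp add: invertible_def)
  then have "A ** matrix_inv A = mat 1 \<and> matrix_inv A ** A = mat 1"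
    unfolding matrix_inv_def by (rule someI_ex)
  then show "A ** matrix_inv A = mat 1" "matrix_inv A ** A = mat 1" by auto
qed

text \<open>The numerator matrix of Cramer's rule. It is polymorphic in the entries, so that it
  makes sense for polynomial matrices and commutes with evaluating them.\<close>

definition replace_column :: "'a ^ 'n ^ 'n \<Rightarrow> 'n \<Rightarrow> 'a ^ 'n ^ 'n \<Rightarrow> 'n \<Rightarrow> 'a ^ 'n ^ 'n"
  where "replace_column P i Q j = (\<chi> a b. if b = i then Q $ a $ j else P $ a $ b)"

lemma matrix_inv_mult_entry:
  fixes P Q :: "'a::field ^ 'n ^ 'n"
  assumes "det P \<noteq> 0"
  shows "(matrix_inv P ** Q) $ i $ j = det (replace_column P i Q j) / det P"
proof -
  define x where "x = column j (matrix_inv P ** Q)"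
  have "P ** (matrix_inv P ** Q) = Q"
    by (simp add: matrix_mul_assoc matrix_inv_right_left[OF assms])
  then have "P *v x = column j Q"
    by (simp add: x_def column_def matrix_vector_mult_def matrix_matrix_mult_def vec_eq_iff)
  then have "x = (\<chi> k. det (\<chi> a b. if b = k then column j Q $ a else P $ a $ b) / det P)"
    using cramer[OF assms, of x "column j Q"] by blast
  then have "x $ i = det (\<chi> a b. if b = i then column j Q $ a else P $ a $ b) / det P"
    by simp
  then show ?thesis
    by (simp add: x_def column_def replace_column_def cong: if_cong)
qed

text \<open>By Cramer's rule the entry is a quotient of determinants: \<open>P\<close> with column
  \<open>i\<close> replaced by column \<open>j\<close> of \<open>Q\<close>, over \<open>P\<close>.
  The new column has degree at most \<open>q < p\<close>, so the numerator has smaller degree than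
  \<open>det P\<close>, and the zeros of the denominator lie in the left half-plane.\<close>

lemma causal_transform_mcarma:
  fixes A B :: "nat \<Rightarrow> real ^ 'd ^ 'd"
  assumes P_def: "P = ar_poly p A" and Q_def: "Q = ma_poly q B" and "q < p" and roots: "\<And>z. poly (det P) z = 0 \<Longrightarrow> Re z < 0"
  shows "\<exists>h. causal_transform h
    (\<lambda>x. (matrix_inv (eval_mat P (\<i> * of_real x)) ** eval_mat Q (\<i> * of_real x)) $ i $ j)"
proof -
  let ?num = "det (replace_column P i Q j)"
  have "degree ?num < p * CARD('d)"
  proof (rule det_poly_degree_less)
    have d: "degree (Q $ a $ j) < p" for a
      using degree_ma_poly[of q B a j] \<open>q < p\<close> by (simp add: Q_def)
    then show "degree (replace_column P i Q j $ a $ b) \<le> p" for a b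
      using degree_ar_poly[of p A a b] by (auto simp: replace_column_def P_def intro: less_imp_le)
    show "coeff (replace_column P i Q j $ a $ i) p = 0" for a
      using d[of a] by (simp add: replace_column_def coeff_eq_0)
  qed (use \<open>q < p\<close> in auto)
  then have "degree ?num < degree (det P)"
    using degree_det_ar_poly[of p A] \<open>q < p\<close> by (simp add: P_def)
  with roots obtain h where h: "causal_transform h (\<lambda>x. poly ?num (\<i> * of_real x) / poly (det P) (\<i> * of_real x))"
    using causal_transform_rational[of "det P" ?num] by auto
  have "poly ?num (\<i> * of_real x) / poly (det P) (\<i> * of_real x) =
     (matrix_inv (eval_mat P (\<i> * of_real x)) ** eval_mat Q (\<i> * of_real x)) $ i $ j" for x
  proof -
    have "det (eval_mat P (\<i> * of_real x)) \<noteq> 0"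
      using roots[of "\<i> * of_real x"] by (auto simp: poly_det)
    moreover have "eval_mat (replace_column P i Q j) z = replace_column (eval_mat P z) i (eval_mat Q z) j" for z
      by (simp add: eval_mat_def map_matrix_def replace_column_def vec_eq_iff)
    ultimately show ?thesis
      by (simp add: poly_det matrix_inv_mult_entry)
  qed
  then show ?thesis using h by auto
qed

section \<open>Square-integrable functions and Parseval\<close>

definition square_integrable :: "'a measure \<Rightarrow> ('a \<Rightarrow> 'b::{banach, second_countable_topology}) \<Rightarrow> bool"
  where "square_integrable M f \<longleftrightarrow> f \<in> borel_measurable M \<and> integrable M (\<lambda>x. (norm (f x))\<^sup>2)"

text \<open>The distance is an extended nonnegative integral. A Bochner integral would be 0 when the
  square is not integrable, and convergence could then hold vacuously.\<close>

definition L2_tendsto :: "'a measure \<Rightarrow> ('i \<Rightarrow> 'a \<Rightarrow> 'b::{banach, second_countable_topology}) \<Rightarrow> ('a \<Rightarrow> 'b) \<Rightarrow> 'i filter \<Rightarrow> bool"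
  where "L2_tendsto M f g F \<longleftrightarrow> ((\<lambda>n. \<integral>\<^sup>+ x. ennreal ((norm (f n x - g x))\<^sup>2) \<partial>M) \<longlongrightarrow> 0) F"

lemma square_integrableI_nn:
  assumes "f \<in> borel_measurable M" "(\<integral>\<^sup>+ x. ennreal ((norm (f x))\<^sup>2) \<partial>M) < \<infinity>"
  shows "square_integrable M f"
  using assms unfolding square_integrable_def
  by (auto intro!: integrableI_bounded)

lemma square_integrable_nn:
  assumes "square_integrable M f"
  shows "(\<integral>\<^sup>+ x. ennreal ((norm (f x))\<^sup>2) \<partial>M) = ennreal (LINT x|M. (norm (f x))\<^sup>2)"
  using assms unfolding square_integrable_def by (intro nn_integral_eq_integral) auto

lemma square_integrable_mult:
  fixes f g :: "'a \<Rightarrow> 'b::{real_normed_field, banach, second_countable_topology}"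
  assumes "square_integrable M f" "square_integrable M g"
  shows "integrable M (\<lambda>x. f x * g x)"
proof (rule Bochner_Integration.integrable_bound)
  show "integrable M (\<lambda>x. (norm (f x))\<^sup>2 + (norm (g x))\<^sup>2)"
    using assms by (auto simp: square_integrable_def)
  show "(\<lambda>x. f x * g x) \<in> borel_measurable M"
    using assms by (auto simp: square_integrable_def)
  have "norm (f x * g x) \<le> norm ((norm (f x))\<^sup>2 + (norm (g x))\<^sup>2)" for x
  proof -
    have "0 \<le> norm (f x) * norm (g x)" by simp
    moreover have "2 * (norm (f x) * norm (g x)) \<le> (norm (f x))\<^sup>2 + (norm (g x))\<^sup>2"
      using sum_squares_bound[of "norm (f x)" "norm (g x)"] by (simp only: mult.assoc)
    ultimately show ?thesis unfolding norm_mult real_norm_def by linarith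
  qed
  then show "AE x in M. norm (f x * g x) \<le> norm ((norm (f x))\<^sup>2 + (norm (g x))\<^sup>2)" by simp
qed

lemma square_integrable_add:
  assumes "square_integrable M f" "square_integrable M g"
  shows "square_integrable M (\<lambda>x. f x + g x)"
  unfolding square_integrable_def
proof
  show "integrable M (\<lambda>x. (norm (f x + g x))\<^sup>2)"
  proof (rule Bochner_Integration.integrable_bound)
    show "integrable M (\<lambda>x. 2 * (norm (f x))\<^sup>2 + 2 * (norm (g x))\<^sup>2)"
      using assms by (auto simp: square_integrable_def)
    have "(norm (f x + g x))\<^sup>2 \<le> 2 * (norm (f x))\<^sup>2 + 2 * (norm (g x))\<^sup>2" for x
    proof -
      have "(norm (f x + g x))\<^sup>2 \<le> (norm (f x) + norm (g x))\<^sup>2"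
        by (intro power_mono norm_triangle_ineq) auto
      also have "\<dots> \<le> 2 * (norm (f x))\<^sup>2 + 2 * (norm (g x))\<^sup>2"
        using sum_squares_bound[of "norm (f x)" "norm (g x)"] unfolding power2_sum by linarith
      finally show ?thesis .
    qed
    then show "AE x in M. norm ((norm (f x + g x))\<^sup>2) \<le> norm (2 * (norm (f x))\<^sup>2 + 2 * (norm (g x))\<^sup>2)"
      by (simp add: abs_of_nonneg)
    show "(\<lambda>x. (norm (f x + g x))\<^sup>2) \<in> borel_measurable M"
      using assms by (auto simp: square_integrable_def)
  qed
qed (use assms in \<open>auto simp: square_integrable_def\<close>)

lemma square_integrable_scale:
  fixes f :: "'a \<Rightarrow> 'b::{real_normed_field, banach, second_countable_topology}"
  assumes "square_integrable M f"
  shows "square_integrable M (\<lambda>x. c * f x)"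
  using assms by (auto simp: square_integrable_def norm_mult power_mult_distrib)

lemma square_integrable_zero: "square_integrable M (\<lambda>_. 0)"
  by (simp add: square_integrable_def)

lemma square_integrable_minus: "square_integrable M f \<Longrightarrow> square_integrable M (\<lambda>x. - f x)"
  by (simp add: square_integrable_def)

lemma square_integrable_diff:
  assumes "square_integrable M f" "square_integrable M g"
  shows "square_integrable M (\<lambda>x. f x - g x)"
  using square_integrable_add[OF assms(1) square_integrable_minus[OF assms(2)]] by simp

lemma square_integrable_sum:
  assumes "\<And>i. i \<in> I \<Longrightarrow> square_integrable M (f i)"
  shows "square_integrable M (\<lambda>x. \<Sum>i\<in>I. f i x)"
  using assms
  by (induction I rule: infinite_finite_induct) (auto intro: square_integrable_add square_integrable_zero)

lemma square_integrable_cong_AE: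
  assumes "square_integrable M f" "g \<in> borel_measurable M" "AE x in M. f x = g x"
  shows "square_integrable M g"
proof -
  have "integrable M (\<lambda>x. (norm (g x))\<^sup>2) = integrable M (\<lambda>x. (norm (f x))\<^sup>2)"
    using assms by (intro integrable_cong_AE) (auto simp: square_integrable_def)
  then show ?thesis using assms by (auto simp: square_integrable_def)
qed

lemma Cauchy_Schwarz_LINT:
  fixes f g :: "'a \<Rightarrow> 'b::{real_normed_field, banach, second_countable_topology}"
  assumes "square_integrable M f" "square_integrable M g"
  shows "norm (LINT x|M. f x * g x) \<le> sqrt (LINT x|M. (norm (f x))\<^sup>2) * sqrt (LINT x|M. (norm (g x))\<^sup>2)"
proof -
  let ?F = "LINT x|M. (norm (f x))\<^sup>2" and ?G = "LINT x|M. (norm (g x))\<^sup>2"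
  let ?I = "LINT x|M. norm (f x) * norm (g x)"
  have meas [measurable]: "f \<in> borel_measurable M" "g \<in> borel_measurable M"
    using assms by (auto simp: square_integrable_def)
  have int: "integrable M (\<lambda>x. norm (f x) * norm (g x))"
    using integrable_norm[OF square_integrable_mult[OF assms]] by (simp add: norm_mult)
  have "(ennreal ?I)\<^sup>2 = (\<integral>\<^sup>+x. ennreal (norm (f x)) * ennreal (norm (g x)) \<partial>M)\<^sup>2"
    using int by (subst nn_integral_eq_integral[symmetric]) (auto simp: ennreal_mult)
  also have "\<dots> \<le> (\<integral>\<^sup>+x. (ennreal (norm (f x)))\<^sup>2 \<partial>M) * (\<integral>\<^sup>+x. (ennreal (norm (g x)))\<^sup>2 \<partial>M)"
    by (rule Cauchy_Schwarz_nn_integral) measurable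
  also have "\<dots> = ennreal ?F * ennreal ?G"
    using square_integrable_nn[OF assms(1)] square_integrable_nn[OF assms(2)] by (simp add: ennreal_power)
  finally have "ennreal (?I\<^sup>2) \<le> ennreal (?F * ?G)"
    by (subst ennreal_power[symmetric], simp, subst ennreal_mult) auto
  then have "?I\<^sup>2 \<le> ?F * ?G"
    by (subst (asm) ennreal_le_iff) auto
  then have "?I \<le> sqrt (?F * ?G)" by (rule real_le_rsqrt)
  moreover have "norm (LINT x|M. f x * g x) \<le> ?I"
    using integral_norm_bound[of M "\<lambda>x. f x * g x"] by (simp add: norm_mult)
  ultimately show ?thesis by (simp add: real_sqrt_mult)
qed

lemma L2_tendsto_eventually:
  assumes "L2_tendsto M f g F" and meas: "\<And>n. f n \<in> borel_measurable M" "g \<in> borel_measurable M"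
  shows "\<forall>\<^sub>F n in F. square_integrable M (\<lambda>x. f n x - g x)"
proof -
  have "\<forall>\<^sub>F n in F. (\<integral>\<^sup>+ x. ennreal ((norm (f n x - g x))\<^sup>2) \<partial>M) < 1"
    using assms(1) unfolding L2_tendsto_def by (rule order_tendstoD) auto
  then show ?thesis
  proof eventually_elim
    case (elim n)
    have "(1 :: ennreal) < \<infinity>" by simp
    with elim show ?case
      by (intro square_integrableI_nn borel_measurable_diff meas) (rule less_trans)
  qed
qed

lemma L2_tendsto_real:
  assumes "L2_tendsto M f g F" and meas: "\<And>n. f n \<in> borel_measurable M" "g \<in> borel_measurable M"
  shows "((\<lambda>n. sqrt (LINT x|M. (norm (f n x - g x))\<^sup>2)) \<longlongrightarrow> 0) F"
proof -
  have "((\<lambda>n. enn2real (\<integral>\<^sup>+ x. ennreal ((norm (f n x - g x))\<^sup>2) \<partial>M)) \<longlongrightarrow> enn2real 0) F"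
    using assms(1) unfolding L2_tendsto_def by (intro tendsto_enn2real) auto
  moreover have "enn2real (\<integral>\<^sup>+ x. ennreal ((norm (f n x - g x))\<^sup>2) \<partial>M) = (LINT x|M. (norm (f n x - g x))\<^sup>2)" for n
    using meas by (subst integral_eq_nn_integral) auto
  ultimately have "((\<lambda>n. LINT x|M. (norm (f n x - g x))\<^sup>2) \<longlongrightarrow> 0) F" by simp
  from tendsto_real_sqrt[OF this] show ?thesis by simp
qed

lemma norm_add3: "norm (a + b + c) \<le> norm a + norm b + norm c"
  using norm_triangle_ineq[of "a + b" c] norm_triangle_ineq[of a b] by linarith

text \<open>Only the limits are known to be square integrable, so the product is expanded around
  them. With \<open>u = f n - f'\<close> and \<open>v = g n - g'\<close> the error is
  \<open>u v + u g' + f' v\<close>, and each part is bounded by Cauchy-Schwarz.\<close>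

lemma L2_tendsto_integral_mult:
  fixes f g :: "'i \<Rightarrow> 'a \<Rightarrow> 'b::{real_normed_field, banach, second_countable_topology}"
  assumes fl: "L2_tendsto M f f' F" and gl: "L2_tendsto M g g' F"
    and fm: "\<And>n. f n \<in> borel_measurable M" and gm: "\<And>n. g n \<in> borel_measurable M"
    and f': "square_integrable M f'" and g': "square_integrable M g'"
  shows "((\<lambda>n. LINT x|M. f n x * g n x) \<longlongrightarrow> (LINT x|M. f' x * g' x)) F"
proof -
  have meas: "f' \<in> borel_measurable M" "g' \<in> borel_measurable M"
    using f' g' by (auto simp: square_integrable_def)
  let ?a = "\<lambda>n. sqrt (LINT x|M. (norm (f n x - f' x))\<^sup>2)"
  let ?b = "\<lambda>n. sqrt (LINT x|M. (norm (g n x - g' x))\<^sup>2)"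
  let ?A = "sqrt (LINT x|M. (norm (f' x))\<^sup>2)" and ?B = "sqrt (LINT x|M. (norm (g' x))\<^sup>2)"
  have "((\<lambda>n. (LINT x|M. f n x * g n x) - (LINT x|M. f' x * g' x)) \<longlongrightarrow> 0) F"
  proof (rule Lim_null_comparison)
    have "((\<lambda>n. ?a n * ?b n + ?a n * ?B + ?A * ?b n) \<longlongrightarrow> 0 * 0 + 0 * ?B + ?A * 0) F"
      by (intro tendsto_intros L2_tendsto_real fl gl fm gm meas)
    then show "((\<lambda>n. ?a n * ?b n + ?a n * ?B + ?A * ?b n) \<longlongrightarrow> 0) F" by simp
    show "\<forall>\<^sub>F n in F. norm ((LINT x|M. f n x * g n x) - (LINT x|M. f' x * g' x))
       \<le> ?a n * ?b n + ?a n * ?B + ?A * ?b n"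
      using L2_tendsto_eventually[OF fl fm meas(1)] L2_tendsto_eventually[OF gl gm meas(2)]
    proof eventually_elim
      case (elim n)
      let ?u = "\<lambda>x. f n x - f' x" and ?v = "\<lambda>x. g n x - g' x"
      have i: "integrable M (\<lambda>x. ?u x * ?v x)" "integrable M (\<lambda>x. ?u x * g' x)" "integrable M (\<lambda>x. f' x * ?v x)"
          "integrable M (\<lambda>x. f' x * g' x)"
        using elim f' g' by (auto intro: square_integrable_mult)
      have "(LINT x|M. f n x * g n x) = (LINT x|M. ?u x * ?v x + ?u x * g' x + f' x * ?v x + f' x * g' x)"
        by (simp add: algebra_simps)
      also have "\<dots> = (LINT x|M. ?u x * ?v x) + (LINT x|M. ?u x * g' x) + (LINT x|M. f' x * ?v x) + (LINT x|M. f' x * g' x)"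
        using i by (simp only: Bochner_Integration.integral_add Bochner_Integration.integrable_add)
      finally have eq: "(LINT x|M. f n x * g n x) - (LINT x|M. f' x * g' x)
          = (LINT x|M. ?u x * ?v x) + (LINT x|M. ?u x * g' x) + (LINT x|M. f' x * ?v x)"
        unfolding diff_eq_eq .
      have "norm ((LINT x|M. f n x * g n x) - (LINT x|M. f' x * g' x))
          \<le> norm (LINT x|M. ?u x * ?v x) + norm (LINT x|M. ?u x * g' x) + norm (LINT x|M. f' x * ?v x)"
        unfolding eq by (rule norm_add3)
      also have "\<dots> \<le> ?a n * ?b n + ?a n * ?B + ?A * ?b n"
        using elim f' g' by (intro add_mono Cauchy_Schwarz_LINT)
      finally show ?case .
    qed
  qed
  then show ?thesis by (rule Lim_null[THEN iffD2])
qed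

lemma L2_limit_square_integrable:
  assumes "L2_tendsto M f g F" "F \<noteq> bot" "\<And>n. square_integrable M (f n)" "g \<in> borel_measurable M"
  shows "square_integrable M g"
proof -
  have "\<forall>\<^sub>F n in F. square_integrable M (\<lambda>x. f n x - g x)"
    using assms by (intro L2_tendsto_eventually) (auto simp: square_integrable_def)
  then obtain n where "square_integrable M (\<lambda>x. f n x - g x)"
    using assms(2) eventually_happens by blast
  from square_integrable_diff[OF assms(3) this, of n] show ?thesis by simp
qed

text \<open>Fatou's lemma for the squared distances replaces the passage to an almost everywhere
  convergent subsequence.\<close>

lemma L2_tendsto_AE_unique:
  assumes lim: "L2_tendsto M f g sequentially"
    and [measurable]: "\<And>n. f n \<in> borel_measurable M" "g \<in> borel_measurable M"
    and ptw: "AE x in M. (\<lambda>n. f n x) \<longlonglongrightarrow> h x"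
  shows "AE x in M. g x = h x"
proof -
  let ?D = "\<lambda>n x. ennreal ((norm (f n x - g x))\<^sup>2)"
  have "liminf (\<lambda>n. \<integral>\<^sup>+ x. ?D n x \<partial>M) = 0"
    using lim unfolding L2_tendsto_def by (intro lim_imp_Liminf) auto
  moreover have "(\<integral>\<^sup>+ x. liminf (\<lambda>n. ?D n x) \<partial>M) \<le> liminf (\<lambda>n. \<integral>\<^sup>+ x. ?D n x \<partial>M)"
    by (rule nn_integral_liminf) measurable
  ultimately have "(\<integral>\<^sup>+ x. liminf (\<lambda>n. ?D n x) \<partial>M) = 0" by simp
  then have "AE x in M. liminf (\<lambda>n. ?D n x) = 0"
    by (subst (asm) nn_integral_0_iff_AE) measurable
  then show ?thesis
    using ptw
  proof eventually_elim
    case (elim x)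
    from elim(2) have "(\<lambda>n. ?D n x) \<longlonglongrightarrow> ennreal ((norm (h x - g x))\<^sup>2)"
      by (intro tendsto_intros)
    then have "liminf (\<lambda>n. ?D n x) = ennreal ((norm (h x - g x))\<^sup>2)"
      by (intro lim_imp_Liminf) auto
    with elim(1) show ?case by simp
  qed
qed

section \<open>Truncated inverse transforms and Parseval's identity\<close>

definition truncated_inverse :: "(real \<Rightarrow> complex) \<Rightarrow> real \<Rightarrow> real \<Rightarrow> complex"
  where "truncated_inverse F N t =
    of_real (1 / (2 * pi)) * (LINT x:{- N..N}|lborel. exp (\<i> * of_real t * of_real x) * F x)"

lemma truncated_inverse_measurable:
  assumes "continuous_on UNIV F"
  shows "truncated_inverse F N \<in> borel_measurable borel"
proof -
  have [measurable]: "F \<in> borel_measurable borel"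
    using assms by (rule borel_measurable_continuous_onI)
  show ?thesis
    unfolding truncated_inverse_def set_lebesgue_integral_def by measurable
qed

lemma truncated_inverse_tendsto:
  assumes "causal_transform h F" "t \<noteq> 0"
  shows "((\<lambda>N. truncated_inverse F N t) \<longlongrightarrow> h t) at_top"
proof -
  have "((\<lambda>N. truncated_inverse F N t) \<longlongrightarrow> of_real (1 / (2 * pi)) * (complex_of_real (2 * pi) * h t)) at_top"
    using assms unfolding truncated_inverse_def causal_transform_def by (intro tendsto_intros) auto
  then show ?thesis by simp
qed

text \<open>Both the mean-square and the pointwise limit are taken along integer \<open>N\<close>,
  since Fatou's lemma is about sequences.\<close>

lemma causal_transform_inverse_AE:
  assumes c: "causal_transform h F" and u: "u \<in> borel_measurable lborel"
    and lim: "L2_tendsto lborel (truncated_inverse F) u at_top"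
  shows "AE t in lborel. u t = h t"
proof -
  have [measurable]: "h \<in> borel_measurable lborel" "u \<in> borel_measurable lborel"
    using c u unfolding causal_transform_def by (auto dest: borel_measurable_integrable)
  have [measurable]: "truncated_inverse F N \<in> borel_measurable borel" for N
    using c by (intro truncated_inverse_measurable) (simp add: causal_transform_def)
  have "L2_tendsto lborel (\<lambda>n. truncated_inverse F (real n)) u sequentially"
    using lim filterlim_real_sequentially unfolding L2_tendsto_def by (rule filterlim_compose)
  moreover have "AE t in lborel. (\<lambda>n. truncated_inverse F (real n) t) \<longlonglongrightarrow> h t"
    using AE_lborel_singleton[of 0]
    by eventually_elim (blast intro: filterlim_compose[OF truncated_inverse_tendsto[OF c] filterlim_real_sequentially])
  ultimately show ?thesis
    by (intro L2_tendsto_AE_unique) auto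
qed

lemma L2_tendsto_cong_AE:
  assumes "L2_tendsto M f u F" "AE x in M. u x = v x"
  shows "L2_tendsto M f v F"
proof -
  have "(\<integral>\<^sup>+ x. ennreal ((norm (f n x - u x))\<^sup>2) \<partial>M) = (\<integral>\<^sup>+ x. ennreal ((norm (f n x - v x))\<^sup>2) \<partial>M)" for n
    by (rule nn_integral_cong_AE) (use assms(2) in eventually_elim, simp)
  then show ?thesis using assms(1) by (simp add: L2_tendsto_def)
qed

lemma L2_tendsto_const:
  "L2_tendsto M (\<lambda>_. f) f F"
  by (simp add: L2_tendsto_def)

lemma square_integrable_shift:
  fixes f :: "real \<Rightarrow> 'b::{banach, second_countable_topology}"
  assumes "square_integrable lborel f"
  shows "square_integrable lborel (\<lambda>s. f (t + s))"
  using assms lborel_integrable_real_affine[of "\<lambda>x. (norm (f x))\<^sup>2" 1 t]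
  by (auto simp: square_integrable_def)

lemma L2_tendsto_shift:
  assumes "L2_tendsto lborel f g F" and [measurable]: "\<And>n. f n \<in> borel_measurable borel" "g \<in> borel_measurable borel"
  shows "L2_tendsto lborel (\<lambda>n s. f n (t + s)) (\<lambda>s. g (t + s :: real)) F"
proof -
  have "(\<integral>\<^sup>+ x. ennreal ((norm (f n x - g x))\<^sup>2) \<partial>lborel) = (\<integral>\<^sup>+ x. ennreal ((norm (f n (t + x) - g (t + x)))\<^sup>2) \<partial>lborel)" for n
    by (subst nn_integral_real_affine[where t = t and c = 1]) auto
  then show ?thesis using assms(1) by (simp add: L2_tendsto_def)
qed

text \<open>For \<open>x\<close> in \<open>[-N, N]\<close> and real \<open>s\<close> the integrand
  is dominated by \<open>|F x| |k s|\<close>, which is integrable because \<open>F\<close> is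
  continuous on a compact interval. So Fubini applies, and the inner integral over \<open>s\<close>
  is the transform of \<open>k\<close> at \<open>- x\<close>.\<close>

lemma truncated_parseval:
  assumes F: "continuous_on UNIV F" and k: "causal_transform k G"
  shows "(LINT s|lborel. truncated_inverse F N (t + s) * k s) =
    truncated_inverse (\<lambda>x. F x * G (- x)) N t"
proof -
  have [measurable]: "F \<in> borel_measurable borel"
    using F by (rule borel_measurable_continuous_onI)
  have ki: "integrable lborel k" using k by (simp add: causal_transform_def)
  then have [measurable]: "k \<in> borel_measurable borel" by (auto dest: borel_measurable_integrable)
  let ?f = "\<lambda>x s. indicator {- N..N} x *\<^sub>R (exp (\<i> * of_real (t + s) * of_real x) * F x * k s)"
  have norm_f: "norm (?f x s) = indicator {- N..N} x * norm (F x) * norm (k s)" for x s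
    by (simp add: norm_mult)
  have Fi: "set_integrable lborel {- N..N} (\<lambda>x. norm (F x))"
    by (intro borel_integrable_atLeastAtMost' continuous_intros continuous_on_subset[OF F]) auto
  have int: "integrable (lborel \<Otimes>\<^sub>M lborel) (\<lambda>(x, s). ?f x s)"
  proof (rule lborel_pair.Fubini_integrable)
    show "(\<lambda>(x, s). ?f x s) \<in> borel_measurable (lborel \<Otimes>\<^sub>M lborel)" by measurable
    have "integrable lborel (\<lambda>x. indicator {- N..N} x * norm (F x) * (LINT s|lborel. norm (k s)))"
      using Fi unfolding set_integrable_def by auto
    then show "integrable lborel (\<lambda>x. LINT s|lborel. norm (case (x, s) of (x, s) \<Rightarrow> ?f x s))"
      unfolding prod.case norm_f by simp
    have "integrable lborel (\<lambda>s. ?f x s)" for x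
    proof (rule Bochner_Integration.integrable_bound)
      show "integrable lborel (\<lambda>s. norm (F x) * norm (k s))" using ki by simp
      have "norm (?f x s) \<le> norm (norm (F x) * norm (k s))" for s
        unfolding norm_f by (simp add: indicator_def)
      then show "AE s in lborel. norm (?f x s) \<le> norm (norm (F x) * norm (k s))" by (rule AE_I2)
    qed measurable
    then show "AE x in lborel. integrable lborel (\<lambda>s. case (x, s) of (x, s) \<Rightarrow> ?f x s)" by simp
  qed
  have inner: "(LINT s|lborel. ?f x s) = indicator {- N..N} x *\<^sub>R (exp (\<i> * of_real t * of_real x) * (F x * G (- x)))" for x
  proof (cases "x \<in> {- N..N}")
    case True
    have "exp (\<i> * of_real (t + s) * of_real x) = exp (\<i> * of_real t * of_real x) * exp (- (\<i> * of_real s * of_real (- x)))" for s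
      unfolding exp_add[symmetric] by (simp add: algebra_simps)
    then have "?f x s = exp (\<i> * of_real t * of_real x) * F x * (exp (- (\<i> * of_real s * of_real (- x))) * k s)" for s
      using True by (simp add: mult_ac)
    then have "(LINT s|lborel. ?f x s) = exp (\<i> * of_real t * of_real x) * F x
        * (LINT s|lborel. exp (- (\<i> * of_real s * of_real (- x))) * k s)"
      by (simp only: integral_mult_right_zero)
    also have "(LINT s|lborel. exp (- (\<i> * of_real s * of_real (- x))) * k s) = G (- x)"
      using k by (simp only: causal_transform_def)
    finally show ?thesis using True by simp
  qed simp
  have "(LINT s|lborel. truncated_inverse F N (t + s) * k s)
      = (LINT s|lborel. of_real (1 / (2 * pi)) * (LINT x|lborel. ?f x s))"
    unfolding truncated_inverse_def set_lebesgue_integral_def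
    by (subst mult.assoc, subst integral_mult_left_zero[symmetric]) (simp add: mult_ac)
  also have "\<dots> = of_real (1 / (2 * pi)) * (LINT s|lborel. LINT x|lborel. ?f x s)" by simp
  also have "(LINT s|lborel. LINT x|lborel. ?f x s) = (LINT x|lborel. LINT s|lborel. ?f x s)"
    by (rule lborel_pair.Fubini_integral) (use int in simp)
  also have "\<dots> = (LINT x|lborel. indicator {- N..N} x *\<^sub>R (exp (\<i> * of_real t * of_real x) * (F x * G (- x))))"
    by (simp only: inner)
  finally show ?thesis
    by (simp add: truncated_inverse_def set_lebesgue_integral_def)
qed

text \<open>The shifted truncated inverses converge in mean square to the shifted \<open>h\<close>,
  hence so do their pairings with the square-integrable \<open>k\<close>. The truncation stays on
  the frequency side of the statement, where the product need not be known to be integrable.\<close>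

lemma causal_parseval:
  assumes h: "causal_transform h F" and k: "causal_transform k G"
    and hL: "L2_tendsto lborel (truncated_inverse F) h at_top"
    and sq: "square_integrable lborel h" "square_integrable lborel k"
  shows "((\<lambda>N. truncated_inverse (\<lambda>x. F x * G (- x)) N t) \<longlongrightarrow> (LINT s|lborel. h (t + s) * k s)) at_top"
proof -
  have F: "continuous_on UNIV F" using h by (simp add: causal_transform_def)
  have m: "h \<in> borel_measurable borel" "k \<in> borel_measurable borel"
    using sq by (auto simp: square_integrable_def)
  have "((\<lambda>N. LINT s|lborel. truncated_inverse F N (t + s) * k s) \<longlongrightarrow> (LINT s|lborel. h (t + s) * k s)) at_top"
    using sq m F
    by (intro L2_tendsto_integral_mult L2_tendsto_shift[OF hL] L2_tendsto_const square_integrable_shift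
      truncated_inverse_measurable) 
     (auto intro: measurable_compose[OF _ truncated_inverse_measurable[OF F]])
  then show ?thesis by (simp add: truncated_parseval[OF F k])
qed

section \<open>Second moments of a Levy process\<close>

lemma additive_sum_of_copies:
  fixes r :: "real \<Rightarrow> real"
  assumes add: "\<And>s t. 0 \<le> s \<Longrightarrow> 0 \<le> t \<Longrightarrow> r (s + t) = r s + r t" and "0 \<le> t"
  shows "r (real n * t) = real n * r t"
proof (induction n)
  case 0
  show ?case using add[of 0 0] by simp
next
  case (Suc n)
  then show ?case using add[of t "real n * t"] \<open>0 \<le> t\<close> by (simp add: algebra_simps)
qed

text \<open>Additivity is carried back to the unit interval, which turns bounds there into linearity.\<close>

lemma additive_fractional_part:
  fixes r :: "real \<Rightarrow> real"
  assumes add: "\<And>s t. 0 \<le> s \<Longrightarrow> 0 \<le> t \<Longrightarrow> r (s + t) = r s + r t" and "r 1 = 0" "0 \<le> t"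
  shows "r (frac (real n * t)) = real n * r t"
proof -
  define k where "k = nat \<lfloor>real n * t\<rfloor>"
  have k: "real n * t = real k * 1 + frac (real n * t)"
    using \<open>0 \<le> t\<close> by (simp add: k_def frac_def)
  have "real n * r t = r (real n * t)" using additive_sum_of_copies[OF add \<open>0 \<le> t\<close>] by simp
  also have "\<dots> = r (real k * 1) + r (frac (real n * t))"
    by (subst k, subst add) auto
  also have "r (real k * 1) = 0"
    using additive_sum_of_copies[of r 1 k, OF add] \<open>r 1 = 0\<close> by simp
  finally show ?thesis by simp
qed

text \<open>The deviation \<open>q\<close> from the linear function is additive, vanishes at 1 and
  is bounded by \<open>2 C\<close> on the unit interval. So \<open>n |q t|\<close>, being the value
  of \<open>|q|\<close> at a fractional part, stays below \<open>2 C\<close> for every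
  \<open>n\<close>.\<close>

lemma additive_bounded_linear:
  fixes r :: "real \<Rightarrow> real"
  assumes add: "\<And>s t. 0 \<le> s \<Longrightarrow> 0 \<le> t \<Longrightarrow> r (s + t) = r s + r t"
    and bound: "\<And>t. 0 \<le> t \<Longrightarrow> t \<le> 1 \<Longrightarrow> \<bar>r t\<bar> \<le> C" and t: "0 \<le> t"
  shows "r t = t * r 1"
proof (rule ccontr)
  define q where "q t = r t - t * r 1" for t
  assume "r t \<noteq> t * r 1"
  then have q: "\<bar>q t\<bar> > 0" by (simp add: q_def)
  have qadd: "q (s + u) = q s + q u" if "0 \<le> s" "0 \<le> u" for s u
    using add[OF that] by (simp add: q_def algebra_simps)
  have qb: "\<bar>q u\<bar> \<le> 2 * C" if "0 \<le> u" "u \<le> 1" for u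
  proof -
    have "\<bar>u * r 1\<bar> \<le> 1 * C"
      unfolding abs_mult using that bound[of 1] by (intro mult_mono) auto
    then show ?thesis using bound[OF that] unfolding q_def by linarith
  qed
  obtain n where n: "2 * C < real n * \<bar>q t\<bar>"
    using reals_Archimedean3[OF q] by blast
  have "real n * q t = q (frac (real n * t))"
    using additive_fractional_part[of q t n] qadd t by (simp add: q_def)
  then have "real n * \<bar>q t\<bar> = \<bar>q (frac (real n * t))\<bar>"
    by (metis abs_mult abs_of_nat)
  also have "\<dots> \<le> 2 * C" by (intro qb) (auto simp: less_imp_le[OF frac_lt_1])
  finally show False using n by simp
qed

text \<open>Under the product law of the pair, Fubini provides a single \<open>y\<close> for which
  \<open>(x + y)^2\<close> is integrable with respect to the law of \<open>A\<close>; then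
  \<open>x^2 \<le> 2 (x + y)^2 + 2 y^2\<close>. In this way a second moment of the sum passes to its
  independent parts.\<close>

lemma (in prob_space) indep_square_integrable:
  fixes A B :: "'a \<Rightarrow> real"
  assumes ind: "indep_var borel A borel B" and sq: "integrable M (\<lambda>w. (A w + B w)\<^sup>2)"
  shows "square_integrable M A"
proof -
  have rv [measurable]: "A \<in> borel_measurable M" "B \<in> borel_measurable M"
    and pd: "distr M borel A \<Otimes>\<^sub>M distr M borel B = distr M (borel \<Otimes>\<^sub>M borel) (\<lambda>w. (A w, B w))"
    using ind unfolding indep_var_distribution_eq by auto
  interpret A: prob_space "distr M borel A" by (rule prob_space_distr) simp
  interpret B: prob_space "distr M borel B" by (rule prob_space_distr) simp
  interpret P: pair_sigma_finite "distr M borel A" "distr M borel B" ..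
  have "integrable (distr M borel A \<Otimes>\<^sub>M distr M borel B) (\<lambda>(x, y). (x + y)\<^sup>2)"
    unfolding pd by (subst integrable_distr_eq) (use sq in auto)
  then have "AE y in distr M borel B. integrable (distr M borel A) (\<lambda>x. (x + y)\<^sup>2)"
    by (rule P.AE_integrable_snd)
  then obtain y where y: "integrable (distr M borel A) (\<lambda>x. (x + y)\<^sup>2)"
    using eventually_happens[of _ "ae_filter (distr M borel B)"] B.ae_filter_bot by blast
  have "integrable (distr M borel A) (\<lambda>x. x\<^sup>2)"
  proof (rule Bochner_Integration.integrable_bound)
    show "integrable (distr M borel A) (\<lambda>x. 2 * (x + y)\<^sup>2 + 2 * y\<^sup>2)" using y by simp
    have "x\<^sup>2 \<le> 2 * (x + y)\<^sup>2 + 2 * y\<^sup>2" for x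
    proof -
      have "2 * (x + y)\<^sup>2 + 2 * y\<^sup>2 - x\<^sup>2 = (x + 2 * y)\<^sup>2"
        by (simp add: power2_eq_square algebra_simps)
      then show ?thesis using zero_le_power2[of "x + 2 * y"] by linarith
    qed
    then show "AE x in distr M borel A. norm (x\<^sup>2) \<le> norm (2 * (x + y)\<^sup>2 + 2 * y\<^sup>2)"
      by (simp add: abs_of_nonneg)
  qed auto
  then show ?thesis
    by (subst (asm) integrable_distr_eq) (auto simp: square_integrable_def)
qed

section \<open>Moments at all times from moments at time 1\<close>

lemma component_borel: "(\<lambda>x :: real ^ 'd. x $ i) \<in> borel_measurable borel"
  by (intro borel_measurable_continuous_onI continuous_intros)

lemma integral_add4:
  fixes a b c d :: "'a \<Rightarrow> 'b::{banach, second_countable_topology}"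
  assumes "integrable M a" "integrable M b" "integrable M c" "integrable M d"
  shows "(LINT x|M. a x + b x + c x + d x) = (LINT x|M. a x) + (LINT x|M. b x) + (LINT x|M. c x) + (LINT x|M. d x)"
  using assms by simp

lemma PiM_component_borel:
  "k \<in> I \<Longrightarrow> (\<lambda>f. f k $ i) \<in> borel_measurable (PiM I (\<lambda>_. borel :: (real ^ 'd) measure))"
  by (rule measurable_compose[where f = "\<lambda>f. f k" and N = borel, OF _ component_borel])
    (rule measurable_component_singleton)

locale square_integrable_levy = prob_space M for M :: "'w measure" +
  fixes X :: "real \<Rightarrow> 'w \<Rightarrow> real ^ 'd"
  assumes levy: "levy_process M X"
    and sq1: "\<And>i. square_integrable M (\<lambda>w. X 1 w $ i)"
    and mean1: "\<And>i. (LINT w|M. X 1 w $ i) = 0"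
begin

lemma X_measurable [measurable]: "0 \<le> t \<Longrightarrow> X t \<in> borel_measurable M"
  using levy by (simp add: levy_process_def)

lemma X_component_measurable: "0 \<le> t \<Longrightarrow> (\<lambda>w. X t w $ i) \<in> borel_measurable M"
  by (rule measurable_compose[OF X_measurable]) (auto intro: borel_measurable_continuous_onI continuous_intros)

lemma X_0: "AE w in M. X 0 w = 0"
  using levy by (simp add: levy_process_def)

text \<open>The first increment is kept as \<open>X s - X 0\<close> because \<open>X 0\<close>
  vanishes only almost surely; expectations remove it by an a.e. argument. The time grid is
  \<open>0, s, s + h\<close>.\<close>

lemma indep_increments:
  assumes "0 \<le> s" "0 \<le> h"
  shows "indep_var borel (\<lambda>w. (X s w - X 0 w) $ i) borel (\<lambda>w. (X (s + h) w - X s w) $ j)"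
proof -
  define t :: "nat \<Rightarrow> real" where "t k = (if k = 0 then 0 else if k = 1 then s else s + h)" for k
  have "0 \<le> t 0 \<and> (\<forall>k<2. t k \<le> t (Suc k))"
    using assms by (auto simp: t_def)
  then have "indep_vars (\<lambda>_. borel) (\<lambda>k w. X (t (Suc k)) w - X (t k) w) {..<2}"
    using levy unfolding levy_process_def by blast
  then have "indep_var (PiM {0} (\<lambda>_. borel)) (\<lambda>w. restrict (\<lambda>k. X (t (Suc k)) w - X (t k) w) {0})
      (PiM {1} (\<lambda>_. borel)) (\<lambda>w. restrict (\<lambda>k. X (t (Suc k)) w - X (t k) w) {1})"
    by (rule indep_var_restrict) auto
  then have "indep_var borel ((\<lambda>f. f 0 $ i) \<circ> (\<lambda>w. restrict (\<lambda>k. X (t (Suc k)) w - X (t k) w) {0}))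
       borel ((\<lambda>f. f 1 $ j) \<circ> (\<lambda>w. restrict (\<lambda>k. X (t (Suc k)) w - X (t k) w) {1}))"
    by (rule indep_var_compose) (rule PiM_component_borel, simp)+
  then show ?thesis by (simp add: comp_def t_def)
qed

lemma stationary_increments:
  assumes "0 \<le> s" "0 \<le> h" and [measurable]: "f \<in> borel_measurable borel"
  shows "expectation (\<lambda>w. f (X (s + h) w - X s w)) = expectation (\<lambda>w. f (X h w) :: real)"
    "integrable M (\<lambda>w. f (X (s + h) w - X s w)) \<longleftrightarrow> integrable M (\<lambda>w. f (X h w))"
proof -
  have d: "distr M borel (\<lambda>w. X (s + h) w - X s w) = distr M borel (X h)"
    using levy assms unfolding levy_process_def by blast
  have [measurable]: "(\<lambda>w. X (s + h) w - X s w) \<in> borel_measurable M" "X h \<in> borel_measurable M"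
    using assms by (auto intro!: borel_measurable_diff)
  have "expectation (\<lambda>w. f (X (s + h) w - X s w)) = (LINT x|distr M borel (\<lambda>w. X (s + h) w - X s w). f x)"
    by (rule integral_distr[symmetric]) measurable
  also have "\<dots> = expectation (\<lambda>w. f (X h w))"
    unfolding d by (rule integral_distr) measurable
  finally show "expectation (\<lambda>w. f (X (s + h) w - X s w)) = expectation (\<lambda>w. f (X h w))" .
  have "integrable M (\<lambda>w. f (X (s + h) w - X s w)) \<longleftrightarrow> integrable (distr M borel (\<lambda>w. X (s + h) w - X s w)) f"
    by (rule integrable_distr_eq[symmetric]) measurable
  also have "\<dots> \<longleftrightarrow> integrable M (\<lambda>w. f (X h w))"
    unfolding d by (rule integrable_distr_eq) measurable
  finally show "integrable M (\<lambda>w. f (X (s + h) w - X s w)) \<longleftrightarrow> integrable M (\<lambda>w. f (X h w))" .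
qed

text \<open>For \<open>s \<le> 1\<close>, up to null sets \<open>X 1\<close> is the sum of the
  independent variables \<open>X s\<close> and \<open>X 1 - X s\<close>, so \<open>X s\<close>
  inherits its second moment. Beyond 1, stationarity compares \<open>X s - X 1\<close> with
  \<open>X (s - 1)\<close>, one unit of time at each step.\<close>

lemma square_integrable_X: 
  assumes "0 \<le> t"
  shows "square_integrable M (\<lambda>w. X t w $ i)"
proof -
  have unit: "square_integrable M (\<lambda>w. X s w $ i)" if s: "0 \<le> s" "s \<le> 1" for s
  proof -
    have "integrable M (\<lambda>w. (X 1 w $ i)\<^sup>2) = integrable M (\<lambda>w. ((X s w - X 0 w) $ i + (X (s + (1 - s)) w - X s w) $ i)\<^sup>2)"
    proof (rule integrable_cong_AE)
      show "AE w in M. (X 1 w $ i)\<^sup>2 = ((X s w - X 0 w) $ i + (X (s + (1 - s)) w - X s w) $ i)\<^sup>2"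
        using X_0 by eventually_elim simp
    qed (use s in \<open>auto intro!: borel_measurable_power borel_measurable_diff borel_measurable_add X_component_measurable\<close>)
    then have "integrable M (\<lambda>w. ((X s w - X 0 w) $ i + (X (s + (1 - s)) w - X s w) $ i)\<^sup>2)"
      using sq1[of i] by (simp add: square_integrable_def)
    then have "square_integrable M (\<lambda>w. (X s w - X 0 w) $ i)"
      using s by (intro indep_square_integrable[OF indep_increments[of s "1 - s" i i]]) auto
    then show ?thesis
      by (rule square_integrable_cong_AE) (use X_0 X_component_measurable s in \<open>auto elim: eventually_mono\<close>)
  qed
  have "square_integrable M (\<lambda>w. X s w $ i)" if "0 \<le> s" "s \<le> real n" for s n
    using that
  proof (induction n arbitrary: s)
    case 0
    then show ?case using unit[of 0] by simp
  next
    case (Suc n)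
    show ?case
    proof (cases "s \<le> 1")
      case False
      then have s: "0 \<le> s - 1" "s - 1 \<le> real n" using Suc.prems by auto
      have "integrable M (\<lambda>w. ((X (1 + (s - 1)) w - X 1 w) $ i)\<^sup>2)"
        using Suc.IH[OF s] s by (subst stationary_increments(2)) (auto simp: square_integrable_def component_borel)
      then have "square_integrable M (\<lambda>w. (X (1 + (s - 1)) w - X 1 w) $ i)"
        using s by (auto simp: square_integrable_def intro!: borel_measurable_diff X_component_measurable)
      from square_integrable_add[OF this sq1[of i]] show ?thesis by simp
    qed (use unit Suc in auto)
  qed
  from this[OF assms real_nat_ceiling_ge] show ?thesis .
qed

lemma integrable_X: "0 \<le> t \<Longrightarrow> integrable M (\<lambda>w. X t w $ i)"
  by (rule square_integrable_imp_integrable)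
    (use square_integrable_X[of t i] in \<open>auto simp: square_integrable_def\<close>)

lemma square_integrable_increment:
  assumes "0 \<le> s" "0 \<le> t"
  shows "square_integrable M (\<lambda>w. (X t w - X s w) $ i)"
  using square_integrable_diff[OF square_integrable_X[OF assms(2)] square_integrable_X[OF assms(1)]] by simp

lemma expectation_product_increment:
  assumes "0 \<le> s" "0 \<le> h"
  shows "expectation (\<lambda>w. X s w $ i * (X (s + h) w - X s w) $ j) = expectation (\<lambda>w. X s w $ i) * expectation (\<lambda>w. X h w $ j)"
proof -
  have int: "integrable M (\<lambda>w. (X s w - X 0 w) $ i)" "integrable M (\<lambda>w. (X (s + h) w - X s w) $ j)"
    using assms integrable_X by (auto simp: vector_minus_component)
  have "expectation (\<lambda>w. X s w $ i * (X (s + h) w - X s w) $ j) = expectation (\<lambda>w. (X s w - X 0 w) $ i * (X (s + h) w - X s w) $ j)"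
  proof (rule integral_cong_AE)
    show "AE w in M. X s w $ i * (X (s + h) w - X s w) $ j = (X s w - X 0 w) $ i * (X (s + h) w - X s w) $ j"
      using X_0 by eventually_elim simp
  qed (use assms in \<open>auto intro!: borel_measurable_times borel_measurable_diff X_component_measurable\<close>)
  also have "\<dots> = expectation (\<lambda>w. (X s w - X 0 w) $ i) * expectation (\<lambda>w. (X (s + h) w - X s w) $ j)"
    by (rule indep_var_lebesgue_integral[OF indep_increments[OF assms] int])
  also have "expectation (\<lambda>w. (X s w - X 0 w) $ i) = expectation (\<lambda>w. X s w $ i)"
  proof (rule integral_cong_AE)
    show "AE w in M. (X s w - X 0 w) $ i = X s w $ i"
      using X_0 by eventually_elim simp
  qed (use assms in \<open>auto intro!: borel_measurable_diff X_component_measurable\<close>)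
  also have "expectation (\<lambda>w. (X (s + h) w - X s w) $ j) = expectation (\<lambda>w. X h w $ j)"
    by (rule stationary_increments(1)[OF assms component_borel])
  finally show ?thesis .
qed

lemma mean_additive:
  assumes "0 \<le> s" "0 \<le> h"
  shows "expectation (\<lambda>w. X (s + h) w $ i) = expectation (\<lambda>w. X s w $ i) + expectation (\<lambda>w. X h w $ i)"
proof -
  have "expectation (\<lambda>w. X h w $ i) = expectation (\<lambda>w. (X (s + h) w - X s w) $ i)"
    using stationary_increments(1)[OF assms component_borel] by simp
  also have "\<dots> = expectation (\<lambda>w. X (s + h) w $ i) - expectation (\<lambda>w. X s w $ i)"
    using assms integrable_X by simp
  finally show ?thesis by simp
qed

text \<open>The products of means cannot be dropped yet: the mean is known to vanish only at time 1,
  and the proof that it vanishes elsewhere goes through the variance, hence through this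
  expansion.\<close>

lemma second_moment_increment:
  assumes "0 \<le> s" "0 \<le> h"
  shows "expectation (\<lambda>w. X (s + h) w $ i * X (s + h) w $ j) = expectation (\<lambda>w. X s w $ i * X s w $ j)
     + expectation (\<lambda>w. X s w $ i) * expectation (\<lambda>w. X h w $ j)
     + expectation (\<lambda>w. X s w $ j) * expectation (\<lambda>w. X h w $ i)
     + expectation (\<lambda>w. X h w $ i * X h w $ j)"
proof -
  let ?a = "\<lambda>w. X s w $ i" and ?b = "\<lambda>w. X s w $ j"
  let ?c = "\<lambda>w. (X (s + h) w - X s w) $ i" and ?d = "\<lambda>w. (X (s + h) w - X s w) $ j"
  have D: "square_integrable M ?c" "square_integrable M ?d"
    using assms by (auto intro!: square_integrable_increment simp del: vector_minus_component)
  have S: "square_integrable M ?a" "square_integrable M ?b"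
    using assms by (auto intro!: square_integrable_X)
  have pt: "(a + c) * (b + d) = a * b + a * d + b * c + c * d" for a b c d :: real
    by (simp add: algebra_simps)
  have "X (s + h) w $ i = ?a w + ?c w" "X (s + h) w $ j = ?b w + ?d w" for w
    by simp_all
  then have "expectation (\<lambda>w. X (s + h) w $ i * X (s + h) w $ j) = expectation (\<lambda>w. (?a w + ?c w) * (?b w + ?d w))"
    by (simp only:)
  also have "\<dots> = expectation (\<lambda>w. ?a w * ?b w + ?a w * ?d w + ?b w * ?c w + ?c w * ?d w)"
    unfolding pt ..
  also have "\<dots> = expectation (\<lambda>w. ?a w * ?b w) + expectation (\<lambda>w. ?a w * ?d w)
      + expectation (\<lambda>w. ?b w * ?c w) + expectation (\<lambda>w. ?c w * ?d w)"
    by (intro integral_add4 square_integrable_mult S D)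
  finally have eq: "expectation (\<lambda>w. X (s + h) w $ i * X (s + h) w $ j) = \<dots>" .
  have eq3: "expectation (\<lambda>w. ?c w * ?d w) = expectation (\<lambda>w. X h w $ i * X h w $ j)"
    by (rule stationary_increments(1)[OF assms, of "\<lambda>x. x $ i * x $ j"])
      (intro borel_measurable_times component_borel)
  show ?thesis unfolding eq eq3 expectation_product_increment[OF assms] ..
qed

lemma second_moment_eq_norm: "expectation (\<lambda>w. (norm (X t w $ i))\<^sup>2) = expectation (\<lambda>w. X t w $ i * X t w $ i)"
  by (simp add: power2_eq_square)

text \<open>While the means are unknown it is the variance, not the second moment, that is additive:
  the cross terms cancel against the squared mean. Being nonnegative, it is bounded by
  \<open>v 1\<close> on the unit interval.\<close>

lemma variance_linear:
  fixes i :: 'd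
  assumes t: "0 \<le> t"
  defines "v \<equiv> \<lambda>t. expectation (\<lambda>w. X t w $ i * X t w $ i) - (expectation (\<lambda>w. X t w $ i))\<^sup>2"
  shows "v t = t * v 1" and "v t = expectation (\<lambda>w. (X t w $ i - expectation (\<lambda>w. X t w $ i))\<^sup>2)"
proof -
  have veq: "v t = expectation (\<lambda>w. (X t w $ i - expectation (\<lambda>w. X t w $ i))\<^sup>2)" if "0 \<le> t" for t
    using variance_eq[of "\<lambda>w. X t w $ i"] integrable_X[OF that] square_integrable_X[OF that, of i]
    by (simp add: v_def square_integrable_def power2_eq_square)
  then show "v t = expectation (\<lambda>w. (X t w $ i - expectation (\<lambda>w. X t w $ i))\<^sup>2)" using t .
  have nn: "0 \<le> v t" if "0 \<le> t" for t using veq[OF that] by simp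
  have add: "v (s + h) = v s + v h" if "0 \<le> s" "0 \<le> h" for s h
    using that by (simp add: v_def second_moment_increment mean_additive power2_eq_square algebra_simps)
  have "\<bar>v u\<bar> \<le> v 1" if "0 \<le> u" "u \<le> 1" for u
    using nn[of u] nn[of "1 - u"] add[of u "1 - u"] that by simp
  then show "v t = t * v 1" using add t by (intro additive_bounded_linear) auto
qed

lemma tendsto_X_0:
  "AE w in M. \<forall>t. (\<forall>n. 0 \<le> t n) \<longrightarrow> t \<longlonglongrightarrow> 0 \<longrightarrow> (\<lambda>n. X (t n) w) \<longlonglongrightarrow> 0"
proof -
  have "AE w in M. \<forall>t\<ge>0. ((\<lambda>s. X s w) \<longlongrightarrow> X t w) (at_right t)"
    using levy unfolding levy_process_def by (auto elim: eventually_mono)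
  then show ?thesis using X_0
  proof eventually_elim
    case (elim w)
    then have "((\<lambda>s. X s w) \<longlongrightarrow> X 0 w) (at_right 0)" by auto
    then have "((\<lambda>s. X s w) \<longlongrightarrow> X 0 w) (at 0 within {0..})"
      by (simp add: at_within_Ici_at_right)
    then have c: "continuous (at 0 within {0..}) (\<lambda>s. X s w)"
      by (simp add: continuous_within)
    show ?case
      using c elim(2) unfolding continuous_within_sequentially by (auto simp: o_def)
  qed
qed

text \<open>The mean is additive in \<open>t\<close> and vanishes at \<open>1\<close>, but is not known to be measurable. The points
  \<open>u n = frac (n t) / n\<close> tend to \<open>0\<close> and carry the same mean as \<open>t\<close>; since the variance is linear in
  time, right continuity of the paths at \<open>0\<close> forces that mean to vanish.\<close>

lemma mean_zero:
  assumes t: "0 \<le> t"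
  shows "expectation (\<lambda>w. X t w $ i) = 0"
proof -
  define m where "m t = expectation (\<lambda>w. X t w $ i)" for t
  define u where "u n = frac (real (Suc n) * t) / real (Suc n)" for n
  have u: "0 \<le> u n" "u n \<le> inverse (real (Suc n))" for n
    using frac_ge_0[of "real (Suc n) * t"] frac_lt_1[of "real (Suc n) * t"]
    by (auto simp: u_def divide_simps simp del: of_nat_Suc)
  have u0: "u \<longlonglongrightarrow> 0"
    by (rule real_tendsto_sandwich[OF _ _ tendsto_const LIMSEQ_inverse_real_of_nat]) (auto simp: u simp del: of_nat_Suc)
  have mu: "m (u n) = m t" for n
  proof -
    have "real (Suc n) * m (u n) = m (real (Suc n) * u n)"
      using additive_sum_of_copies[of m "u n" "Suc n"] mean_additive u by (simp add: m_def)
    also have "real (Suc n) * u n = frac (real (Suc n) * t)" by (simp add: u_def del: of_nat_Suc)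
    also have "m \<dots> = real (Suc n) * m t"
      using additive_fractional_part[of m t "Suc n"] mean_additive mean1 t unfolding m_def by blast
    finally show ?thesis by (simp del: of_nat_Suc)
  qed
  define v where "v = expectation (\<lambda>w. X 1 w $ i * X 1 w $ i) - (expectation (\<lambda>w. X 1 w $ i))\<^sup>2"
  have "L2_tendsto M (\<lambda>n w. X (u n) w $ i) (\<lambda>_. m t) sequentially"
  proof -
    have "(\<integral>\<^sup>+ w. ennreal ((norm (X (u n) w $ i - m t))\<^sup>2) \<partial>M) = ennreal (u n * v)" for n
    proof -
      have "square_integrable M (\<lambda>w. X (u n) w $ i - m t)"
        using square_integrable_X[OF u(1)] by (rule square_integrable_diff) (simp add: square_integrable_def)
      then have "(\<integral>\<^sup>+ w. ennreal ((norm (X (u n) w $ i - m t))\<^sup>2) \<partial>M) = ennreal (expectation (\<lambda>w. (X (u n) w $ i - m (u n))\<^sup>2))"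
        by (subst square_integrable_nn) (simp_all add: mu)
      also have "expectation (\<lambda>w. (X (u n) w $ i - m (u n))\<^sup>2) = u n * v"
        using variance_linear[OF u(1), where i = i] unfolding m_def v_def by simp
      finally show ?thesis .
    qed
    moreover have "(\<lambda>n. ennreal (u n * v)) \<longlonglongrightarrow> ennreal (0 * v)"
      by (intro tendsto_intros u0)
    ultimately show ?thesis by (simp add: L2_tendsto_def)
  qed
  moreover have "AE w in M. (\<lambda>n. X (u n) w $ i) \<longlonglongrightarrow> 0 $ i"
    using tendsto_X_0
  proof eventually_elim
    case (elim w)
    then have "(\<lambda>n. X (u n) w) \<longlonglongrightarrow> 0" using u0 u(1) by blast
    then show ?case by (rule tendsto_vec_nth)
  qed
  ultimately have "AE w in M. m t = 0 $ i"
    using X_component_measurable u by (intro L2_tendsto_AE_unique) auto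
  then show ?thesis by (simp add: m_def)
qed

text \<open>Mixed second moments are additive once the mean is zero, and on the unit interval
  Cauchy-Schwarz bounds them by the diagonal ones, which are linear as variances. For
  \<open>s \<le> t\<close> the independent increment from \<open>s\<close> to \<open>t\<close> has
  mean zero and drops out.\<close>

lemma covariance_X:
  assumes "0 \<le> s" "0 \<le> t"
  shows "expectation (\<lambda>w. X s w $ i * X t w $ j) = min s t * expectation (\<lambda>w. X 1 w $ i * X 1 w $ j)"
proof -
  have add: "expectation (\<lambda>w. X (s + h) w $ i * X (s + h) w $ j) = expectation (\<lambda>w. X s w $ i * X s w $ j)
     + expectation (\<lambda>w. X h w $ i * X h w $ j)" if "0 \<le> s" "0 \<le> h" for s h i j
    using that by (simp add: second_moment_increment mean_zero)
  have diag: "expectation (\<lambda>w. X t w $ i * X t w $ i) = t * expectation (\<lambda>w. X 1 w $ i * X 1 w $ i)" if "0 \<le> t" for t i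
    using variance_linear(1)[OF that, of i] mean_zero[OF that] mean_zero[of 1] by simp
  have same: "expectation (\<lambda>w. X t w $ i * X t w $ j) = t * expectation (\<lambda>w. X 1 w $ i * X 1 w $ j)" if "0 \<le> t" for t i j
  proof (rule additive_bounded_linear[of "\<lambda>t. expectation (\<lambda>w. X t w $ i * X t w $ j)"])
    fix u :: real assume u: "0 \<le> u" "u \<le> 1"
    let ?a = "expectation (\<lambda>w. X 1 w $ i * X 1 w $ i)" and ?b = "expectation (\<lambda>w. X 1 w $ j * X 1 w $ j)"
    have "\<bar>expectation (\<lambda>w. X u w $ i * X u w $ j)\<bar> \<le> sqrt (expectation (\<lambda>w. (norm (X u w $ i))\<^sup>2)) * sqrt (expectation (\<lambda>w. (norm (X u w $ j))\<^sup>2))"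
      using Cauchy_Schwarz_LINT[OF square_integrable_X[OF u(1)] square_integrable_X[OF u(1)], of i j] unfolding real_norm_def[of "expectation _"] .
    also have "\<dots> = sqrt (u * ?a) * sqrt (u * ?b)"
      unfolding second_moment_eq_norm diag[OF u(1)] ..
    also have "\<dots> \<le> sqrt (1 * ?a) * sqrt (1 * ?b)"
    proof -
      have nn: "0 \<le> expectation (\<lambda>w. X 1 w $ k * X 1 w $ k)" for k
        by (intro Bochner_Integration.integral_nonneg zero_le_square)
      show ?thesis
        using u nn[of i] nn[of j]
        by (intro mult_mono real_sqrt_le_mono mult_right_mono real_sqrt_ge_zero mult_nonneg_nonneg order.refl zero_le_one)
    qed
    finally show "\<bar>expectation (\<lambda>w. X u w $ i * X u w $ j)\<bar> \<le> sqrt (1 * ?a) * sqrt (1 * ?b)" .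
  qed (rule add, assumption+, rule that)
  have ordered: "expectation (\<lambda>w. X s w $ i * X t w $ j) = s * expectation (\<lambda>w. X 1 w $ i * X 1 w $ j)"
    if "0 \<le> s" "s \<le> t" for s t i j
  proof -
    have t: "t = s + (t - s)" "0 \<le> t - s" using that by auto
    have "expectation (\<lambda>w. X s w $ i * X t w $ j) = expectation (\<lambda>w. X s w $ i * X s w $ j + X s w $ i * (X (s + (t - s)) w - X s w) $ j)"
      by (intro Bochner_Integration.integral_cong refl) (simp add: algebra_simps)
    also have "\<dots> = expectation (\<lambda>w. X s w $ i * X s w $ j) + expectation (\<lambda>w. X s w $ i * (X (s + (t - s)) w - X s w) $ j)"
      using that by (intro Bochner_Integration.integral_add square_integrable_mult square_integrable_X square_integrable_increment) auto
    finally show ?thesis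
      using that by (simp only: expectation_product_increment[OF that(1) t(2)] mean_zero[OF t(2)] same[OF that(1)])
  qed
  show ?thesis
  proof (cases "s \<le> t")
    case True
    then show ?thesis using ordered[of s t i j] assms by (simp add: min_def)
  next
    case False
    then show ?thesis using ordered[of t s j i] assms by (simp add: min_def mult.commute)
  qed
qed

text \<open>Mean-square continuity in time, with which the left limits that define the process at
  negative times are identified.\<close>

lemma L2_increment:
  assumes "0 \<le> s" "s \<le> t"
  shows "(\<integral>\<^sup>+ w. ennreal ((norm (X s w $ i - X t w $ i))\<^sup>2) \<partial>M)
    = ennreal ((t - s) * expectation (\<lambda>w. X 1 w $ i * X 1 w $ i))"
proof -
  have t: "0 \<le> t" using assms by simp
  let ?x = "\<lambda>w. X s w $ i" and ?y = "\<lambda>w. X t w $ i"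
  have S: "square_integrable M ?x" and T: "square_integrable M ?y"
    using square_integrable_X assms(1) t by blast+
  have i: "integrable M (\<lambda>w. - (?x w * ?y w))" 
    using square_integrable_mult[OF S T] by (rule Bochner_Integration.integrable_minus)
  have pt: "(norm (x - y))\<^sup>2 = x * x + - (x * y) + - (x * y) + y * y" for x y :: real
    by (simp add: power2_eq_square algebra_simps)
  have "expectation (\<lambda>w. (norm (?x w - ?y w))\<^sup>2)
      = expectation (\<lambda>w. ?x w * ?x w + - (?x w * ?y w) + - (?x w * ?y w) + ?y w * ?y w)"
    unfolding pt ..
  also have "\<dots> = expectation (\<lambda>w. ?x w * ?x w) + expectation (\<lambda>w. - (?x w * ?y w))
      + expectation (\<lambda>w. - (?x w * ?y w)) + expectation (\<lambda>w. ?y w * ?y w)"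
    by (intro integral_add4 i square_integrable_mult S T)
  also have "\<dots> = (t - s) * expectation (\<lambda>w. X 1 w $ i * X 1 w $ i)"
    unfolding Bochner_Integration.integral_minus covariance_X[OF assms(1) assms(1)]
      covariance_X[OF assms(1) t] covariance_X[OF t t]
    using assms by (simp add: algebra_simps)
  finally have "expectation (\<lambda>w. (norm (?x w - ?y w))\<^sup>2) = (t - s) * expectation (\<lambda>w. X 1 w $ i * X 1 w $ i)" .
  with square_integrable_nn[OF square_integrable_diff[OF S T]] show ?thesis by (rule trans[OF _ arg_cong])
qed

end

section \<open>The isometry of the stochastic integral\<close>

lemma square_integrable_component:
  fixes f :: "'a \<Rightarrow> real ^ 'd"
  assumes "square_integrable M f"
  shows "square_integrable M (\<lambda>w. f w $ i)"
  unfolding square_integrable_def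
proof
  show m: "(\<lambda>w. f w $ i) \<in> borel_measurable M"
    using assms by (intro measurable_compose[OF _ component_borel]) (simp add: square_integrable_def)
  show "integrable M (\<lambda>w. (norm (f w $ i))\<^sup>2)"
  proof (rule Bochner_Integration.integrable_bound)
    show "integrable M (\<lambda>w. (norm (f w))\<^sup>2)" using assms by (simp add: square_integrable_def)
    have "(norm (f w $ i))\<^sup>2 \<le> (norm (f w))\<^sup>2" for w
      by (intro power_mono Finite_Cartesian_Product.norm_nth_le norm_ge_zero)
    then show "AE w in M. norm ((norm (f w $ i))\<^sup>2) \<le> norm ((norm (f w))\<^sup>2)" by simp
  qed (use m in simp)
qed

text \<open>The entry type is left general so that two applications descend from matrices to their
  entries.\<close>

lemma component_tendsto_L2:
  fixes f :: "'i \<Rightarrow> 'a \<Rightarrow> 'b::{banach, second_countable_topology} ^ 'd"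
  assumes "((\<lambda>n. \<integral>\<^sup>+ w. ennreal ((norm (g w - f n w))\<^sup>2) \<partial>M) \<longlongrightarrow> 0) F"
  shows "L2_tendsto M (\<lambda>n w. f n w $ i) (\<lambda>w. g w $ i) F"
  unfolding L2_tendsto_def
proof (rule tendsto_sandwich[OF _ _ tendsto_const assms])
  have "(norm (f n w $ i - g w $ i))\<^sup>2 \<le> (norm (g w - f n w))\<^sup>2" for n w
    using Finite_Cartesian_Product.norm_nth_le[of "g w - f n w" i] by (simp add: norm_minus_commute power_mono)
  then show "\<forall>\<^sub>F n in F. (\<integral>\<^sup>+ w. ennreal ((norm (f n w $ i - g w $ i))\<^sup>2) \<partial>M)
      \<le> (\<integral>\<^sup>+ w. ennreal ((norm (g w - f n w))\<^sup>2) \<partial>M)"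
    by (intro always_eventually allI nn_integral_mono ennreal_leI)
qed auto

section \<open>Second moments of the two-sided process\<close>

lemma half_path_apply: "0 \<le> t \<Longrightarrow> half_path X w t = X t w"
  by (simp add: half_path_def)

lemma half_path_distr:
  fixes f :: "real ^ 'd \<Rightarrow> real" and X Y :: "real \<Rightarrow> 'w \<Rightarrow> real ^ 'd"
  assumes X: "half_path X \<in> measurable M (PiM {0..} (\<lambda>_. borel))"
    and Y: "half_path Y \<in> measurable M (PiM {0..} (\<lambda>_. borel))"
    and eq: "distr M (PiM {0..} (\<lambda>_. borel)) (half_path X) = distr M (PiM {0..} (\<lambda>_. borel)) (half_path Y)"
    and t: "0 \<le> t" and f: "f \<in> borel_measurable borel"
  shows "(LINT w|M. f (X t w)) = (LINT w|M. f (Y t w))"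
    and "integrable M (\<lambda>w. f (X t w)) \<longleftrightarrow> integrable M (\<lambda>w. f (Y t w))"
proof -
  let ?P = "PiM {0..} (\<lambda>_. borel :: (real ^ 'd) measure)"
  have g: "(\<lambda>p. f (p t)) \<in> borel_measurable ?P"
    using t by (intro measurable_compose[OF _ f] measurable_component_singleton) simp
  have "(LINT w|M. f (Z t w)) = (LINT p|distr M ?P (half_path Z). f (p t))"
      "integrable M (\<lambda>w. f (Z t w)) \<longleftrightarrow> integrable (distr M ?P (half_path Z)) (\<lambda>p. f (p t))"
    if "half_path Z \<in> measurable M ?P" for Z :: "real \<Rightarrow> 'w \<Rightarrow> real ^ 'd"
    using integral_distr[OF that g] integrable_distr_eq[OF that g] t by (simp_all add: half_path_apply)
  from this[OF X] this[OF Y] eq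
  show "(LINT w|M. f (X t w)) = (LINT w|M. f (Y t w))"
    "integrable M (\<lambda>w. f (X t w)) \<longleftrightarrow> integrable M (\<lambda>w. f (Y t w))" by simp_all
qed

text \<open>This is \<open>min \<bar>s\<bar> \<bar>t\<bar>\<close> if \<open>s\<close> and \<open>t\<close> have the same sign and \<open>0\<close> otherwise.\<close>

definition brownian_cov :: "real \<Rightarrow> real \<Rightarrow> real"
  where "brownian_cov s t = (\<bar>s\<bar> + \<bar>t\<bar> - \<bar>s - t\<bar>) / 2"

text \<open>The second-moment structure of a two-sided Brownian motion with covariance matrix
  \<open>S\<close>. The isometry speaks only of second moments, so it is separated from the path
  properties of the process.\<close>

locale second_order_noise =
  fixes M :: "'w measure" and L :: "real \<Rightarrow> 'w \<Rightarrow> real ^ 'd" and S :: "real ^ 'd ^ 'd"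
  assumes sq: "\<And>t i. square_integrable M (\<lambda>w. L t w $ i)"
    and cov: "\<And>s t i j. (LINT w|M. L s w $ i * L t w $ j) = brownian_cov s t * S $ i $ j"

text \<open>Times of equal sign reduce to one of the two one-sided processes; for opposite signs,
  independence and zero means give covariance 0. The left limit at negative times changes the
  variables only on null sets.\<close>

lemma two_sided_second_order:
  fixes L :: "real \<Rightarrow> 'w \<Rightarrow> real ^ 'd"
  assumes L: "two_sided_levy_process M L" and int: "integrable M (\<lambda>w. (norm (L 1 w))\<^sup>2)"
    and mean: "(LINT w|M. L 1 w) = 0"
  shows "second_order_noise M L (covariance_matrix M (L 1))"
proof -
  obtain L1 L2 where levy: "levy_process M L1" "levy_process M L2"
    and indep: "prob_space.indep_var M (PiM {0..} (\<lambda>_. borel)) (half_path L1) (PiM {0..} (\<lambda>_. borel)) (half_path L2)"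
    and same: "distr M (PiM {0..} (\<lambda>_. borel)) (half_path L1) = distr M (PiM {0..} (\<lambda>_. borel)) (half_path L2)"
    and pos: "\<forall>t\<ge>0. L t = L1 t" and meas: "\<forall>t<0. L t \<in> borel_measurable M"
    and neg: "AE w in M. \<forall>t<0. ((\<lambda>s. - L2 s w) \<longlongrightarrow> L t w) (at_left (- t))"
    using L unfolding two_sided_levy_process_def by blast
  interpret prob_space M using levy(1) by (simp add: levy_process_def)
  have rv: "half_path L1 \<in> measurable M (PiM {0..} (\<lambda>_. borel))" "half_path L2 \<in> measurable M (PiM {0..} (\<lambda>_. borel))"
    using indep_var_rv1[OF indep] indep_var_rv2[OF indep] by auto
  note transfer = half_path_distr[OF rv same]
  have L1: "L 1 = L1 1" using pos by simp
  have m1: "L1 1 \<in> borel_measurable M" using levy(1) by (simp add: levy_process_def)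
  have sqv: "square_integrable M (L1 1)"
    using int m1 by (simp add: square_integrable_def L1)
  have sqc: "square_integrable M (\<lambda>w. L1 1 w $ i)" for i
    by (rule square_integrable_component[OF sqv])
  \<comment> \<open>The mean-zero hypothesis is about a vector integral, and coordinates commute
    with it only after integrability is known.\<close>
  have intv: "integrable M (L1 1)"
  proof (rule Bochner_Integration.integrable_bound)
    show "integrable M (\<lambda>w. 1 + (norm (L1 1 w))\<^sup>2)" using int L1 by simp
    have "norm x \<le> norm (1 + (norm x)\<^sup>2)" for x :: "real ^ 'd"
      using sum_squares_bound[of 1 "norm x"] norm_ge_zero[of x]
      unfolding real_norm_def power_one mult_1_right by linarith
    then show "AE w in M. norm (L1 1 w) \<le> norm (1 + (norm (L1 1 w))\<^sup>2)" by simp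
  qed (rule m1)
  have meanc: "(LINT w|M. L1 1 w $ i) = 0" for i
    using integral_bounded_linear[OF bounded_linear_vec_nth intv, of i] mean L1 by simp
  interpret A: square_integrable_levy M L1
    by unfold_locales (use levy sqc meanc in auto)
  have "square_integrable M (\<lambda>w. L2 1 w $ i)" for i
  proof -
    have "integrable M (\<lambda>w. (L2 1 w $ i)\<^sup>2)"
      using transfer(2)[of 1 "\<lambda>x. (x $ i)\<^sup>2"] sqc[of i]
      by (simp add: square_integrable_def component_borel borel_measurable_power)
    moreover have "(\<lambda>w. L2 1 w $ i) \<in> borel_measurable M"
      using levy(2) by (intro measurable_compose[OF _ component_borel]) (simp add: levy_process_def)
    ultimately show ?thesis by (simp add: square_integrable_def)
  qed
  moreover have "(LINT w|M. L2 1 w $ i) = 0" for i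
    using transfer(1)[of 1 "\<lambda>x. x $ i"] meanc[of i] by (simp add: component_borel)
  ultimately interpret B: square_integrable_levy M L2
    by unfold_locales (use levy in auto)
  have cov12: "(LINT w|M. L1 1 w $ i * L1 1 w $ j) = (LINT w|M. L2 1 w $ i * L2 1 w $ j)" for i j
    by (rule transfer(1)[of 1 "\<lambda>x. x $ i * x $ j"]) (auto intro!: borel_measurable_times component_borel)
  have cross: "(LINT w|M. L1 s w $ i * L2 t w $ j) = 0" if "0 \<le> s" "0 \<le> t" for s t i j
  proof -
    have "indep_var borel ((\<lambda>p. p s $ i) \<circ> half_path L1) borel ((\<lambda>p. p t $ j) \<circ> half_path L2)"
      by (rule indep_var_compose[OF indep]) (use that in \<open>auto intro!: PiM_component_borel\<close>)
    then have "indep_var borel (\<lambda>w. L1 s w $ i) borel (\<lambda>w. L2 t w $ j)"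
      using that by (simp add: comp_def half_path_apply)
    from indep_var_lebesgue_integral[OF this A.integrable_X[OF that(1)] B.integrable_X[OF that(2)]]
    show ?thesis using A.mean_zero[OF that(1)] by simp
  qed
  have Lmeas: "L t \<in> borel_measurable M" for t
    using meas pos A.X_measurable[of t] by (cases "0 \<le> t") auto
  \<comment> \<open>There are no fixed jumps: along times increasing to \<open>- t\<close>, the
    process \<open>- L2\<close> converges in mean square to \<open>- L2 (- t)\<close> and almost
    surely to \<open>L t\<close>, so the two limits agree almost everywhere.\<close>
  have negc: "AE w in M. - (L2 (- t) w $ i) = L t w $ i" if t: "t < 0" for t i
  proof (rule L2_tendsto_AE_unique)
    define u where "u n = - t - (- t) * inverse (real (Suc n))" for n
    have u: "0 \<le> u n" "u n < - t" for n
    proof -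
      have "inverse (real (Suc n)) \<le> 1" "inverse (real (Suc n)) > 0"
        by (auto simp: inverse_le_1_iff)
      then show "0 \<le> u n" "u n < - t"
        using t mult_left_mono[of "inverse (real (Suc n))" 1 "- t"] mult_pos_pos[of "- t" "inverse (real (Suc n))"]
        unfolding u_def by linarith+
    qed
    have ulim: "u \<longlonglongrightarrow> - t"
    proof -
      have "(\<lambda>n. - t - (- t) * inverse (real (Suc n))) \<longlonglongrightarrow> - t - (- t) * 0"
        by (intro tendsto_intros LIMSEQ_inverse_real_of_nat)
      then show ?thesis by (simp add: u_def[abs_def])
    qed
    have fl: "filterlim u (at_left (- t)) sequentially"
      unfolding filterlim_at using ulim u(2) by (auto intro!: always_eventually simp: less_imp_neq)
    show "AE w in M. (\<lambda>n. - (L2 (u n) w $ i)) \<longlonglongrightarrow> L t w $ i"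
      using neg
    proof eventually_elim
      case (elim w)
      then have "((\<lambda>s. - L2 s w) \<longlongrightarrow> L t w) (at_left (- t))" using t by blast
      from filterlim_compose[OF this fl] have "(\<lambda>n. - L2 (u n) w) \<longlonglongrightarrow> L t w" .
      from tendsto_vec_nth[OF this, of i] show ?case by simp
    qed
    show "L2_tendsto M (\<lambda>n w. - (L2 (u n) w $ i)) (\<lambda>w. - (L2 (- t) w $ i)) sequentially"
    proof -
      let ?c = "expectation (\<lambda>w. L2 1 w $ i * L2 1 w $ i)"
      have "norm (- x - - y) = norm (x - y)" for x y :: real by simp
      then have "(\<integral>\<^sup>+ w. ennreal ((norm (- (L2 (u n) w $ i) - - (L2 (- t) w $ i)))\<^sup>2) \<partial>M) = ennreal ((- t - u n) * ?c)" for n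
        using B.L2_increment[OF u(1) less_imp_le[OF u(2)], of n i] by (simp only:)
      moreover have "(\<lambda>n. ennreal ((- t - u n) * ?c)) \<longlonglongrightarrow> ennreal ((- t - - t) * ?c)"
        by (intro tendsto_intros ulim)
      ultimately show ?thesis by (simp add: L2_tendsto_def)
    qed
    show "(\<lambda>w. - (L2 (u n) w $ i)) \<in> borel_measurable M" for n
      using B.X_component_measurable[OF u(1)] by (rule borel_measurable_uminus)
    show "(\<lambda>w. - (L2 (- t) w $ i)) \<in> borel_measurable M"
      using t by (intro borel_measurable_uminus B.X_component_measurable) simp
  qed
  \<comment> \<open>\<open>Z\<close> has \<open>L2 (- t)\<close> in place of its left limit. For
    each fixed time it agrees with \<open>L\<close> almost everywhere, which is enough for
    moments.\<close>
  define Z where "Z t i w = (if 0 \<le> t then L1 t w $ i else - (L2 (- t) w $ i))" for t i w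
  have ZAE: "AE w in M. Z t i w = L t w $ i" for t i
    using negc[of t i] pos by (cases "0 \<le> t") (auto simp: Z_def)
  have Zsq: "square_integrable M (Z t i)" for t i
  proof (cases "0 \<le> t")
    case True
    then have "Z t i = (\<lambda>w. L1 t w $ i)" by (simp add: Z_def fun_eq_iff)
    then show ?thesis using A.square_integrable_X[of t i] True by simp
  next
    case False
    then have "Z t i = (\<lambda>w. - (L2 (- t) w $ i))" by (simp add: Z_def fun_eq_iff)
    then show ?thesis
      using square_integrable_minus[OF B.square_integrable_X[of "- t" i]] False by simp
  qed
  have Lc: "(\<lambda>w. L t w $ i) \<in> borel_measurable M" for t i
    by (rule measurable_compose[OF Lmeas component_borel])
  define C where "C i j = expectation (\<lambda>w. L1 1 w $ i * L1 1 w $ j)" for i j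
  have C2: "expectation (\<lambda>w. L2 1 w $ i * L2 1 w $ j) = C i j" for i j
    using cov12 by (simp add: C_def)
  have Zcov: "expectation (\<lambda>w. Z s i w * Z t j w) = brownian_cov s t * C i j" for s t i j
  proof (cases "0 \<le> s"; cases "0 \<le> t")
    assume st: "0 \<le> s" "0 \<le> t"
    have "brownian_cov s t = min s t" using st by (auto simp: brownian_cov_def min_def)
    then show ?thesis using st A.covariance_X[OF st, of i j] by (simp add: Z_def C_def)
  next
    assume st: "0 \<le> s" "\<not> 0 \<le> t"
    have "brownian_cov s t = 0" using st by (auto simp: brownian_cov_def)
    then show ?thesis using st cross[of s "- t" i j] by (simp add: Z_def)
  next
    assume st: "\<not> 0 \<le> s" "0 \<le> t"
    have "brownian_cov s t = 0" using st by (auto simp: brownian_cov_def)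
    then show ?thesis using st cross[of t "- s" j i] by (simp add: Z_def mult.commute)
  next
    assume st: "\<not> 0 \<le> s" "\<not> 0 \<le> t"
    have "brownian_cov s t = min (- s) (- t)" using st by (auto simp: brownian_cov_def min_def)
    then show ?thesis using st B.covariance_X[of "- s" "- t" i j] by (simp add: Z_def C2)
  qed
  have CM: "covariance_matrix M (L 1) $ i $ j = C i j" for i j
    by (simp add: covariance_matrix_def C_def L1 meanc)
  show ?thesis
  proof
    show "square_integrable M (\<lambda>w. L t w $ i)" for t i
      by (rule square_integrable_cong_AE[OF Zsq Lc ZAE])
    show "expectation (\<lambda>w. L s w $ i * L t w $ j) = brownian_cov s t * covariance_matrix M (L 1) $ i $ j" for s t i j
    proof -
      have "AE w in M. Z s i w * Z t j w = L s w $ i * L t w $ j"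
        using ZAE[of s i] ZAE[of t j] by eventually_elim simp
      then have "expectation (\<lambda>w. Z s i w * Z t j w) = expectation (\<lambda>w. L s w $ i * L t w $ j)"
        using Zsq Lc by (intro integral_cong_AE borel_measurable_times) (auto simp: square_integrable_def)
      then show ?thesis by (simp add: Zcov CM)
    qed
  qed
qed

section \<open>Integrals of step functions and their limits\<close>

lemma step_fun_simps:
  "step_fun [] s = 0"
  "step_fun ((a, b, G) # xs) s $ i $ k = indicator {a<..b} s * G $ i $ k + step_fun xs s $ i $ k"
  by (simp_all add: step_fun_def)

lemma step_integral_simps:
  "step_integral L [] w = 0"
  "step_integral L ((a, b, G) # xs) w $ i = (\<Sum>k\<in>UNIV. G $ i $ k * (L b w - L a w) $ k) + step_integral L xs w $ i"
  by (simp_all add: step_integral_def matrix_vector_mult_def)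

lemma square_integrable_indicator: "square_integrable lborel (indicator {a<..b} :: real \<Rightarrow> real)"
proof -
  have "(norm (indicator {a<..b} s :: real))\<^sup>2 = indicator {a<..b} s" for s
    by (simp add: indicator_def)
  then show ?thesis
    by (cases "a \<le> b") (auto simp: square_integrable_def)
qed

text \<open>The increment of \<open>brownian_cov\<close> over a rectangle is the covariance of two
  Brownian increments, that is, the length of the overlap of the two intervals.\<close>

lemma integral_indicator_Ioc:
  assumes "a \<le> b" "c \<le> d"
  shows "(LINT s|lborel. indicator {a<..b} s * indicator {c<..d} s :: real) =
    brownian_cov b d - brownian_cov a d - brownian_cov b c + brownian_cov a c"
proof -
  have "(LINT s|lborel. indicator {a<..b} s * indicator {c<..d} s :: real) = measure lborel ({a<..b} \<inter> {c<..d})"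
    by (simp flip: indicator_inter_arith)
  also have "{a<..b} \<inter> {c<..d} = {max a c<..min b d}" by auto
  also have "measure lborel {max a c<..min b d} = max 0 (min b d - max a c)"
    by (cases "max a c \<le> min b d") auto
  also have "\<dots> = brownian_cov b d - brownian_cov a d - brownian_cov b c + brownian_cov a c"
    using assms by (simp add: brownian_cov_def max_def min_def abs_if field_simps) 
  finally show ?thesis .
qed

context second_order_noise
begin

lemma sym: "S $ i $ j = S $ j $ i"
proof -
  have "(LINT w|M. L 1 w $ i * L 1 w $ j) = (LINT w|M. L 1 w $ j * L 1 w $ i)"
    by (simp add: mult.commute)
  then show ?thesis by (simp add: cov brownian_cov_def)
qed

lemma increment_sq: "square_integrable M (\<lambda>w. (L b w - L a w) $ k)"
  using square_integrable_diff[OF sq sq] by simp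

lemma increment_cov:
  assumes "a \<le> b" "c \<le> d"
  shows "(LINT w|M. (L b w - L a w) $ k * (L d w - L c w) $ l) =
    S $ k $ l * (LINT s|lborel. indicator {a<..b} s * indicator {c<..d} s)"
proof -
  have i: "integrable M (\<lambda>w. L u w $ i * L v w $ j)" for u v i j
    by (rule square_integrable_mult[OF sq sq])
  have i': "integrable M (\<lambda>w. - (L u w $ i * L v w $ j))" for u v i j
    by (rule Bochner_Integration.integrable_minus[OF i])
  have pt: "(x - y) * (u - v) = x * u + - (y * u) + - (x * v) + y * v" for x y u v :: real
    by (simp add: algebra_simps)
  have "(LINT w|M. (L b w - L a w) $ k * (L d w - L c w) $ l) =
     (LINT w|M. L b w $ k * L d w $ l + - (L a w $ k * L d w $ l) + - (L b w $ k * L c w $ l) + L a w $ k * L c w $ l)"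
    unfolding vector_minus_component pt ..
  also have "\<dots> = (LINT w|M. L b w $ k * L d w $ l) + (LINT w|M. - (L a w $ k * L d w $ l))
      + (LINT w|M. - (L b w $ k * L c w $ l)) + (LINT w|M. L a w $ k * L c w $ l)"
    by (intro integral_add4 i i')
  also have "\<dots> = S $ k $ l * (brownian_cov b d - brownian_cov a d - brownian_cov b c + brownian_cov a c)"
    unfolding Bochner_Integration.integral_minus cov by (simp add: algebra_simps)
  finally show ?thesis by (simp only: integral_indicator_Ioc[OF assms])
qed

lemma step_sq:
  "square_integrable M (\<lambda>w. step_integral L xs w $ i)"
  "square_integrable lborel (\<lambda>s. step_fun xs s $ i $ k)"
proof -
  show "square_integrable M (\<lambda>w. step_integral L xs w $ i)"
  proof (induction xs)
    case (Cons x xs)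
    then show ?case
      by (cases x) (auto simp: step_integral_simps simp del: vector_minus_component
        intro!: square_integrable_add square_integrable_sum square_integrable_scale increment_sq)
  qed (simp add: step_integral_simps square_integrable_zero)
  show "square_integrable lborel (\<lambda>s. step_fun xs s $ i $ k)"
  proof (induction xs)
    case (Cons x xs)
    obtain a b G where x: "x = (a, b, G)" by (cases x)
    show ?case
      using square_integrable_add[OF square_integrable_scale[OF square_integrable_indicator[of a b], of "G $ i $ k"] Cons]
      by (simp add: x step_fun_simps mult.commute)
  qed (simp add: step_fun_simps square_integrable_zero)
qed

text \<open>Linearity in the first factor alone: \<open>Z\<close> and \<open>\<psi>\<close> stand
  for any second factor whose pairing with single increments is known. With an increment as
  \<open>Z\<close>, and again with a step integral as \<open>Z\<close>, it yields the bilinear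
  isometry.\<close>

lemma step_pairing:
  assumes Z: "square_integrable M Z" and \<psi>: "\<And>l. square_integrable lborel (\<psi> l)"
    and single: "\<And>a b k. a \<le> b \<Longrightarrow> (LINT w|M. (L b w - L a w) $ k * Z w) =
       (\<Sum>l\<in>UNIV. S $ k $ l * (LINT s|lborel. indicator {a<..b} s * \<psi> l s))"
    and xs: "\<forall>(a, b, G)\<in>set xs. a \<le> b"
  shows "(LINT w|M. step_integral L xs w $ i * Z w) =
    (\<Sum>k\<in>UNIV. \<Sum>l\<in>UNIV. S $ k $ l * (LINT s|lborel. step_fun xs s $ i $ k * \<psi> l s))"
  using xs
proof (induction xs)
  case Nil
  then show ?case by (simp add: step_integral_simps step_fun_simps)
next
  case (Cons x xs)
  obtain a b G where x: "x = (a, b, G)" by (cases x)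
  have ab: "a \<le> b" using Cons.prems x by auto
  let ?D = "\<lambda>k w. (L b w - L a w) $ k"
  let ?I = "indicator {a<..b} :: real \<Rightarrow> real"
  have iD: "integrable M (\<lambda>w. ?D k w * Z w)" for k
    by (rule square_integrable_mult[OF increment_sq Z])
  have iS: "integrable M (\<lambda>w. step_integral L xs w $ i * Z w)"
    by (rule square_integrable_mult[OF step_sq(1) Z])
  have iI: "integrable lborel (\<lambda>s. ?I s * \<psi> l s)" for l
    by (rule square_integrable_mult[OF square_integrable_indicator \<psi>])
  have iF: "integrable lborel (\<lambda>s. step_fun xs s $ i $ k * \<psi> l s)" for k l
    by (rule square_integrable_mult[OF step_sq(2) \<psi>])
  have "step_integral L (x # xs) w $ i * Z w = (\<Sum>k\<in>UNIV. G $ i $ k * (?D k w * Z w)) + step_integral L xs w $ i * Z w" for w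
    unfolding x step_integral_simps by (simp add: distrib_right sum_distrib_right mult.assoc)
  then have "(LINT w|M. step_integral L (x # xs) w $ i * Z w)
     = (LINT w|M. (\<Sum>k\<in>UNIV. G $ i $ k * (?D k w * Z w)) + step_integral L xs w $ i * Z w)"
    by (simp only:)
  also have "\<dots> = (LINT w|M. (\<Sum>k\<in>UNIV. G $ i $ k * (?D k w * Z w))) + (LINT w|M. step_integral L xs w $ i * Z w)"
    by (intro Bochner_Integration.integral_add Bochner_Integration.integrable_sum integrable_mult_right iD iS)
  also have "(LINT w|M. (\<Sum>k\<in>UNIV. G $ i $ k * (?D k w * Z w))) = (\<Sum>k\<in>UNIV. (LINT w|M. G $ i $ k * (?D k w * Z w)))"
    by (intro Bochner_Integration.integral_sum integrable_mult_right iD)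
  also have "\<dots> = (\<Sum>k\<in>UNIV. G $ i $ k * (\<Sum>l\<in>UNIV. S $ k $ l * (LINT s|lborel. ?I s * \<psi> l s)))"
    by (simp only: integral_mult_right_zero single[OF ab])
  also have "\<dots> = (\<Sum>k\<in>UNIV. \<Sum>l\<in>UNIV. S $ k $ l * (G $ i $ k * (LINT s|lborel. ?I s * \<psi> l s)))"
    by (simp add: sum_distrib_left mult_ac)
  also have "(LINT w|M. step_integral L xs w $ i * Z w) =
     (\<Sum>k\<in>UNIV. \<Sum>l\<in>UNIV. S $ k $ l * (LINT s|lborel. step_fun xs s $ i $ k * \<psi> l s))"
    using Cons by simp
  finally have eq: "(LINT w|M. step_integral L (x # xs) w $ i * Z w) =
    (\<Sum>k\<in>UNIV. \<Sum>l\<in>UNIV. S $ k $ l * (G $ i $ k * (LINT s|lborel. ?I s * \<psi> l s) + (LINT s|lborel. step_fun xs s $ i $ k * \<psi> l s)))"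
    by (simp add: distrib_left sum.distrib)
  have "G $ i $ k * (LINT s|lborel. ?I s * \<psi> l s) + (LINT s|lborel. step_fun xs s $ i $ k * \<psi> l s)
      = (LINT s|lborel. step_fun (x # xs) s $ i $ k * \<psi> l s)" for k l
  proof -
    have "step_fun (x # xs) s $ i $ k * \<psi> l s = G $ i $ k * (?I s * \<psi> l s) + step_fun xs s $ i $ k * \<psi> l s" for s
      unfolding x step_fun_simps by (simp add: algebra_simps)
    then show ?thesis
      using iI[of l] iF[of k l] by simp
  qed
  with eq show ?case by (simp only:)
qed

lemma step_isometry:
  assumes xs: "\<forall>(a, b, G)\<in>set xs. a \<le> b" and ys: "\<forall>(a, b, G)\<in>set ys. a \<le> b"
  shows "(LINT w|M. step_integral L xs w $ i * step_integral L ys w $ j) =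
    (\<Sum>k\<in>UNIV. \<Sum>l\<in>UNIV. S $ k $ l * (LINT s|lborel. step_fun xs s $ i $ k * step_fun ys s $ j $ l))"
proof (rule step_pairing[OF step_sq(1) step_sq(2) _ xs])
  fix a b :: real and k :: 'd assume ab: "a \<le> b"
  \<comment> \<open>For a single increment in coordinate \<open>k\<close> as second factor,
    \<open>\<psi>\<close> is the indicator in coordinate \<open>k\<close> and 0 in the others, so
    the sum over \<open>l\<close> keeps one term.\<close>
  let ?\<psi> = "\<lambda>l s. if l = k then indicator {a<..b} s else 0 :: real"
  have "(LINT w|M. step_integral L ys w $ j * (L b w - L a w) $ k) =
    (\<Sum>k'\<in>UNIV. \<Sum>l\<in>UNIV. S $ k' $ l * (LINT s|lborel. step_fun ys s $ j $ k' * ?\<psi> l s))"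
  proof (rule step_pairing[OF increment_sq _ _ ys])
    show "square_integrable lborel (?\<psi> l)" for l
      by (cases "l = k") (simp_all add: square_integrable_indicator square_integrable_zero)
    fix c d :: real and k' :: 'd assume "c \<le> d"
    have "(\<Sum>l\<in>UNIV. S $ k' $ l * (LINT s|lborel. indicator {c<..d} s * ?\<psi> l s)) =
      (\<Sum>l\<in>{k}. S $ k' $ l * (LINT s|lborel. indicator {c<..d} s * ?\<psi> l s))"
      by (rule sum.mono_neutral_right) auto
    then show "(LINT w|M. (L d w - L c w) $ k' * (L b w - L a w) $ k) =
       (\<Sum>l\<in>UNIV. S $ k' $ l * (LINT s|lborel. indicator {c<..d} s * ?\<psi> l s))"
      using increment_cov[OF \<open>c \<le> d\<close> ab, of k' k] by simp
  qed
  also have "\<dots> = (\<Sum>k'\<in>UNIV. \<Sum>l\<in>{k}. S $ k' $ l * (LINT s|lborel. step_fun ys s $ j $ k' * ?\<psi> l s))"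
    by (intro sum.cong refl sum.mono_neutral_right) auto
  \<comment> \<open>The roles of the two factors were exchanged above; symmetry of \<open>S\<close>
    restores the order of the indices.\<close>
  also have "\<dots> = (\<Sum>l\<in>UNIV. S $ k $ l * (LINT s|lborel. indicator {a<..b} s * step_fun ys s $ j $ l))"
    by (simp add: sym[of k] mult.commute)
  finally show "(LINT w|M. (L b w - L a w) $ k * step_integral L ys w $ j) =
      (\<Sum>l\<in>UNIV. S $ k $ l * (LINT s|lborel. indicator {a<..b} s * step_fun ys s $ j $ l))"
    by (simp only: mult.commute)
qed

lemma has_L2_integralE:
  assumes "has_L2_integral M L f X"
  obtains xs where "\<And>n. \<forall>(a, b, G)\<in>set (xs n). a \<le> b"
    "\<And>i. L2_tendsto M (\<lambda>n w. step_integral L (xs n) w $ i) (\<lambda>w. X w $ i) sequentially"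
    "\<And>i k. L2_tendsto lborel (\<lambda>n s. step_fun (xs n) s $ i $ k) (\<lambda>s. f s $ i $ k) sequentially"
    "\<And>i. square_integrable M (\<lambda>w. X w $ i)" "\<And>i k. square_integrable lborel (\<lambda>s. f s $ i $ k)"
proof -
  have fm: "f \<in> borel_measurable lborel" and Xm: "X \<in> borel_measurable M"
    using assms by (auto simp: has_L2_integral_def)
  obtain xs where xs: "\<And>n. \<forall>(a, b, G)\<in>set (xs n). a \<le> b"
    and f: "(\<lambda>n. \<integral>\<^sup>+ s. ennreal ((norm (f s - step_fun (xs n) s))\<^sup>2) \<partial>lborel) \<longlonglongrightarrow> 0"
    and X: "(\<lambda>n. \<integral>\<^sup>+ w. ennreal ((norm (X w - step_integral L (xs n) w))\<^sup>2) \<partial>M) \<longlonglongrightarrow> 0"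
    using assms unfolding has_L2_integral_def by blast
  have Xl: "L2_tendsto M (\<lambda>n w. step_integral L (xs n) w $ i) (\<lambda>w. X w $ i) sequentially" for i
    by (rule component_tendsto_L2[OF X])
  have "L2_tendsto lborel (\<lambda>n s. step_fun (xs n) s $ i) (\<lambda>s. f s $ i) sequentially" for i
    by (rule component_tendsto_L2[OF f])
  then have "(\<lambda>n. \<integral>\<^sup>+ s. ennreal ((norm (f s $ i - step_fun (xs n) s $ i))\<^sup>2) \<partial>lborel) \<longlonglongrightarrow> 0" for i
    by (simp add: L2_tendsto_def norm_minus_commute)
  then have fl: "L2_tendsto lborel (\<lambda>n s. step_fun (xs n) s $ i $ k) (\<lambda>s. f s $ i $ k) sequentially" for i k
    by (rule component_tendsto_L2)
  have Xsq: "square_integrable M (\<lambda>w. X w $ i)" for i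
    by (rule L2_limit_square_integrable[OF Xl _ step_sq(1)])
      (auto intro: measurable_compose[OF Xm component_borel])
  have fik: "(\<lambda>s. f s $ i $ k) \<in> borel_measurable lborel" for i k
    by (rule measurable_compose[OF fm]) (intro borel_measurable_continuous_onI continuous_intros)
  have fsq: "square_integrable lborel (\<lambda>s. f s $ i $ k)" for i k
    by (rule L2_limit_square_integrable[OF fl _ step_sq(2) fik]) auto
  from that[OF xs Xl fl Xsq fsq] show thesis .
qed

text \<open>Both sides are continuous under mean-square convergence of the two factors, so the
  isometry passes from step functions to the limits.\<close>

lemma L2_isometry:
  assumes f: "has_L2_integral M L f X" and h: "has_L2_integral M L h Y"
  shows "(LINT w|M. X w $ i * Y w $ j) =
    (\<Sum>k\<in>UNIV. \<Sum>l\<in>UNIV. S $ k $ l * (LINT s|lborel. f s $ i $ k * h s $ j $ l))"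
proof -
  obtain xs where xs: "\<And>n. \<forall>(a, b, G)\<in>set (xs n). a \<le> b"
    "\<And>i. L2_tendsto M (\<lambda>n w. step_integral L (xs n) w $ i) (\<lambda>w. X w $ i) sequentially"
    "\<And>i k. L2_tendsto lborel (\<lambda>n s. step_fun (xs n) s $ i $ k) (\<lambda>s. f s $ i $ k) sequentially"
    "\<And>i. square_integrable M (\<lambda>w. X w $ i)" "\<And>i k. square_integrable lborel (\<lambda>s. f s $ i $ k)"
    using has_L2_integralE[OF f] by blast
  obtain ys where ys: "\<And>n. \<forall>(a, b, G)\<in>set (ys n). a \<le> b"
    "\<And>i. L2_tendsto M (\<lambda>n w. step_integral L (ys n) w $ i) (\<lambda>w. Y w $ i) sequentially"
    "\<And>i k. L2_tendsto lborel (\<lambda>n s. step_fun (ys n) s $ i $ k) (\<lambda>s. h s $ i $ k) sequentially"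
    "\<And>i. square_integrable M (\<lambda>w. Y w $ i)" "\<And>i k. square_integrable lborel (\<lambda>s. h s $ i $ k)"
    using has_L2_integralE[OF h] by blast
  have 1: "(\<lambda>n. LINT w|M. step_integral L (xs n) w $ i * step_integral L (ys n) w $ j) \<longlonglongrightarrow> (LINT w|M. X w $ i * Y w $ j)"
    using step_sq(1) by (intro L2_tendsto_integral_mult xs ys) (simp_all add: square_integrable_def)
  have "(\<lambda>n. \<Sum>k\<in>UNIV. \<Sum>l\<in>UNIV. S $ k $ l * (LINT s|lborel. step_fun (xs n) s $ i $ k * step_fun (ys n) s $ j $ l)) \<longlonglongrightarrow>
    (\<Sum>k\<in>UNIV. \<Sum>l\<in>UNIV. S $ k $ l * (LINT s|lborel. f s $ i $ k * h s $ j $ l))"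
    using step_sq(2) by (intro tendsto_sum tendsto_mult tendsto_const L2_tendsto_integral_mult xs ys) (simp_all add: square_integrable_def)
  with 1 show ?thesis
    unfolding step_isometry[OF xs(1) ys(1)] by (rule LIMSEQ_unique)
qed

end

section \<open>The autocovariance function\<close>

lemma truncated_inverse_add:
  assumes "continuous_on UNIV F" "continuous_on UNIV G"
  shows "truncated_inverse (\<lambda>x. F x + G x) N t = truncated_inverse F N t + truncated_inverse G N t"
  unfolding truncated_inverse_def distrib_left
  by (subst set_integral_add) (auto intro!: set_integrable_exp_continuous assms simp: distrib_left)

lemma truncated_inverse_scale:
  "truncated_inverse (\<lambda>x. c * F x) N t = c * truncated_inverse F N t"
proof -
  have "(LINT x:{- N..N}|lborel. exp (\<i> * of_real t * of_real x) * (c * F x))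
     = c * (LINT x:{- N..N}|lborel. exp (\<i> * of_real t * of_real x) * F x)"
    by (subst set_integral_mult_right[symmetric]) (simp add: mult_ac)
  then show ?thesis by (simp add: truncated_inverse_def)
qed

lemma truncated_inverse_sum:
  assumes "\<And>i. i \<in> I \<Longrightarrow> continuous_on UNIV (F i)"
  shows "truncated_inverse (\<lambda>x. \<Sum>i\<in>I. F i x) N t = (\<Sum>i\<in>I. truncated_inverse (F i) N t)"
  using assms
proof (induction I rule: infinite_finite_induct)
  case (insert i I)
  have "truncated_inverse (\<lambda>x. F i x + (\<Sum>i\<in>I. F i x)) N t
      = truncated_inverse (F i) N t + truncated_inverse (\<lambda>x. \<Sum>i\<in>I. F i x) N t"
    using insert.prems by (intro truncated_inverse_add continuous_on_sum) auto
  then show ?case using insert by simp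
qed (simp_all add: truncated_inverse_def)

lemma truncated_inverse_reflect:
  "truncated_inverse (\<lambda>x. F (- x)) N t = truncated_inverse F N (- t)"
proof -
  have "(LINT x:{- N..N}|lborel. exp (\<i> * of_real t * of_real x) * F (- x))
     = (LINT x|lborel. (\<lambda>y. indicator {- N..N} y *\<^sub>R (exp (\<i> * of_real (- t) * of_real y) * F y)) (0 + (- 1) * x))"
    unfolding set_lebesgue_integral_def
    by (intro Bochner_Integration.integral_cong refl) (auto simp: indicator_def)
  also have "\<dots> = (LINT x:{- N..N}|lborel. exp (\<i> * of_real (- t) * of_real x) * F x)"
    unfolding set_lebesgue_integral_def
    by (subst lborel_integral_real_affine[where c = "-1" and t = 0]) auto
  finally show ?thesis by (simp add: truncated_inverse_def)
qed

text \<open>For integrable \<open>G\<close> dominated convergence removes the truncation, which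
  leaves a formula that is continuous in \<open>t\<close>.\<close>

lemma truncated_inverse_integrable:
  assumes "integrable lborel G"
  shows "((\<lambda>N. truncated_inverse G N t) \<longlongrightarrow> of_real (1 / (2 * pi)) * (LINT x|lborel. exp (\<i> * of_real t * of_real x) * G x)) at_top"
proof -
  have [measurable]: "G \<in> borel_measurable borel" using assms by auto
  have "((\<lambda>N. LINT x|lborel. indicator {- N..N} x *\<^sub>R (exp (\<i> * of_real t * of_real x) * G x)) \<longlongrightarrow>
      (LINT x|lborel. exp (\<i> * of_real t * of_real x) * G x)) at_top"
  proof (rule integral_dominated_convergence_at_top)
    show "\<forall>\<^sub>F N in at_top. AE x in lborel. norm (indicator {- N..N} x *\<^sub>R (exp (\<i> * of_real t * of_real x) * G x)) \<le> norm (G x)"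
      by (intro always_eventually allI AE_I2) (simp add: norm_mult indicator_def)
    show "AE x in lborel. ((\<lambda>N. indicator {- N..N} x *\<^sub>R (exp (\<i> * of_real t * of_real x) * G x)) \<longlongrightarrow>
        exp (\<i> * of_real t * of_real x) * G x) at_top"
    proof (rule AE_I2)
      fix x :: real
      have "\<forall>\<^sub>F N in at_top. exp (\<i> * of_real t * of_real x) * G x = indicator {- N..N} x *\<^sub>R (exp (\<i> * of_real t * of_real x) * G x)"
        using eventually_ge_at_top[of "\<bar>x\<bar>"] by eventually_elim (auto simp: indicator_def)
      then show "((\<lambda>N. indicator {- N..N} x *\<^sub>R (exp (\<i> * of_real t * of_real x) * G x)) \<longlongrightarrow>
        exp (\<i> * of_real t * of_real x) * G x) at_top"
        by (rule Lim_transform_eventually[OF tendsto_const])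
    qed
  qed (use assms in auto)
  then show ?thesis
    unfolding truncated_inverse_def set_lebesgue_integral_def by (intro tendsto_intros)
qed

lemma inverse_transform_sequentially_continuous:
  assumes "integrable lborel G" "t \<longlonglongrightarrow> u"
  shows "(\<lambda>n. LINT x|lborel. exp (\<i> * of_real (t n) * of_real x) * G x) \<longlonglongrightarrow>
    (LINT x|lborel. exp (\<i> * of_real u * of_real x) * G x)"
proof (rule integral_dominated_convergence)
  have [measurable]: "G \<in> borel_measurable borel" using assms by auto
  show "integrable lborel (\<lambda>x. norm (G x))" using assms by auto
  show "(\<lambda>x. exp (\<i> * of_real u * of_real x) * G x) \<in> borel_measurable lborel"
    "(\<lambda>x. exp (\<i> * of_real (t n) * of_real x) * G x) \<in> borel_measurable lborel" for n
    by measurable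
  show "AE x in lborel. norm (exp (\<i> * of_real (t n) * of_real x) * G x) \<le> norm (G x)" for n
    by (intro AE_I2) (simp add: norm_mult)
  show "AE x in lborel. (\<lambda>n. exp (\<i> * of_real (t n) * of_real x) * G x) \<longlonglongrightarrow> exp (\<i> * of_real u * of_real x) * G x"
    by (intro AE_I2 tendsto_intros assms)
qed

text \<open>Reflecting \<open>x\<close> in the second fraction turns its inverse at \<open>t\<close>
  into the inverse of the first one at \<open>- t\<close>, where the causal kernel vanishes.\<close>

lemma partial_fraction_inverse:
  assumes z: "Re z < 0" and t: "0 < t"
  shows "((\<lambda>N. truncated_inverse (\<lambda>x. 1 / (\<i> * of_real x - z) ^ Suc n) N t) \<longlongrightarrow> exp_kernel z n t) at_top"
    and "((\<lambda>N. truncated_inverse (\<lambda>x. 1 / (- (\<i> * of_real x) - z) ^ Suc n) N t) \<longlongrightarrow> 0) at_top"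
proof -
  note c = causal_transform_exp_kernel[OF z, of n]
  show "((\<lambda>N. truncated_inverse (\<lambda>x. 1 / (\<i> * of_real x - z) ^ Suc n) N t) \<longlongrightarrow> exp_kernel z n t) at_top"
    by (rule truncated_inverse_tendsto[OF c]) (use t in simp)
  have lim: "((\<lambda>N. truncated_inverse (\<lambda>x. 1 / (\<i> * of_real x - z) ^ Suc n) N (- t)) \<longlongrightarrow> exp_kernel z n (- t)) at_top"
    by (rule truncated_inverse_tendsto[OF c]) (use t in simp)
  have zero: "exp_kernel z n (- t) = 0" using t by (simp add: exp_kernel_def)
  have eq: "truncated_inverse (\<lambda>x. 1 / (- (\<i> * of_real x) - z) ^ Suc n) N t
      = truncated_inverse (\<lambda>x. 1 / (\<i> * of_real x - z) ^ Suc n) N (- t)" for N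
    by (subst truncated_inverse_reflect[symmetric]) (simp only: of_real_minus mult_minus_right)
  show "((\<lambda>N. truncated_inverse (\<lambda>x. 1 / (- (\<i> * of_real x) - z) ^ Suc n) N t) \<longlongrightarrow> 0) at_top"
    using lim unfolding eq zero .
qed

lemma continuous_partial_fraction:
  assumes "Re z < 0"
  shows "continuous_on UNIV (\<lambda>x. 1 / (\<i> * of_real x - z) ^ n)" "continuous_on UNIV (\<lambda>x. 1 / (- (\<i> * of_real x) - z) ^ n)"
proof -
  have "\<i> * of_real x \<noteq> z" for x
    using assms by auto
  then show "continuous_on UNIV (\<lambda>x. 1 / (\<i> * of_real x - z) ^ n)"
    by (intro continuous_intros) auto
  have "- (\<i> * of_real x) \<noteq> z" for x
    using assms by auto
  then show "continuous_on UNIV (\<lambda>x. 1 / (- (\<i> * of_real x) - z) ^ n)"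
    by (intro continuous_intros) auto
qed

lemma partial_fractions_inverse:
  assumes \<zeta>: "\<And>l. l \<in> {1..m} \<Longrightarrow> Re (\<zeta> l) < 0" and t: "0 < t"
    and G: "\<And>x. G x = (\<Sum>l=1..m. \<Sum>j=1..\<nu> l.
        1 / (\<i> * of_real x - \<zeta> l) ^ j * a l j + 1 / (- (\<i> * of_real x) - \<zeta> l) ^ j * b l j)"
  shows "((\<lambda>N. truncated_inverse G N t) \<longlongrightarrow> (\<Sum>l=1..m. \<Sum>j=1..\<nu> l. exp_kernel (\<zeta> l) (j - 1) t * a l j)) at_top"
proof -
  let ?A = "\<lambda>l j x. a l j * (1 / (\<i> * of_real x - \<zeta> l) ^ j)" and ?B = "\<lambda>l j x. b l j * (1 / (- (\<i> * of_real x) - \<zeta> l) ^ j)"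
  have cA: "continuous_on UNIV (?A l j)" and cB: "continuous_on UNIV (?B l j)" if "l \<in> {1..m}" for l j
    using \<zeta>[OF that] by (intro continuous_on_mult_left continuous_partial_fraction, assumption)+
  have "G = (\<lambda>x. \<Sum>l=1..m. \<Sum>j=1..\<nu> l. ?A l j x + ?B l j x)"
    by (simp add: fun_eq_iff G mult.commute)
  then have "truncated_inverse G N t = truncated_inverse (\<lambda>x. \<Sum>l=1..m. \<Sum>j=1..\<nu> l. ?A l j x + ?B l j x) N t" for N
    by (simp only:)
  also have "\<dots> N = (\<Sum>l=1..m. truncated_inverse (\<lambda>x. \<Sum>j=1..\<nu> l. ?A l j x + ?B l j x) N t)" for N
    by (intro truncated_inverse_sum continuous_on_sum continuous_on_add cA cB)
  also have "\<dots> N = (\<Sum>l=1..m. \<Sum>j=1..\<nu> l. truncated_inverse (\<lambda>x. ?A l j x + ?B l j x) N t)" for N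
    by (intro sum.cong refl truncated_inverse_sum continuous_on_add cA cB)
  also have "\<dots> N = (\<Sum>l=1..m. \<Sum>j=1..\<nu> l. truncated_inverse (?A l j) N t + truncated_inverse (?B l j) N t)" for N
    by (intro sum.cong refl truncated_inverse_add cA cB)
  finally have eq: "truncated_inverse G N t = (\<Sum>l=1..m. \<Sum>j=1..\<nu> l.
      a l j * truncated_inverse (\<lambda>x. 1 / (\<i> * of_real x - \<zeta> l) ^ j) N t
    + b l j * truncated_inverse (\<lambda>x. 1 / (- (\<i> * of_real x) - \<zeta> l) ^ j) N t)" for N
    unfolding truncated_inverse_scale .
  have lim: "((\<lambda>N. a l j * truncated_inverse (\<lambda>x. 1 / (\<i> * of_real x - \<zeta> l) ^ j) N t
    + b l j * truncated_inverse (\<lambda>x. 1 / (- (\<i> * of_real x) - \<zeta> l) ^ j) N t) \<longlongrightarrow> exp_kernel (\<zeta> l) (j - 1) t * a l j) at_top"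
    if l: "l \<in> {1..m}" and j: "j \<in> {1..\<nu> l}" for l j
  proof -
    obtain n where n: "j = Suc n" using j by (cases j) auto
    have "((\<lambda>N. a l j * truncated_inverse (\<lambda>x. 1 / (\<i> * of_real x - \<zeta> l) ^ Suc n) N t
      + b l j * truncated_inverse (\<lambda>x. 1 / (- (\<i> * of_real x) - \<zeta> l) ^ Suc n) N t)
      \<longlongrightarrow> a l j * exp_kernel (\<zeta> l) n t + b l j * 0) at_top"
      by (intro tendsto_intros partial_fraction_inverse \<zeta> l t)
    moreover have "a l j * exp_kernel (\<zeta> l) n t + b l j * 0 = exp_kernel (\<zeta> l) n t * a l j"
      by simp
    ultimately show ?thesis by (simp only: n diff_Suc_1)
  qed
  show ?thesis unfolding eq by (intro tendsto_sum lim)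
qed

text \<open>For \<open>n = 0\<close> the kernel jumps from 0 to 1 at the origin, so the approach has
  to be through positive times.\<close>

lemma exp_kernel_right_continuous:
  assumes "t \<longlonglongrightarrow> 0" "\<And>k. 0 < t k"
  shows "(\<lambda>k. exp_kernel z n (t k)) \<longlonglongrightarrow> exp_kernel z n 0"
proof -
  have "(\<lambda>k. of_real (t k) ^ n / fact n * exp (z * of_real (t k))) \<longlonglongrightarrow> of_real 0 ^ n / fact n * exp (z * of_real 0)"
    by (intro tendsto_intros assms) auto
  moreover have "exp_kernel z n (t k) = of_real (t k) ^ n / fact n * exp (z * of_real (t k))" for k
    using assms(2)[of k] by (simp add: exp_kernel_def)
  ultimately show ?thesis by (simp add: exp_kernel_def)
qed

text \<open>The isometry writes \<open>\<Gamma>(t)\<close> as correlations of the kernels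
  \<open>h\<close>, and Parseval turns these into truncated inverse integrals of \<open>R\<close> on
  the imaginary axis. The integrability of \<open>G\<close> serves continuity in \<open>t\<close>,
  and its reflection serves negative times.\<close>

lemma (in second_order_noise) autocov_inverse:
  fixes P Q :: "complex poly ^ 'd ^ 'd"
  assumes causal: "\<And>i k. \<exists>h. causal_transform h
      (\<lambda>x. (matrix_inv (eval_mat P (\<i> * of_real x)) ** eval_mat Q (\<i> * of_real x)) $ i $ k)"
    and Y: "mcarma_process M L P Q Y"
    and G_def: "\<And>i j x. G i j x = R_fun P Q S (\<i> * of_real x) $ i $ j"
  shows "((\<lambda>N. truncated_inverse (G i j) N t) \<longlongrightarrow> of_real (autocov M Y t $ i $ j)) at_top"
    and "integrable lborel (G i j)"
    and "G i j (- x) = G j i x"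
proof -
  define H where "H z = matrix_inv (eval_mat P z) ** eval_mat Q z" for z
  define F where "F i k x = H (\<i> * of_real x) $ i $ k" for i k and x :: real
  have "\<forall>i k. \<exists>h. causal_transform h (F i k)"
    using causal by (simp add: F_def[abs_def] H_def)
  then obtain h where h: "\<And>i k. causal_transform (h i k) (F i k)" by metis
  have Fc: "continuous_on UNIV (F i k)" for i k
    using h[of i k] by (simp add: causal_transform_def)
  obtain g where g: "is_L2_inverse_fourier (\<lambda>x. H (\<i> * of_real x)) (\<lambda>t. cmatrix (g t))"
    and Yg: "\<And>t. has_L2_integral M L (\<lambda>s. if s \<le> t then g (t - s) else 0) (Y t)"
    using Y by (auto simp: mcarma_process_def mcarma_kernel_def H_def)
  have gm: "(\<lambda>t. cmatrix (g t)) \<in> borel_measurable lborel"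
    using g by (simp add: is_L2_inverse_fourier_def)
  define u where "u i k t = complex_of_real (g t $ i $ k)" for i k t
  have um [measurable]: "u i k \<in> borel_measurable borel" for i k
  proof -
    have "(\<lambda>t. cmatrix (g t) $ i $ k) \<in> borel_measurable lborel"
      by (rule measurable_compose[OF gm]) (intro borel_measurable_continuous_onI continuous_intros)
    then show ?thesis by (simp add: u_def[abs_def] map_matrix_def)
  qed
  \<comment> \<open>Taking an entry is bounded linear, hence commutes with the matrix-valued
    integral.\<close>
  have trunc: "(of_real (1 / (2 * pi)) *k (LINT x:{- N..N}|lborel. exp (\<i> * of_real t * of_real x) *k H (\<i> * of_real x))) $ i $ k
      = truncated_inverse (F i k) N t" for N t i k
  proof -
    have "continuous_on UNIV (\<lambda>x. \<chi> i k. exp (\<i> * complex_of_real t * complex_of_real x) * F i k x)"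
      by (intro continuous_intros Fc)
    then have "continuous_on {- N..N} (\<lambda>x. exp (\<i> * of_real t * of_real x) *k H (\<i> * of_real x))"
      unfolding matrix_smult_def F_def by (rule continuous_on_subset) auto
    then have int: "set_integrable lborel {- N..N} (\<lambda>x. exp (\<i> * of_real t * of_real x) *k H (\<i> * of_real x))"
      by (rule borel_integrable_atLeastAtMost')
    have bl: "bounded_linear (\<lambda>A :: complex ^ 'd ^ 'd. A $ i $ k)"
      by (rule bounded_linear_compose[OF bounded_linear_vec_nth bounded_linear_vec_nth])
    have "(LINT x:{- N..N}|lborel. exp (\<i> * of_real t * of_real x) *k H (\<i> * of_real x)) $ i $ k
        = (LINT x:{- N..N}|lborel. exp (\<i> * of_real t * of_real x) * F i k x)"
      using integral_bounded_linear[OF bl int[unfolded set_integrable_def]]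
      by (simp add: set_lebesgue_integral_def matrix_smult_def F_def)
    then show ?thesis by (simp add: truncated_inverse_def matrix_smult_def)
  qed
  have uL2: "L2_tendsto lborel (truncated_inverse (F i k)) (u i k) at_top" for i k
  proof -
    let ?T = "\<lambda>N t. of_real (1 / (2 * pi)) *k (LINT x:{- N..N}|lborel. exp (\<i> * of_real t * of_real x) *k H (\<i> * of_real x))"
    have "((\<lambda>N. \<integral>\<^sup>+ t. ennreal ((norm (cmatrix (g t) - ?T N t))\<^sup>2) \<partial>lborel) \<longlongrightarrow> 0) at_top"
      using g by (simp add: is_L2_inverse_fourier_def)
    from component_tendsto_L2[OF this, of i]
    have "((\<lambda>N. \<integral>\<^sup>+ t. ennreal ((norm (cmatrix (g t) $ i - ?T N t $ i))\<^sup>2) \<partial>lborel) \<longlongrightarrow> 0) at_top"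
      by (simp add: L2_tendsto_def norm_minus_commute)
    from component_tendsto_L2[OF this, of k]
    show ?thesis
      unfolding trunc by (simp add: map_matrix_def u_def[abs_def] L2_tendsto_def)
  qed
  have uh: "AE t in lborel. u i k t = h i k t" for i k
    by (rule causal_transform_inverse_AE[OF h _ uL2]) simp
  have hm [measurable]: "h i k \<in> borel_measurable borel" for i k
    using h[of i k] unfolding causal_transform_def by auto
  have hneg: "h i k t = 0" if "t < 0" for i k t
    using h[of i k] that by (simp add: causal_transform_def)
  define f where "f t i k s = (if s \<le> t then g (t - s) else 0) $ i $ k" for t i k s
  \<comment> \<open>For \<open>s > t\<close> both sides are 0, the left by the cut-off and the right
    by causality of \<open>h\<close>. Otherwise the a.e. identity of \<open>u\<close> and
    \<open>h\<close> is carried along the affine map from \<open>s\<close> to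
    \<open>t - s\<close>.\<close>
  have fh: "AE s in lborel. complex_of_real (f t i k s) = h i k (t - s)" for t i k
  proof -
    have "AE s in lborel. u i k (t + (- 1) * s) = h i k (t + (- 1) * s)"
      by (rule AE_borel_affine[OF _ _ uh]) (simp, measurable)
    then show ?thesis
      by eventually_elim (auto simp: f_def u_def hneg)
  qed
  have fsq: "square_integrable lborel (f t i k)" for t i k
  proof (rule has_L2_integralE[OF Yg[of t]])
    assume "\<And>i k. square_integrable lborel (\<lambda>s. (if s \<le> t then g (t - s) else 0) $ i $ k)"
    then show ?thesis unfolding f_def[abs_def] .
  qed
  \<comment> \<open>Square integrability of \<open>h\<close> is read off from the integrand of
    \<open>Y 0\<close>, which is a mean-square limit of step functions.\<close>
  have hsq: "square_integrable lborel (h i k)" for i k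
  proof -
    have "square_integrable lborel (\<lambda>s. complex_of_real (f 0 i k s))"
      using fsq[of 0 i k] by (auto simp: square_integrable_def)
    then have "square_integrable lborel (\<lambda>s. h i k (0 - s))"
      by (rule square_integrable_cong_AE[OF _ _ fh]) measurable
    then have "integrable lborel (\<lambda>s. (norm (h i k (0 + (- 1) * s)))\<^sup>2)"
      by (simp add: square_integrable_def)
    then have "integrable lborel (\<lambda>s. (norm (h i k s))\<^sup>2)"
      by (subst (asm) lborel_integrable_real_affine_iff[where f = "\<lambda>s. (norm (h i k s))\<^sup>2"]) simp_all
    then show ?thesis by (simp add: square_integrable_def)
  qed
  have hL2: "L2_tendsto lborel (truncated_inverse (F i k)) (h i k) at_top" for i k
    by (rule L2_tendsto_cong_AE[OF uL2 uh])
  have product: "of_real (LINT s|lborel. f t i k s * f 0 j l s) = (LINT s|lborel. h i k (t + s) * h j l s)" for t i j k l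
  proof -
    have fm [measurable]: "f t i k \<in> borel_measurable borel" for t i k
      using fsq[of t i k] by (simp add: square_integrable_def)
    have "of_real (LINT s|lborel. f t i k s * f 0 j l s) = (LINT s|lborel. complex_of_real (f t i k s) * complex_of_real (f 0 j l s))"
      by (simp flip: integral_complex_of_real)
    also have "\<dots> = (LINT s|lborel. h i k (t - s) * h j l (0 - s))"
    proof (rule integral_cong_AE)
      show "AE s in lborel. complex_of_real (f t i k s) * complex_of_real (f 0 j l s) = h i k (t - s) * h j l (0 - s)"
        using fh[of t i k] fh[of 0 j l] by eventually_elim simp
    qed measurable
    also have "\<dots> = (LINT s|lborel. h i k (t + s) * h j l s)"
      by (subst lborel_integral_real_affine[where c = "-1" and t = 0]) simp_all
    finally show ?thesis .
  qed
  have autocov: "of_real (autocov M Y t $ i $ j) =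
      (\<Sum>k\<in>UNIV. \<Sum>l\<in>UNIV. of_real (S $ k $ l) * (LINT s|lborel. h i k (t + s) * h j l s))" for t i j
    using L2_isometry[OF Yg[of t] Yg[of 0], of i j]
    by (simp add: autocov_def f_def[symmetric] product[symmetric])
  have Gsum: "G i j x = (\<Sum>k\<in>UNIV. \<Sum>l\<in>UNIV. of_real (S $ k $ l) * (F i k x * F j l (- x)))" for i j x
  proof -
    have "R_fun P Q S z = H z ** cmatrix S ** transpose (H (- z))" for z
      by (simp add: R_fun_def H_def matrix_transpose_mul matrix_mul_assoc)
    then have "G i j x = (\<Sum>l\<in>UNIV. (\<Sum>k\<in>UNIV. F i k x * of_real (S $ k $ l)) * F j l (- x))"
      by (simp add: G_def matrix_matrix_mult_def F_def map_matrix_def transpose_def)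
    also have "\<dots> = (\<Sum>l\<in>UNIV. \<Sum>k\<in>UNIV. of_real (S $ k $ l) * (F i k x * F j l (- x)))"
      unfolding sum_distrib_right by (intro sum.cong refl) (simp only: mult_ac)
    also have "\<dots> = (\<Sum>k\<in>UNIV. \<Sum>l\<in>UNIV. of_real (S $ k $ l) * (F i k x * F j l (- x)))"
      by (rule sum.swap)
    finally show ?thesis .
  qed
  have Frc: "continuous_on UNIV (\<lambda>x. F i k (- x))" for i k
    by (rule continuous_on_compose2[OF Fc]) (auto intro!: continuous_intros)
  have c: "continuous_on UNIV (\<lambda>x. of_real (S $ k $ l) * (F i k x * F j l (- x)))" for i j k l
    by (intro continuous_intros Fc Frc)
  have Gtrunc: "truncated_inverse (G i j) N t =
      (\<Sum>k\<in>UNIV. \<Sum>l\<in>UNIV. of_real (S $ k $ l) * truncated_inverse (\<lambda>x. F i k x * F j l (- x)) N t)" for N t i j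
  proof -
    let ?T = "\<lambda>k l x. of_real (S $ k $ l) * (F i k x * F j l (- x))"
    have 1: "G i j = (\<lambda>x. \<Sum>k\<in>UNIV. \<Sum>l\<in>UNIV. ?T k l x)"
      by (simp add: Gsum fun_eq_iff)
    have 2: "truncated_inverse (\<lambda>x. \<Sum>k\<in>UNIV. \<Sum>l\<in>UNIV. ?T k l x) N t
        = (\<Sum>k\<in>UNIV. truncated_inverse (\<lambda>x. \<Sum>l\<in>UNIV. ?T k l x) N t)"
      by (intro truncated_inverse_sum continuous_on_sum c)
    have 3: "truncated_inverse (\<lambda>x. \<Sum>l\<in>UNIV. ?T k l x) N t = (\<Sum>l\<in>UNIV. truncated_inverse (?T k l) N t)" for k
      by (intro truncated_inverse_sum c)
    show ?thesis unfolding 1 2 3 truncated_inverse_scale ..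
  qed
  have parseval: "((\<lambda>N. truncated_inverse (\<lambda>x. F i k x * F j l (- x)) N t) \<longlongrightarrow> (LINT s|lborel. h i k (t + s) * h j l s)) at_top" for k l
    by (rule causal_parseval[OF h h hL2 hsq hsq])
  show "((\<lambda>N. truncated_inverse (G i j) N t) \<longlongrightarrow> of_real (autocov M Y t $ i $ j)) at_top"
    unfolding autocov Gtrunc by (intro tendsto_sum tendsto_mult[OF tendsto_const] parseval)
  \<comment> \<open>The L2 inverse Fourier transform includes square integrability of
    \<open>H\<close> on the imaginary axis. Entries inherit it, and products of two
    square-integrable entries are integrable.\<close>
  have Hsq: "square_integrable lborel (F i k)" for i k
  proof -
    have int: "integrable lborel (\<lambda>x. (norm (H (\<i> * of_real x)))\<^sup>2)"
      using g unfolding is_L2_inverse_fourier_def by blast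
    have Fm: "F i k \<in> borel_measurable borel"
      using Fc by (rule borel_measurable_continuous_onI)
    have "norm (F i k x) \<le> norm (H (\<i> * of_real x))" for x
      unfolding F_def
      by (rule order_trans[OF Finite_Cartesian_Product.norm_nth_le Finite_Cartesian_Product.norm_nth_le])
    then have "norm ((norm (F i k x))\<^sup>2) \<le> norm ((norm (H (\<i> * of_real x)))\<^sup>2)" for x
      by (simp add: power_mono)
    then have "integrable lborel (\<lambda>x. (norm (F i k x))\<^sup>2)"
      using Fm by (intro Bochner_Integration.integrable_bound[OF int] AE_I2) auto
    with Fm show ?thesis by (simp add: square_integrable_def)
  qed
  have Hrsq: "square_integrable lborel (\<lambda>x. F i k (- x))" for i k
  proof -
    have "integrable lborel (\<lambda>x. (norm (F i k (0 + (- 1) * x)))\<^sup>2)"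
      using Hsq[of i k] by (subst lborel_integrable_real_affine_iff) (auto simp: square_integrable_def)
    moreover have "(\<lambda>x. F i k (- x)) \<in> borel_measurable borel"
      using Frc by (rule borel_measurable_continuous_onI)
    ultimately show ?thesis by (simp add: square_integrable_def)
  qed
  show "integrable lborel (G i j)"
    unfolding Gsum[abs_def]
    by (intro Bochner_Integration.integrable_sum integrable_mult_right square_integrable_mult Hsq Hrsq)
  show "G i j (- x) = G j i x"
  proof -
    have "G i j (- x) = (\<Sum>l\<in>UNIV. \<Sum>k\<in>UNIV. of_real (S $ k $ l) * (F i k (- x) * F j l x))"
      unfolding Gsum minus_minus by (rule sum.swap)
    moreover have "of_real (S $ k $ l) * (a * b) = of_real (S $ l $ k) * (b * a)" for k l and a b :: complex
      using sym[of k l] by simp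
    ultimately show ?thesis
      unfolding Gsum by (simp only:)
  qed
qed

text \<open>For \<open>t > 0\<close> the same truncated integrals have two limits, one from the
  isometry and one from the partial fractions, so these agree.\<close>

lemma (in second_order_noise) autocov_partial_fractions:
  fixes P Q :: "complex poly ^ 'd ^ 'd"
  assumes causal: "\<And>i k. \<exists>h. causal_transform h
      (\<lambda>x. (matrix_inv (eval_mat P (\<i> * of_real x)) ** eval_mat Q (\<i> * of_real x)) $ i $ k)"
    and Y: "mcarma_process M L P Q Y"
    and \<zeta>: "\<And>l. l \<in> {1..m} \<Longrightarrow> Re (\<zeta> l) < 0"
    and R: "\<And>x. R_fun P Q S (\<i> * of_real x) = (\<Sum>l=1..m. \<Sum>j=1..\<nu> l.
        (1 / (\<i> * of_real x - \<zeta> l) ^ j) *k \<alpha> l j + (1 / (- (\<i> * of_real x) - \<zeta> l) ^ j) *k \<beta> l j)"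
  shows "0 \<le> t \<Longrightarrow> cmatrix (autocov M Y t) = (\<Sum>l=1..m. \<Sum>j=1..\<nu> l. exp_kernel (\<zeta> l) (j - 1) t *k \<alpha> l j)"
    and "autocov M Y (- t) = transpose (autocov M Y t)"
proof -
  define G where "G i j x = R_fun P Q S (\<i> * of_real x) $ i $ j" for i j x
  have inv: "((\<lambda>N. truncated_inverse (G i j) N t) \<longlongrightarrow> of_real (autocov M Y t $ i $ j)) at_top" "integrable lborel (G i j)" "G i j (- x) = G j i x" for i j t x
    by (rule autocov_inverse[OF causal Y G_def])+
  let ?K = "\<lambda>i j t. \<Sum>l=1..m. \<Sum>n=1..\<nu> l. exp_kernel (\<zeta> l) (n - 1) t * \<alpha> l n $ i $ j"
  have pos: "of_real (autocov M Y t $ i $ j) = ?K i j t" if "0 < t" for t i j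
  proof (rule tendsto_unique[OF _ inv(1)])
    show "((\<lambda>N. truncated_inverse (G i j) N t) \<longlongrightarrow> ?K i j t) at_top"
    proof (rule partial_fractions_inverse[OF \<zeta> that, where b = "\<lambda>l n. \<beta> l n $ i $ j"])
      show "G i j x = (\<Sum>l = 1..m. \<Sum>n = 1..\<nu> l. 1 / (\<i> * of_real x - \<zeta> l) ^ n * \<alpha> l n $ i $ j
          + 1 / (- (\<i> * of_real x) - \<zeta> l) ^ n * \<beta> l n $ i $ j)" for x
        unfolding G_def R by (simp add: sum_component matrix_smult_def)
    qed
  qed simp
  have full: "of_real (autocov M Y t $ i $ j) = of_real (1 / (2 * pi)) * (LINT x|lborel. exp (\<i> * of_real t * of_real x) * G i j x)" for t i j
    by (rule tendsto_unique[OF _ inv(1) truncated_inverse_integrable[OF inv(2)]]) simp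
  \<comment> \<open>By \<open>full\<close> the autocovariance is continuous, and the kernels are
    right continuous at 0; so the equality extends from the times \<open>1 / (n + 1)\<close> to
    0.\<close>
  have zero: "of_real (autocov M Y 0 $ i $ j) = ?K i j 0" for i j
  proof (rule LIMSEQ_unique)
    let ?t = "\<lambda>n. inverse (real (Suc n))"
    have t: "?t \<longlonglongrightarrow> 0" by (rule LIMSEQ_inverse_real_of_nat)
    have "(\<lambda>n. of_real (1 / (2 * pi)) * (LINT x|lborel. exp (\<i> * of_real (?t n) * of_real x) * G i j x))
      \<longlonglongrightarrow> of_real (1 / (2 * pi)) * (LINT x|lborel. exp (\<i> * of_real 0 * of_real x) * G i j x)"
      by (intro tendsto_mult tendsto_const inverse_transform_sequentially_continuous inv(2) t)
    then show "(\<lambda>n. complex_of_real (autocov M Y (?t n) $ i $ j)) \<longlonglongrightarrow> of_real (autocov M Y 0 $ i $ j)"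
      unfolding full .
    have "complex_of_real (autocov M Y (?t n) $ i $ j) = ?K i j (?t n)" for n
      by (rule pos) simp
    moreover have "(\<lambda>n. ?K i j (?t n)) \<longlonglongrightarrow> ?K i j 0"
      by (intro tendsto_sum tendsto_mult tendsto_const exp_kernel_right_continuous t) simp
    ultimately show "(\<lambda>n. complex_of_real (autocov M Y (?t n) $ i $ j)) \<longlonglongrightarrow> ?K i j 0"
      by (simp only:)
  qed
  show "cmatrix (autocov M Y t) = (\<Sum>l=1..m. \<Sum>j=1..\<nu> l. exp_kernel (\<zeta> l) (j - 1) t *k \<alpha> l j)" if "0 \<le> t"
  proof -
    have "of_real (autocov M Y t $ i $ j) = ?K i j t" for i j
      using pos[of t i j] zero[of i j] that by (cases "t = 0") auto
    then show ?thesis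
      by (simp add: vec_eq_iff map_matrix_def sum_component matrix_smult_def)
  qed
  \<comment> \<open>Reflecting \<open>G\<close> exchanges its indices, and on the inverse side it
    exchanges \<open>t\<close> with \<open>- t\<close>.\<close>
  have "complex_of_real (autocov M Y (- t) $ i $ j) = of_real (autocov M Y t $ j $ i)" for i j
  proof (rule tendsto_unique[OF _ inv(1)])
    have "G j i = (\<lambda>x. G i j (- x))"
      using inv(3)[of i j] by (simp add: fun_eq_iff)
    then have "truncated_inverse (G j i) N t = truncated_inverse (G i j) N (- t)" for N
      by (simp only: truncated_inverse_reflect)
    with inv(1)[of j i t]
    show "((\<lambda>N. truncated_inverse (G i j) N (- t)) \<longlongrightarrow> of_real (autocov M Y t $ j $ i)) at_top"
      by (simp only:)
  qed simp
  then show "autocov M Y (- t) = transpose (autocov M Y t)"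
    by (simp add: vec_eq_iff transpose_def)
qed

section \<open>Eulerian series and trigonometric polynomials\<close>

lemma powser_norm_summable:
  fixes c :: "nat \<Rightarrow> complex"
  assumes "\<And>x. norm x < 1 \<Longrightarrow> summable (\<lambda>k. c k * x ^ k)" "norm z < 1"
  shows "summable (\<lambda>k. norm (c k * z ^ k))"
proof (rule powser_insidea)
  let ?x = "complex_of_real ((1 + norm z) / 2)"
  have n: "norm ?x = (1 + norm z) / 2"
    by (simp only: norm_of_real) (simp add: abs_of_nonneg)
  show "norm z < norm ?x" using assms(2) unfolding n by simp
  show "summable (\<lambda>k. c k * ?x ^ k)"
    by (rule assms(1)) (simp only: n, use assms(2) in simp)
qed

text \<open>With \<open>0 ^ 0 = 1\<close> the case \<open>n = 0\<close> is the geometric series,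
  while for \<open>n > 0\<close> the series starts with \<open>x\<close>. The two coefficient
  conditions record this; they later fix the lowest frequency of the trigonometric polynomial and
  keep its coefficient from vanishing.\<close>

definition is_eulerian :: "nat \<Rightarrow> complex poly \<Rightarrow> bool"
  where "is_eulerian n E \<longleftrightarrow> degree E \<le> n \<and> (n > 0 \<longrightarrow> coeff E 0 = 0 \<and> coeff E 1 = 1) \<and>
    (\<forall>x. norm x < 1 \<longrightarrow> (\<lambda>k. of_nat k ^ n * x ^ k) sums (poly E x / (1 - x) ^ Suc n))"

text \<open>The operator \<open>x d/dx\<close> multiplies the coefficients by \<open>k\<close> and
  sends \<open>E / (1 - x)^(n + 1)\<close> to \<open>x H / (1 - x)^(n + 2)\<close> with
  \<open>H = (1 - x) E' + (n + 1) E\<close>. The value \<open>E = 1\<close> at \<open>n = 0\<close>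
  is carried along because the coefficient conditions, which make \<open>H\<close> start with 1,
  begin only at \<open>n = 1\<close>.\<close>

lemma ex_eulerian: "\<exists>E. is_eulerian n E \<and> (n = 0 \<longrightarrow> E = 1)"
proof (induction n)
  case 0
  have "(\<lambda>k. x ^ k) sums (1 / (1 - x))" if "norm x < 1" for x :: complex
    using geometric_sums[OF that] .
  then show ?case by (auto simp: is_eulerian_def)
next
  case (Suc n)
 then obtain E :: "complex poly" where deg: "degree E \<le> n" and c: "n > 0 \<longrightarrow> coeff E 0 = 0 \<and> coeff E 1 = 1" and n0: "n = 0 \<longrightarrow> E = 1"
    and E: "\<And>x. norm x < 1 \<Longrightarrow> (\<lambda>k. of_nat k ^ n * x ^ k) sums (poly E x / (1 - x) ^ Suc n)"
    unfolding is_eulerian_def by blast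
  define H where "H = [:1, -1:] * pderiv E + smult (of_nat (Suc n)) E"
  have degH: "degree H \<le> n"
  proof (cases "n = 0")
    case True
    then show ?thesis using n0 by (simp add: H_def)
  next
    case False
    have "degree ([:1, -1:] * pderiv E) \<le> 1 + (n - 1)"
      using deg by (intro order_trans[OF degree_mult_le] add_mono) (auto simp: degree_pderiv)
    then show ?thesis
      unfolding H_def using False deg by (intro degree_add_le) (auto intro: order_trans[OF degree_smult_le])
  qed
  have H0: "coeff H 0 = 1"
    using c n0 by (cases "n = 0") (auto simp: H_def coeff_pderiv mult_poly_0_left coeff_mult)
  have sum: "(\<lambda>k. of_nat k ^ Suc n * x ^ k) sums (poly ([:0, 1:] * H) x / (1 - x) ^ Suc (Suc n))"
    if x: "norm x < 1" for x :: complex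
  proof -
    let ?c = "\<lambda>k. of_nat k ^ n :: complex"
    let ?S = "\<lambda>x. \<Sum>k. ?c k * x ^ k"
    have smb: "summable (\<lambda>k. ?c k * z ^ k)" if "norm z < 1" for z
      using E[OF that] by (rule sums_summable)
    have D: "(?S has_field_derivative (\<Sum>k. diffs ?c k * x ^ k)) (at x)"
      using smb x by (rule termdiffs_strong')
    have "(?S has_field_derivative poly H x / (1 - x) ^ Suc (Suc n)) (at x)"
    proof (rule has_field_derivative_transform_within_open)
      show "open (ball 0 1 :: complex set)" by simp
      show "x \<in> ball 0 1" using x by simp
      show "poly E y / (1 - y) ^ Suc n = ?S y" if "y \<in> ball 0 1" for y
        using E[of y] that by (auto simp: sums_iff)
      have ne: "1 - x \<noteq> 0" using x by auto
      have "((\<lambda>y. poly E y / (1 - y) ^ Suc n) has_field_derivative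
        (poly (pderiv E) x * (1 - x) ^ Suc n - poly E x * (of_nat (Suc n) * (1 - x) ^ n * (- 1))) / ((1 - x) ^ Suc n * (1 - x) ^ Suc n)) (at x)"
        by (rule derivative_eq_intros poly_DERIV refl | use ne in simp)+
      moreover have "(p * w ^ Suc n - e * (s * w ^ n * (- 1))) / (w ^ Suc n * w ^ Suc n) = (p * w + s * e) / w ^ Suc (Suc n)"
        if "w \<noteq> 0" for p w e s :: complex
      proof -
        have "p * w ^ Suc n - e * (s * w ^ n * (- 1)) = w ^ n * (p * w + s * e)" by (simp add: algebra_simps)
        moreover have "w ^ Suc n * w ^ Suc n = w ^ n * w ^ Suc (Suc n)" by simp
        ultimately show ?thesis using that by simp
      qed
      ultimately show "((\<lambda>y. poly E y / (1 - y) ^ Suc n) has_field_derivative poly H x / (1 - x) ^ Suc (Suc n)) (at x)"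
        using ne by (simp add: H_def algebra_simps del: power_Suc of_nat_Suc)
    qed
    with D have eq: "(\<Sum>k. diffs ?c k * x ^ k) = poly H x / (1 - x) ^ Suc (Suc n)"
      by (rule DERIV_unique)
    have "summable (\<lambda>k. diffs ?c k * x ^ k)"
      by (rule termdiff_converges[OF x smb])
    then have "(\<lambda>k. diffs ?c k * x ^ k) sums (poly H x / (1 - x) ^ Suc (Suc n))"
      unfolding eq[symmetric] by (rule summable_sums)
    from sums_mult[OF this, of x]
    have "(\<lambda>k. of_nat (Suc k) ^ Suc n * x ^ Suc k) sums (x * (poly H x / (1 - x) ^ Suc (Suc n)))"
      by (simp add: diffs_def mult_ac)
    then have "(\<lambda>k. of_nat k ^ Suc n * x ^ k) sums (x * (poly H x / (1 - x) ^ Suc (Suc n)) + of_nat 0 ^ Suc n * x ^ 0)"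
      by (rule sums_Suc)
    then show ?thesis by simp
  qed
  have "degree ([:0, 1:] * H) \<le> Suc n"
    using degH degree_mult_le[of "[:0, 1:]" H] by simp
  moreover have "coeff ([:0, 1:] * H) 0 = 0" "coeff ([:0, 1:] * H) 1 = 1"
    using H0 by simp_all
  ultimately show ?case
    using sum unfolding is_eulerian_def by blast
qed

definition eulerian :: "nat \<Rightarrow> complex poly"
  where "eulerian n = (SOME E. is_eulerian n E)"

lemma is_eulerian_eulerian: "is_eulerian n (eulerian n)"
  unfolding eulerian_def by (rule someI_ex) (use ex_eulerian[of n] in blast)

text \<open>Let \<open>c = exp (\<Delta> z)\<close> and
  \<open>D = cosh (\<Delta> z) - cos \<omega>\<close>. From \<open>(1 - x) (1 - y) = 2 c D\<close>
  one has \<open>1 / (1 - y)^j = (1 - x)^j / ((2 c)^j D^j)\<close>. The numerator is what multiplies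
  \<open>1 / D^j\<close> in the sampled kernel sum, divided by \<open>2 \<pi>\<close>; the power of
  \<open>\<Delta>\<close> over the factorial comes from the kernel at time
  \<open>k \<Delta>\<close>.\<close>

definition trig_numerator :: "nat \<Rightarrow> real \<Rightarrow> complex \<Rightarrow> real \<Rightarrow> complex"
  where "trig_numerator j \<Delta> z \<omega> = of_real \<Delta> ^ (j - 1) / (2 * of_real pi * fact (j - 1)) *
    poly (eulerian (j - 1)) (exp (of_real \<Delta> * z + \<i> * of_real \<omega>)) *
    (1 - exp (of_real \<Delta> * z - \<i> * of_real \<omega>)) ^ j / (2 * exp (of_real \<Delta> * z)) ^ j"

text \<open>Without a constant term the Eulerian polynomial contributes frequencies \<open>a\<close>
  from 1 to \<open>n\<close>, and the binomial power contributes \<open>- b\<close> with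
  \<open>b\<close> from 0 to \<open>j = n + 1\<close>. So \<open>a - b\<close> stays between
  \<open>- n\<close> and \<open>n\<close>.\<close>

lemma trig_numerator_trig_poly:
  assumes j: "j \<ge> 2" and \<Delta>: "\<Delta> > 0"
  shows "trig_poly_of_degree (j - 1) (trig_numerator j \<Delta> z)"
proof -
  define n where "n = j - 1"
  have n: "j = Suc n" "n > 0" using j by (auto simp: n_def)
  define c where "c = exp (of_real \<Delta> * z)"
  define K where "K = of_real \<Delta> ^ n / (2 * of_real pi * fact n) / (2 * c) ^ j"
  have "c \<noteq> 0" by (simp add: c_def)
  have "K \<noteq> 0" using \<Delta> \<open>c \<noteq> 0\<close> by (simp add: K_def)
  define e where "e = coeff (eulerian n)"
  have E: "degree (eulerian n) \<le> n" "e 0 = 0" "e 1 = 1"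
    using is_eulerian_eulerian[of n] n(2) by (auto simp: is_eulerian_def e_def)
  define w where "w = (\<lambda>(a, b). K * (e a * of_nat (j choose b) * (-1) ^ b * c ^ (a + b)))"
  define S where "S = {1..n} \<times> {0..j}"
  define g where "g = (\<lambda>(a, b). int a - int b)"
  define coe where "coe k = (\<Sum>p\<in>{p \<in> S. g p = k}. w p)" for k
  have "trig_numerator j \<Delta> z \<omega> = (\<Sum>k=- int n..int n. coe k * exp (\<i> * of_int k * of_real \<omega>))" for \<omega>
  proof -
    define v where "v = exp (\<i> * of_real \<omega>)"
    have v: "v \<noteq> 0" by (simp add: v_def)
    have vp: "exp (\<i> * of_int (g (a, b)) * of_real \<omega>) = v ^ a * inverse v ^ b" for a b
    proof -
      have "\<i> * of_int (g (a, b)) * of_real \<omega> = of_nat a * (\<i> * of_real \<omega>) + of_nat b * (- (\<i> * of_real \<omega>))"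
        by (simp add: g_def algebra_simps)
      then show ?thesis
        by (simp only: exp_add exp_of_nat_mult exp_minus v_def)
    qed
    have "poly (eulerian n) (c * v) = (\<Sum>a\<le>n. e a * (c * v) ^ a)"
    proof -
      have "poly (eulerian n) (c * v) = (\<Sum>a\<le>degree (eulerian n). e a * (c * v) ^ a)"
        unfolding e_def by (rule poly_altdef)
      also have "\<dots> = (\<Sum>a\<le>n. e a * (c * v) ^ a)"
        by (rule sum.mono_neutral_left) (use E(1) in \<open>auto simp: e_def coeff_eq_0\<close>)
      finally show ?thesis .
    qed
    also have "\<dots> = (\<Sum>a\<in>{1..n}. e a * (c * v) ^ a)"
      by (rule sum.mono_neutral_right) (auto simp: E(2) not_le)
    finally have p1: "poly (eulerian n) (c * v) = (\<Sum>a\<in>{1..n}. e a * (c * v) ^ a)" .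
    have "(- (c * inverse v) + 1) ^ j = (\<Sum>b\<le>j. of_nat (j choose b) * (- (c * inverse v)) ^ b * 1 ^ (j - b))"
      by (rule binomial_ring)
    then have p2: "(1 - c * inverse v) ^ j = (\<Sum>b\<in>{0..j}. of_nat (j choose b) * (- (c * inverse v)) ^ b)"
      by (simp add: atMost_atLeast0)
    have "trig_numerator j \<Delta> z \<omega> = K * (poly (eulerian n) (c * v) * (1 - c * inverse v) ^ j)"
    proof -
      have "exp (of_real \<Delta> * z + \<i> * of_real \<omega>) = c * v" "exp (of_real \<Delta> * z - \<i> * of_real \<omega>) = c * inverse v"
        by (simp_all only: c_def v_def exp_add exp_diff divide_inverse)
      then have "trig_numerator j \<Delta> z \<omega> = of_real \<Delta> ^ n / (2 * of_real pi * fact n) *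
          poly (eulerian n) (c * v) * (1 - c * inverse v) ^ j / (2 * c) ^ j"
        unfolding trig_numerator_def c_def[symmetric] n_def[symmetric] by (simp only:)
      then show ?thesis by (simp add: K_def)
    qed
    also have "\<dots> = K * (\<Sum>(a, b)\<in>S. (e a * (c * v) ^ a) * (of_nat (j choose b) * (- (c * inverse v)) ^ b))"
      by (simp add: p1 p2 S_def sum_product sum.cartesian_product)
    also have "\<dots> = (\<Sum>p\<in>S. w p * exp (\<i> * of_int (g p) * of_real \<omega>))"
      unfolding sum_distrib_left
    proof (intro sum.cong refl, safe)
      fix a b
      have "(- (c * inverse v)) ^ b = (-1) ^ b * c ^ b * inverse v ^ b"
        using power_minus[of "c * inverse v" b] by (simp add: power_mult_distrib)
      then show "K * (e a * (c * v) ^ a * (of_nat (j choose b) * (- (c * inverse v)) ^ b)) =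
          w (a, b) * exp (\<i> * of_int (g (a, b)) * of_real \<omega>)"
        unfolding vp w_def prod.case power_mult_distrib[of c v] power_add by (simp only: mult_ac)
    qed
    also have "\<dots> = (\<Sum>k=- int n..int n. \<Sum>p\<in>{p \<in> S. g p = k}. w p * exp (\<i> * of_int (g p) * of_real \<omega>))"
      by (rule sum.group[symmetric]) (auto simp: S_def g_def n)
    also have "\<dots> = (\<Sum>k=- int n..int n. coe k * exp (\<i> * of_int k * of_real \<omega>))"
      by (simp add: coe_def sum_distrib_right)
    finally show ?thesis .
  qed
  \<comment> \<open>The frequency \<open>- n\<close> arises only from \<open>a = 1\<close> and
    \<open>b = j\<close>, so nothing can cancel, and the linear Eulerian coefficient is 1.\<close>
  moreover have "coe (- int n) \<noteq> 0"
  proof -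
    have "{p \<in> S. g p = - int n} = {(1, j)}"
      using n by (auto simp: S_def g_def)
    then have "coe (- int n) = w (1, j)" by (simp add: coe_def)
    then show ?thesis using \<open>K \<noteq> 0\<close> \<open>c \<noteq> 0\<close> E(3) by (simp add: w_def)
  qed
  ultimately show ?thesis
    unfolding trig_poly_of_degree_def n_def[symmetric] by blast
qed

section \<open>Summing the sampled kernels\<close>

lemma cosh_minus_cos:
  "2 * exp z * (cosh z - of_real (cos \<omega>)) = (1 - exp (z - \<i> * of_real \<omega>)) * (1 - exp (z + \<i> * of_real \<omega>))"
proof -
  have "(1 - exp (z - \<i> * of_real \<omega>)) * (1 - exp (z + \<i> * of_real \<omega>))
     = 1 - (exp (z - \<i> * of_real \<omega>) + exp (z + \<i> * of_real \<omega>)) + exp z * exp z"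
    by (simp add: algebra_simps exp_add[symmetric])
  also have "exp (z - \<i> * of_real \<omega>) + exp (z + \<i> * of_real \<omega>) = 2 * exp z * of_real (cos \<omega>)"
    by (simp add: exp_add exp_diff cos_of_real[symmetric] cos_exp_eq exp_minus field_simps)
  finally have "(1 - exp (z - \<i> * of_real \<omega>)) * (1 - exp (z + \<i> * of_real \<omega>)) =
    1 - 2 * exp z * of_real (cos \<omega>) + exp z * exp z" .
  moreover have "2 * exp z * cosh z = exp z * exp z + 1"
    by (simp add: cosh_def exp_minus field_simps scaleR_conv_of_real)
  ultimately show ?thesis by (simp add: algebra_simps)
qed

lemma one_minus_nonzero: "norm (w :: complex) < 1 \<Longrightarrow> 1 - w \<noteq> 0"
  by auto

lemma norm_exp_less_1:
  assumes "Re z < 0" "\<Delta> > 0"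
  shows "norm (exp (of_real \<Delta> * z + \<i> * of_real \<omega>)) < 1" "norm (exp (of_real \<Delta> * z - \<i> * of_real \<omega>)) < 1"
  using assms by (auto simp: mult_pos_neg)

lemma cosh_minus_cos_nonzero:
  assumes "Re z < 0" "\<Delta> > 0"
  shows "cosh (of_real \<Delta> * z) - of_real (cos \<omega>) \<noteq> 0"
proof -
  note one_minus_nonzero[OF norm_exp_less_1(1)[OF assms, of \<omega>]]
    one_minus_nonzero[OF norm_exp_less_1(2)[OF assms, of \<omega>]]
  then show ?thesis
    using cosh_minus_cos[of "of_real \<Delta> * z" \<omega>] by auto
qed

text \<open>Modulation and decay combine into powers of \<open>y\<close>, which lies inside the unit
  disc. Absolute summability is recorded because the spectral density is an unordered sum over the
  integers.\<close>

lemma exp_kernel_series: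
  fixes \<omega> :: real and n :: nat
  assumes z: "Re z < 0" and \<Delta>: "\<Delta> > 0"
  defines "y \<equiv> exp (of_real \<Delta> * z + \<i> * of_real \<omega>)"
  defines "f \<equiv> \<lambda>k. exp (\<i> * of_nat k * of_real \<omega>) * exp_kernel z n (of_nat k * \<Delta>)"
  shows "summable (\<lambda>k. norm (f k))"
    and "f sums (of_real \<Delta> ^ n / fact n * (poly (eulerian n) y / (1 - y) ^ Suc n))"
proof -
  have f: "f k = of_real \<Delta> ^ n / fact n * (of_nat k ^ n * y ^ k)" for k
  proof -
    have "exp (\<i> * of_nat k * of_real \<omega>) * exp (z * (of_nat k * of_real \<Delta>)) = y ^ k"
      unfolding y_def exp_of_nat_mult[symmetric] exp_add[symmetric] by (simp add: algebra_simps)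
    moreover have "exp_kernel z n (of_nat k * \<Delta>) = of_real \<Delta> ^ n / fact n * of_nat k ^ n * exp (z * (of_nat k * of_real \<Delta>))"
      using \<Delta> by (auto simp: exp_kernel_def power_mult_distrib mult_less_0_iff)
    ultimately show ?thesis by (simp add: f_def mult_ac)
  qed
  have y: "norm y < 1" unfolding y_def by (rule norm_exp_less_1[OF z \<Delta>])
  have sums: "(\<lambda>k. of_nat k ^ n * x ^ k) sums (poly (eulerian n) x / (1 - x) ^ Suc n)" if "norm x < 1" for x
    using is_eulerian_eulerian[of n] that by (auto simp: is_eulerian_def)
  show "f sums (of_real \<Delta> ^ n / fact n * (poly (eulerian n) y / (1 - y) ^ Suc n))"
    unfolding f by (intro sums_mult sums y)
  have "summable (\<lambda>k. norm (of_real \<Delta> ^ n / fact n :: complex) * norm (of_nat k ^ n * y ^ k))"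
    using sums y by (intro summable_mult powser_norm_summable) (auto intro: sums_summable)
  then show "summable (\<lambda>k. norm (f k))"
    unfolding f norm_mult by (simp add: mult_ac)
qed

lemma eulerian_0: "norm x < 1 \<Longrightarrow> poly (eulerian 0) x = 1"
proof -
  assume x: "norm x < 1"
  have "(\<lambda>k. x ^ k) sums (poly (eulerian 0) x / (1 - x))"
    using is_eulerian_eulerian[of 0] x by (auto simp: is_eulerian_def)
  from sums_unique2[OF this geometric_sums[OF x]] show ?thesis
    using x by auto
qed

lemma exp_kernel_series_0:
  fixes \<omega> :: real
  assumes z: "Re z < 0" and \<Delta>: "\<Delta> > 0"
  defines "D \<equiv> cosh (of_real \<Delta> * z) - complex_of_real (cos \<omega>)"
  shows "(\<lambda>k. exp (\<i> * of_nat k * of_real \<omega>) * exp_kernel z 0 (of_nat k * \<Delta>)) sums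
    ((exp (- (of_real \<Delta> * z)) - exp (- \<i> * of_real \<omega>)) / (2 * D))"
proof -
  let ?y = "exp (of_real \<Delta> * z + \<i> * of_real \<omega>)" and ?x = "exp (of_real \<Delta> * z - \<i> * of_real \<omega>)"
  let ?c = "exp (of_real \<Delta> * z)"
  have y: "norm ?y < 1" "norm ?x < 1" using norm_exp_less_1[OF z \<Delta>] by auto
  note ne = one_minus_nonzero[OF y(1)] one_minus_nonzero[OF y(2)]
  have "1 / (1 - ?y) = (1 - ?x) / ((1 - ?x) * (1 - ?y))" using ne by simp
  also have "\<dots> = (1 - ?x) / (2 * ?c * D)"
    unfolding D_def cosh_minus_cos ..
  also have "\<dots> = ((1 - ?x) / ?c) / (2 * D)" by simp
  also have "(1 - ?x) / ?c = exp (- (of_real \<Delta> * z)) - exp (- \<i> * of_real \<omega>)"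
  proof -
    have "?x = ?c * exp (- \<i> * of_real \<omega>)" unfolding exp_add[symmetric] by simp
    then show ?thesis by (simp add: diff_divide_distrib exp_minus inverse_eq_divide)
  qed
  finally show ?thesis
    using exp_kernel_series(2)[OF z \<Delta>, of \<omega> 0] by (simp add: eulerian_0[OF y(1)])
qed

lemma exp_kernel_series_trig:
  fixes \<omega> :: real
  assumes z: "Re z < 0" and \<Delta>: "\<Delta> > 0" and j: "j \<ge> 2"
  defines "D \<equiv> cosh (of_real \<Delta> * z) - complex_of_real (cos \<omega>)"
  shows "(\<lambda>k. exp (\<i> * of_nat k * of_real \<omega>) * exp_kernel z (j - 1) (of_nat k * \<Delta>)) sums
    (2 * of_real pi * (trig_numerator j \<Delta> z \<omega> / D ^ j))"
proof -
  let ?y = "exp (of_real \<Delta> * z + \<i> * of_real \<omega>)" and ?x = "exp (of_real \<Delta> * z - \<i> * of_real \<omega>)"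
  let ?c = "exp (of_real \<Delta> * z)"
  have y: "norm ?y < 1" "norm ?x < 1" using norm_exp_less_1[OF z \<Delta>] by auto
  note ne = one_minus_nonzero[OF y(1)] one_minus_nonzero[OF y(2)]
  have "1 / (1 - ?y) ^ j = (1 - ?x) ^ j / ((1 - ?x) * (1 - ?y)) ^ j"
    using ne by (simp add: power_mult_distrib)
  also have "\<dots> = (1 - ?x) ^ j / ((2 * ?c) ^ j * D ^ j)"
    unfolding D_def cosh_minus_cos[symmetric] power_mult_distrib ..
  finally have eq: "1 / (1 - ?y) ^ j = (1 - ?x) ^ j / ((2 * ?c) ^ j * D ^ j)" .
  have "of_real \<Delta> ^ (j - 1) / fact (j - 1) * (poly (eulerian (j - 1)) ?y / (1 - ?y) ^ Suc (j - 1))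
      = of_real \<Delta> ^ (j - 1) / fact (j - 1) * (poly (eulerian (j - 1)) ?y * (1 / (1 - ?y) ^ j))"
  proof -
    have "Suc (j - 1) = j" using j by simp
    then show ?thesis by (simp only: divide_inverse mult_1_left)
  qed
  also have "\<dots> = 2 * of_real pi * (trig_numerator j \<Delta> z \<omega> / D ^ j)"
  proof -
    have "a / f * (e * (c / (g * d))) = 2 * q * (a / (2 * q * f) * e * c / g / d)" if "q \<noteq> 0"
      for a f e c g d q :: complex
      using that by simp
    then show ?thesis unfolding eq trig_numerator_def by auto
  qed
  finally show ?thesis
    using exp_kernel_series(2)[OF z \<Delta>, of \<omega> "j - 1"] by (simp only:)
qed

section \<open>The sampled spectral density\<close>

lemma bounded_linear_matrix_smult: "bounded_linear (\<lambda>c. c *k (A :: complex ^ 'n ^ 'm))"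
proof (rule linear_conv_bounded_linear[THEN iffD1], rule linearI)
  show "(a + b) *k A = a *k A + b *k A" for a b
    by (simp add: matrix_smult_def vec_eq_iff algebra_simps)
  show "(r *\<^sub>R b) *k A = r *\<^sub>R (b *k A)" for r b
    by (simp add: matrix_smult_def vec_eq_iff)
qed

lemma matrix_smult_smult: "a *k (b *k A) = (a * b) *k (A :: complex ^ 'n ^ 'm)"
  by (simp add: matrix_smult_def vec_eq_iff mult.assoc)

lemma matrix_smult_sum: "c *k (\<Sum>i\<in>I. A i) = (\<Sum>i\<in>I. c *k (A i :: complex ^ 'n ^ 'm))"
  by (simp add: matrix_smult_def vec_eq_iff sum_component sum_distrib_left)

lemma transpose_smult: "transpose (c *k A) = c *k transpose A"
  by (simp add: matrix_smult_def vec_eq_iff transpose_def)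

lemma transpose_sum: "transpose (\<Sum>i\<in>I. A i) = (\<Sum>i\<in>I. transpose (A i :: complex ^ 'n ^ 'm))"
  by (simp add: vec_eq_iff transpose_def sum_component)

lemma transpose_cmatrix: "transpose (cmatrix A) = cmatrix (transpose A)"
  by (simp add: vec_eq_iff transpose_def map_matrix_def)

lemma has_sum_finite_sum:
  fixes f :: "'i \<Rightarrow> 'a \<Rightarrow> 'b::{topological_comm_monoid_add}"
  assumes "\<And>i. i \<in> I \<Longrightarrow> (f i has_sum s i) A"
  shows "((\<lambda>x. \<Sum>i\<in>I. f i x) has_sum (\<Sum>i\<in>I. s i)) A"
  using assms
  by (induction I rule: infinite_finite_induct) (auto intro: has_sum_add has_sum_0)

lemma has_sum_int_split:
  fixes f :: "int \<Rightarrow> 'b::topological_comm_monoid_add"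
  assumes "((\<lambda>n. f (int (Suc n))) has_sum a) UNIV" "((\<lambda>n. f (- int n)) has_sum b) UNIV"
  shows "(f has_sum (a + b)) UNIV"
proof -
  have "(f has_sum a) (range (\<lambda>n. int (Suc n)))"
    using assms(1) by (subst has_sum_reindex) (auto simp: inj_def o_def)
  moreover have "(f has_sum b) (range (\<lambda>n. - int n))"
    using assms(2) by (subst has_sum_reindex) (auto simp: inj_def o_def)
  moreover have "range (\<lambda>n. int (Suc n)) \<inter> range (\<lambda>n. - int n) = {}"
    by auto
  ultimately have "(f has_sum (a + b)) (range (\<lambda>n. int (Suc n)) \<union> range (\<lambda>n. - int n))"
    by (rule has_sum_Un_disjoint)
  moreover have "range (\<lambda>n. int (Suc n)) \<union> range (\<lambda>n. - int n) = UNIV"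
  proof -
    have "k \<in> range (\<lambda>n. int (Suc n)) \<union> range (\<lambda>n. - int n)" for k
    proof (cases "k \<le> 0")
      case True
      then have "k = - int (nat (- k))" by simp
      then show ?thesis by blast
    next
      case False
      then have "k = int (Suc (nat (k - 1)))" by simp
      then show ?thesis by blast
    qed
    then show ?thesis by blast
  qed
  ultimately show ?thesis by simp
qed

text \<open>One series serves both halves of the spectral sum: nonpositive lags use it at
  \<open>\<omega>\<close>, positive lags at \<open>- \<omega>\<close> with the term
  \<open>k = 0\<close> removed.\<close>

definition sampled_factor :: "nat \<Rightarrow> real \<Rightarrow> complex \<Rightarrow> real \<Rightarrow> complex"
  where "sampled_factor j \<Delta> z \<omega> =
    (\<Sum>k. exp (\<i> * of_nat k * of_real \<omega>) * exp_kernel z (j - 1) (of_nat k * \<Delta>))"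

lemma sampled_factor_has_sum:
  fixes j :: nat
  assumes "Re z < 0" "\<Delta> > 0"
  defines "f \<equiv> \<lambda>\<omega> k. exp (\<i> * of_nat k * of_real \<omega>) * exp_kernel z (j - 1) (of_nat k * \<Delta>)"
  shows "(f \<omega> has_sum sampled_factor j \<Delta> z \<omega>) UNIV"
    and "((\<lambda>k. f \<omega> (Suc k)) has_sum (sampled_factor j \<Delta> z \<omega> - exp_kernel z (j - 1) 0)) UNIV"
proof -
  have s: "summable (\<lambda>k. norm (f \<omega> k))"
    unfolding f_def by (rule exp_kernel_series(1)[OF assms(1,2)])
  have "f \<omega> sums sampled_factor j \<Delta> z \<omega>"
    using summable_sums[OF summable_norm_cancel[OF s]] by (simp add: sampled_factor_def f_def)
  then show "(f \<omega> has_sum sampled_factor j \<Delta> z \<omega>) UNIV"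
    using s by (intro norm_summable_imp_has_sum)
  have "f \<omega> 0 = exp_kernel z (j - 1) 0" by (simp add: f_def)
  then have "(\<lambda>k. f \<omega> (Suc k)) sums (sampled_factor j \<Delta> z \<omega> - exp_kernel z (j - 1) 0)"
    using \<open>f \<omega> sums sampled_factor j \<Delta> z \<omega>\<close> by (subst sums_Suc_iff) simp
  moreover have "summable (\<lambda>k. norm (f \<omega> (Suc k)))"
    using s by (subst summable_Suc_iff)
  ultimately show "((\<lambda>k. f \<omega> (Suc k)) has_sum (sampled_factor j \<Delta> z \<omega> - exp_kernel z (j - 1) 0)) UNIV"
    by (intro norm_summable_imp_has_sum)
qed

lemma sampled_series:
  fixes \<alpha> :: "nat \<Rightarrow> nat \<Rightarrow> complex ^ 'd ^ 'd"
  assumes \<Delta>: "\<Delta> > 0" and \<zeta>: "\<And>l. l \<in> {1..m} \<Longrightarrow> Re (\<zeta> l) < 0"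
    and \<Gamma>: "\<And>t. 0 \<le> t \<Longrightarrow> \<Gamma> t = (\<Sum>l=1..m. \<Sum>j=1..\<nu> l. exp_kernel (\<zeta> l) (j - 1) t *k \<alpha> l j)"
    and sym: "\<And>t. 0 \<le> t \<Longrightarrow> \<Gamma> (- t) = transpose (\<Gamma> t)"
  shows "((\<lambda>k::int. exp (- \<i> * of_int k * of_real \<omega>) *k \<Gamma> (of_int k * \<Delta>)) has_sum
    (\<Sum>l=1..m. \<Sum>j=1..\<nu> l. (sampled_factor j \<Delta> (\<zeta> l) (- \<omega>) - exp_kernel (\<zeta> l) (j - 1) 0) *k \<alpha> l j
        + sampled_factor j \<Delta> (\<zeta> l) \<omega> *k transpose (\<alpha> l j))) UNIV"
proof -
  let ?f = "\<lambda>k::int. exp (- \<i> * of_int k * of_real \<omega>) *k \<Gamma> (of_int k * \<Delta>)"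
  let ?e = "\<lambda>l j \<omega> k. exp (\<i> * of_nat k * of_real \<omega>) * exp_kernel (\<zeta> l) (j - 1) (of_nat k * \<Delta>)"
  have pos: "?f (int (Suc n)) = (\<Sum>l=1..m. \<Sum>j=1..\<nu> l. ?e l j (- \<omega>) (Suc n) *k \<alpha> l j)" for n
  proof -
    have "- \<i> * of_int (int (Suc n)) * of_real \<omega> = \<i> * of_nat (Suc n) * of_real (- \<omega>)" by simp
    moreover have "\<Gamma> (of_int (int (Suc n)) * \<Delta>) = (\<Sum>l=1..m. \<Sum>j=1..\<nu> l. exp_kernel (\<zeta> l) (j - 1) (of_nat (Suc n) * \<Delta>) *k \<alpha> l j)"
      using \<Gamma>[of "of_nat (Suc n) * \<Delta>"] \<Delta> by simp
    ultimately show ?thesis by (simp only: matrix_smult_sum matrix_smult_smult)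
  qed
  have neg: "?f (- int n) = (\<Sum>l=1..m. \<Sum>j=1..\<nu> l. ?e l j \<omega> n *k transpose (\<alpha> l j))" for n
  proof -
    have "- \<i> * of_int (- int n) * of_real \<omega> = \<i> * of_nat n * of_real \<omega>" by simp
    moreover have "\<Gamma> (of_int (- int n) * \<Delta>) = transpose (\<Gamma> (of_nat n * \<Delta>))"
      using sym[of "of_nat n * \<Delta>"] \<Delta> by simp
    moreover have "\<Gamma> (of_nat n * \<Delta>) = (\<Sum>l=1..m. \<Sum>j=1..\<nu> l. exp_kernel (\<zeta> l) (j - 1) (of_nat n * \<Delta>) *k \<alpha> l j)"
      using \<Gamma>[of "of_nat n * \<Delta>"] \<Delta> by simp
    ultimately show ?thesis by (simp only: matrix_smult_sum matrix_smult_smult transpose_sum transpose_smult)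
  qed
  have "((\<lambda>n. ?f (int (Suc n))) has_sum (\<Sum>l=1..m. \<Sum>j=1..\<nu> l.
      (sampled_factor j \<Delta> (\<zeta> l) (- \<omega>) - exp_kernel (\<zeta> l) (j - 1) 0) *k \<alpha> l j)) UNIV"
    unfolding pos
    by (intro has_sum_finite_sum has_sum_bounded_linear[OF bounded_linear_matrix_smult]
        sampled_factor_has_sum(2) \<zeta> \<Delta>)
  moreover have "((\<lambda>n. ?f (- int n)) has_sum (\<Sum>l=1..m. \<Sum>j=1..\<nu> l.
      sampled_factor j \<Delta> (\<zeta> l) \<omega> *k transpose (\<alpha> l j))) UNIV"
    unfolding neg
    by (intro has_sum_finite_sum has_sum_bounded_linear[OF bounded_linear_matrix_smult]
        sampled_factor_has_sum(1) \<zeta> \<Delta>)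
  ultimately show ?thesis
    unfolding sum.distrib by (rule has_sum_int_split)
qed

lemma sampled_factor_trig:
  assumes "Re z < 0" "\<Delta> > 0" "j \<ge> 2"
  shows "sampled_factor j \<Delta> z \<omega> =
    2 * of_real pi * (trig_numerator j \<Delta> z \<omega> / (cosh (of_real \<Delta> * z) - of_real (cos \<omega>)) ^ j)"
  unfolding sampled_factor_def using exp_kernel_series_trig[OF assms] by (rule sums_unique[symmetric])

lemma sampled_factor_1:
  assumes "Re z < 0" "\<Delta> > 0"
  shows "sampled_factor 1 \<Delta> z \<omega> =
    (exp (- (of_real \<Delta> * z)) - exp (- \<i> * of_real \<omega>)) / (2 * (cosh (of_real \<Delta> * z) - of_real (cos \<omega>)))"
  unfolding sampled_factor_def diff_self_eq_0
  using exp_kernel_series_0[OF assms] by (rule sums_unique[symmetric])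

text \<open>With \<open>2 D = p + q - u - v\<close>, the transposed half contributes
  \<open>(q - u) / (2 D)\<close>. In the other half, removing the lag-0 term, which is 1, changes
  \<open>(q - v) / (2 D)\<close> to \<open>(u - p) / (2 D)\<close>. Collecting the multiples of
  \<open>u\<close> gives \<open>A - transpose A\<close>.\<close>

lemma simple_pole_term:
  fixes A :: "complex ^ 'd ^ 'd"
  assumes z: "Re z < 0" and \<Delta>: "\<Delta> > 0"
  shows "of_real (1 / (2 * pi)) *k ((sampled_factor 1 \<Delta> z (- \<omega>) - exp_kernel z (1 - 1) 0) *k A
        + sampled_factor 1 \<Delta> z \<omega> *k transpose A)
    = of_real (1 / (4 * pi)) *k ((1 / (cosh (of_real \<Delta> * z) - of_real (cos \<omega>))) *k
        (exp (- \<i> * of_real \<omega>) *k (A - transpose A) - exp (of_real \<Delta> * z) *k A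
          + exp (- (of_real \<Delta> * z)) *k transpose A))"
proof -
  define D where "D = cosh (of_real \<Delta> * z) - complex_of_real (cos \<omega>)"
  define p where "p = exp (of_real \<Delta> * z)"
  define q where "q = exp (- (of_real \<Delta> * z))"
  define u where "u = exp (- \<i> * complex_of_real \<omega>)"
  define v where "v = exp (\<i> * complex_of_real \<omega>)"
  have D0: "D \<noteq> 0" unfolding D_def by (rule cosh_minus_cos_nonzero[OF z \<Delta>])
  have D2: "2 * D = p + q - u - v"
    by (simp add: D_def p_def q_def u_def v_def cosh_def scaleR_conv_of_real cos_of_real[symmetric] cos_exp_eq algebra_simps)
  have s1: "sampled_factor 1 \<Delta> z \<omega> = (q - u) / (2 * D)"
    unfolding sampled_factor_1[OF z \<Delta>] q_def u_def D_def ..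
  have "sampled_factor 1 \<Delta> z (- \<omega>) - exp_kernel z (1 - 1) 0 = (q - v) / (2 * D) - 1"
    unfolding sampled_factor_1[OF z \<Delta>] by (simp add: q_def v_def D_def exp_kernel_def)
  also have "\<dots> = (q - v - 2 * D) / (2 * D)" using D0 by (simp add: diff_divide_distrib)
  also have "\<dots> = (u - p) / (2 * D)" unfolding D2 by simp
  finally have s2: "sampled_factor 1 \<Delta> z (- \<omega>) - exp_kernel z (1 - 1) 0 = (u - p) / (2 * D)" .
  show ?thesis
    unfolding s1 s2 D_def[symmetric] p_def[symmetric] q_def[symmetric] u_def[symmetric]
    using D0 by (simp add: vec_eq_iff matrix_smult_def transpose_def field_simps)
qed

text \<open>For \<open>j \<ge> 2\<close> the kernel vanishes at time 0, so lag 0 contributes nothing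
  and the two halves mirror each other in \<open>\<omega>\<close>. The factor \<open>2 \<pi>\<close>
  cancels against the one built into \<open>trig_numerator\<close>.\<close>

lemma multiple_pole_term:
  fixes A :: "complex ^ 'd ^ 'd"
  assumes z: "Re z < 0" and \<Delta>: "\<Delta> > 0" and j: "j \<ge> 2"
  shows "of_real (1 / (2 * pi)) *k ((sampled_factor j \<Delta> z (- \<omega>) - exp_kernel z (j - 1) 0) *k A
        + sampled_factor j \<Delta> z \<omega> *k transpose A)
    = (1 / (cosh (of_real \<Delta> * z) - of_real (cos \<omega>)) ^ j) *k
        (trig_numerator j \<Delta> z \<omega> *k transpose A + trig_numerator j \<Delta> z (- \<omega>) *k A)"
proof -
  define E where "E = (cosh (of_real \<Delta> * z) - complex_of_real (cos \<omega>)) ^ j"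
  have s: "sampled_factor j \<Delta> z \<omega> = 2 * of_real pi * (trig_numerator j \<Delta> z \<omega> / E)"
    "sampled_factor j \<Delta> z (- \<omega>) = 2 * of_real pi * (trig_numerator j \<Delta> z (- \<omega>) / E)"
    unfolding sampled_factor_trig[OF assms] E_def by simp_all
  have k0: "exp_kernel z (j - 1) 0 = 0" using j by (simp add: exp_kernel_def)
  show ?thesis
    unfolding s k0 E_def[symmetric]
    by (simp add: vec_eq_iff matrix_smult_def transpose_def add_divide_distrib)
qed

text \<open>The family \<open>s\<close> is quantified outermost and receives only \<open>j\<close>,
  \<open>\<Delta>\<close> and the zero, so the same trigonometric polynomials serve every
  process.\<close>

theorem proposition3:
  shows "\<exists>s :: nat \<Rightarrow> real \<Rightarrow> complex \<Rightarrow> real \<Rightarrow> complex.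
    (\<forall>j\<ge>2. \<forall>\<Delta>>0. \<forall>z. Re z < 0 \<longrightarrow> trig_poly_of_degree (j - 1) (s j \<Delta> z)) \<and>
    (\<forall>(p::nat) (q::nat) (A :: nat \<Rightarrow> real^'d^'d) (B :: nat \<Rightarrow> real^'d^'d)
       (M :: 'w measure) (L :: real \<Rightarrow> 'w \<Rightarrow> real^'d) (Y :: real \<Rightarrow> 'w \<Rightarrow> real^'d)
       P Q (m::nat) (\<zeta> :: nat \<Rightarrow> complex) (\<nu> :: nat \<Rightarrow> nat)
       (\<alpha> :: nat \<Rightarrow> nat \<Rightarrow> complex^'d^'d) (\<beta> :: nat \<Rightarrow> nat \<Rightarrow> complex^'d^'d).
      q < p \<and>
      P = ar_poly p A \<and> Q = ma_poly q B \<and>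
      (\<forall>z. poly (det P) z = 0 \<longrightarrow> Re z < 0) \<and>
      two_sided_levy_process M L \<and>
      integrable M (\<lambda>w. (norm (L 1 w))\<^sup>2) \<and>
      (LINT w|M. L 1 w) = 0 \<and>
      mcarma_process M L P Q Y \<and>
      bij_betw \<zeta> {1..m} {z. poly (det P) z = 0} \<and>
      (\<forall>l\<in>{1..m}. \<nu> l = order (\<zeta> l) (det P)) \<and>
      (\<forall>z. poly (det P) z \<noteq> 0 \<and> poly (det P) (- z) \<noteq> 0 \<longrightarrow>
         R_fun P Q (covariance_matrix M (L 1)) z =
           (\<Sum>l=1..m. \<Sum>j=1..\<nu> l.
              (1 / (z - \<zeta> l) ^ j) *k \<alpha> l j + (1 / (- z - \<zeta> l) ^ j) *k \<beta> l j))
      \<longrightarrow>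
      (\<forall>\<Delta>>0. \<forall>\<omega>\<in>{- pi<..<pi}.
         sampled_spectral_density M Y \<Delta> \<omega> =
           complex_of_real (1 / (4 * pi)) *k
             (\<Sum>l=1..m.
                (1 / (cosh (complex_of_real \<Delta> * \<zeta> l) - complex_of_real (cos \<omega>))) *k
                  (exp (- \<i> * complex_of_real \<omega>) *k (\<alpha> l 1 - transpose (\<alpha> l 1))
                   - exp (complex_of_real \<Delta> * \<zeta> l) *k \<alpha> l 1
                   + exp (- (complex_of_real \<Delta> * \<zeta> l)) *k transpose (\<alpha> l 1)))
         + (\<Sum>l=1..m. \<Sum>j=2..\<nu> l.
              (1 / (cosh (complex_of_real \<Delta> * \<zeta> l) - complex_of_real (cos \<omega>)) ^ j) *k
                (s j \<Delta> (\<zeta> l) \<omega> *k transpose (\<alpha> l j) + s j \<Delta> (\<zeta> l) (- \<omega>) *k \<alpha> l j))))"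
proof (intro exI[of _ trig_numerator] conjI allI impI ballI, goal_cases)
  case (1 j \<Delta> z)
  then show ?case by (intro trig_numerator_trig_poly)
next
  case (2 p q A B M L Y P Q m \<zeta> \<nu> \<alpha> \<beta> \<Delta> \<omega>)
  then have qp: "q < p" and P: "P = ar_poly p A" and Q: "Q = ma_poly q B"
    and roots: "\<And>z. poly (det P) z = 0 \<Longrightarrow> Re z < 0"
    and L: "two_sided_levy_process M L" "integrable M (\<lambda>w. (norm (L 1 w))\<^sup>2)" "(LINT w|M. L 1 w) = 0"
    and Y: "mcarma_process M L P Q Y" and bij: "bij_betw \<zeta> {1..m} {z. poly (det P) z = 0}"
    and \<nu>: "\<And>l. l \<in> {1..m} \<Longrightarrow> \<nu> l = order (\<zeta> l) (det P)"
    and R: "\<And>z. poly (det P) z \<noteq> 0 \<Longrightarrow> poly (det P) (- z) \<noteq> 0 \<Longrightarrow>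
         R_fun P Q (covariance_matrix M (L 1)) z =
           (\<Sum>l=1..m. \<Sum>j=1..\<nu> l.
              (1 / (z - \<zeta> l) ^ j) *k \<alpha> l j + (1 / (- z - \<zeta> l) ^ j) *k \<beta> l j)"
    and \<Delta>: "\<Delta> > 0"
    by blast+
  interpret second_order_noise M L "covariance_matrix M (L 1)"
    by (rule two_sided_second_order[OF L])
  have root: "poly (det P) (\<zeta> l) = 0" if "l \<in> {1..m}" for l
    using bij that by (auto simp: bij_betw_def)
  have \<zeta>: "Re (\<zeta> l) < 0" if "l \<in> {1..m}" for l
    using roots root[OF that] by blast
  have "degree (det P) = p * CARD('d)"
    unfolding P using qp by (intro degree_det_ar_poly) simp
  then have "det P \<noteq> 0" using qp by auto
  \<comment> \<open>Each \<open>\<zeta> l\<close> is a zero of the nonzero polynomial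
    \<open>det P\<close>, so its order is at least 1 and the summand \<open>j = 1\<close> can be
    split off.\<close>
  then have \<nu>1: "1 \<le> \<nu> l" if "l \<in> {1..m}" for l
    using root[OF that] \<nu>[OF that] by (simp add: order_root Suc_le_eq)
  have causal: "\<exists>h. causal_transform h
      (\<lambda>x. (matrix_inv (eval_mat P (\<i> * of_real x)) ** eval_mat Q (\<i> * of_real x)) $ i $ k)" for i k
    by (rule causal_transform_mcarma[OF P Q qp roots])
  \<comment> \<open>All zeros of \<open>det P\<close> have negative real part, so neither
    \<open>i x\<close> nor \<open>- i x\<close> is one of them and the decomposition holds on the
    whole imaginary axis.\<close>
  have Rx: "R_fun P Q (covariance_matrix M (L 1)) (\<i> * of_real x) = (\<Sum>l=1..m. \<Sum>j=1..\<nu> l.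
        (1 / (\<i> * of_real x - \<zeta> l) ^ j) *k \<alpha> l j + (1 / (- (\<i> * of_real x) - \<zeta> l) ^ j) *k \<beta> l j)" for x
    by (rule R) (use roots in force)+
  note autocov = autocov_partial_fractions[OF causal Y \<zeta> Rx]
  let ?T = "\<lambda>l j. (sampled_factor j \<Delta> (\<zeta> l) (- \<omega>) - exp_kernel (\<zeta> l) (j - 1) 0) *k \<alpha> l j
        + sampled_factor j \<Delta> (\<zeta> l) \<omega> *k transpose (\<alpha> l j)"
  have "((\<lambda>k::int. exp (- \<i> * of_int k * of_real \<omega>) *k cmatrix (autocov M Y (of_int k * \<Delta>))) has_sum
    (\<Sum>l=1..m. \<Sum>j=1..\<nu> l. ?T l j)) UNIV"
    using sampled_series[where \<Gamma> = "\<lambda>t. cmatrix (autocov M Y t)", OF \<Delta> \<zeta> autocov(1)] autocov(2)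
    by (simp only: transpose_cmatrix)
  then have "sampled_spectral_density M Y \<Delta> \<omega> = (\<Sum>l=1..m. \<Sum>j=1..\<nu> l. of_real (1 / (2 * pi)) *k ?T l j)"
    unfolding sampled_spectral_density_def by (simp only: infsumI matrix_smult_sum)
  also have "\<dots> = (\<Sum>l=1..m. of_real (1 / (2 * pi)) *k ?T l 1 + (\<Sum>j=2..\<nu> l. of_real (1 / (2 * pi)) *k ?T l j))"
    by (intro sum.cong refl) (simp only: sum.atLeast_Suc_atMost[OF \<nu>1] Suc_1)
  also have "\<dots> = (\<Sum>l=1..m. of_real (1 / (2 * pi)) *k ?T l 1) + (\<Sum>l=1..m. \<Sum>j=2..\<nu> l. of_real (1 / (2 * pi)) *k ?T l j)"
    by (rule sum.distrib)
  finally show ?case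
    unfolding matrix_smult_sum
    by (rule trans)
      (intro arg_cong2[where f = "(+)"] sum.cong refl simple_pole_term multiple_pole_term \<zeta> \<Delta>, auto)
qed

end
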